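(* Let $n\geq1$ and $r\ge2$ be integers, let $\pi_1,\ldots,\pi_n$ be independent uniformly distributed random permutations of $\{1,\ldots,r\}$, and let $F_r$ be Friedman's statistic built from them (see context). Then $$d_{\mathrm{K}}(\mathcal{L}(F_r),\chi_{(r-1)}^2)\leq\begin{cases}\displaystyle\frac{0.9496}{\sqrt{n}}, & r=2,\\[2mm] \displaystyle\frac{30}{n^{1/4}}+\frac{75}{n^{1/2}}+\frac{120}{n^{3/4}}+\frac{8}{n^{5/4}}+\frac{36}{n^{3/2}}, & r=3,\\[2mm] \displaystyle\frac{13r^{1/8}}{n^{1/4}}\bigg(1+\frac{1}{r}\bigg)+\frac{46}{r^{1/4}n^{1/2}}+\frac{54r^{3/8}}{n^{3/4}}+\frac{3r^{1/8}}{n^{5/4}}+\frac{8r^{3/4}}{n^{3/2}}, & r\geq4.\end{cases}$$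
   Context: Friedman's statistic: for $1\le i\le n$ and $1\le j\le r$ put $\rho_i(j)=\pi_i(j)-(r+1)/2$, $$S_j=\frac{\sqrt{12}}{\sqrt{r(r+1)n}}\sum_{i=1}^n\rho_i(j),\qquad F_r=\sum_{j=1}^r S_j^2 .$$ $\mathcal{L}(F_r)$ is the law of $F_r$, $\chi_{(p)}^2$ is the chi-square distribution with $p$ degrees of freedom, and the Kolmogorov distance is $d_{\mathrm{K}}(\mathcal{L}(F_r),\chi_{(r-1)}^2)=\sup_{z\geq0}|\mathbb{P}(F_r\leq z)-\mathbb{P}(Y_{r-1}\leq z)|$ with $Y_{r-1}\sim\chi_{(r-1)}^2$. *)

theory Defs
  imports "HOL-Probability.Probability" "HOL-Combinatorics.Permutations"
begin

definition friedman_rho :: "nat \<Rightarrow> (nat \<Rightarrow> nat) \<Rightarrow> nat \<Rightarrow> real" where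
  "friedman_rho r p j = real (p j) - (real r + 1) / 2"

definition friedman_S :: "nat \<Rightarrow> nat \<Rightarrow> (nat \<Rightarrow> nat \<Rightarrow> nat) \<Rightarrow> nat \<Rightarrow> real" where
  "friedman_S n r p j =
     sqrt 12 / sqrt (real r * (real r + 1) * real n) * (\<Sum>i=1..n. friedman_rho r (p i) j)"

definition friedman_F :: "nat \<Rightarrow> nat \<Rightarrow> (nat \<Rightarrow> nat \<Rightarrow> nat) \<Rightarrow> real" where
  "friedman_F n r p = (\<Sum>j=1..r. (friedman_S n r p j)\<^sup>2)"

text \<open>The chi-square distribution with \<open>p\<close> degrees of freedom, as the law of the sum of the
  squares of \<open>p\<close> independent standard normal random variables.\<close>

definition chi_square :: "nat \<Rightarrow> real measure" where
  "chi_square p =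
     distr (\<Pi>\<^sub>M k\<in>{..<p}. density lborel (\<lambda>x. ennreal (std_normal_density x))) borel
       (\<lambda>x. \<Sum>k<p. (x k)\<^sup>2)"

text \<open>The supremum is restricted to nonnegative \<open>z\<close>, which is the full Kolmogorov distance
  for laws supported on the nonnegative half-line.\<close>

definition kolmogorov_dist :: "real measure \<Rightarrow> real measure \<Rightarrow> real" where
  "kolmogorov_dist \<mu> \<nu> = (SUP z\<in>{0..}. \<bar>measure \<mu> {..z} - measure \<nu> {..z}\<bar>)"

end

theory Submission
  imports Defs "HOL-Real_Asymp.Real_Asymp"
begin

text \<open>For \<open>r \<ge> 3\<close> put \<open>d = r - 1\<close> and \<open>X\<^sub>i = \<surd>(12 / (r (r + 1) n)) \<rho>\<^sub>i\<close>, so that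
  \<open>F = \<bar>X\<^sub>1 + \<dots> + X\<^sub>n\<bar>\<^sup>2\<close>. The Stein equation \<open>2 x f' + (d - x) f = h - E h\<close> is solved for a smoothed
  indicator \<open>h\<close> of width of order \<open>\<surd>d n\<^bsup>-1/4\<^esup>\<close>; the derivatives of \<open>f\<close> solve equations of the same type
  with \<open>d + 2 k\<close> in place of \<open>d\<close>, which bounds them uniformly in \<open>d\<close>. Write \<open>F = q + d / n + 2 \<eta>\<close>, where
  \<open>q\<close> is the squared length of the sum without \<open>X\<^sub>i\<close>, \<open>\<eta>\<close> is its inner product with \<open>X\<^sub>i\<close>, and
  \<open>\<bar>X\<^sub>i\<bar>\<^sup>2 = d / n\<close> is deterministic. Given \<open>q\<close>, the variable \<open>\<eta>\<close> is symmetric with variance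
  \<open>q / n\<close> and fourth moment at most \<open>18 (q / n)\<^sup>2\<close>, so expanding the Stein operator around \<open>q + d / n\<close>
  leaves an error of order \<open>1 / n\<close> times the third derivative of \<open>f\<close>.

  For \<open>r = 2\<close> the statistic is \<open>B\<^sup>2 / n\<close> for a simple random walk \<open>B\<close>. Fourier inversion shows that
  \<open>P(\<bar>B\<bar> < y)\<close>, for integers \<open>y\<close> strictly between two lattice points, is within \<open>O(1 / n)\<close> of its Gaussian
  counterpart; moving \<open>y\<close> by at most 1 costs \<open>2 / \<surd>(2 \<pi> n)\<close>, which leaves room below
  \<open>0.9496 / \<surd>n\<close>.\<close>

section \<open>Moments of rank statistics of a uniform permutation\<close>

text \<open>The exponent 1/4 comes from the smoothing. The chi-square density is at most of order
  \<open>1 / \<surd>d\<close>, so a step of width \<alpha> costs about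
  \<open>\<alpha> / \<surd>d\<close>, while the third derivative of the step makes the Stein
  remainder of order \<open>(\<surd>d / \<alpha>)^3 / n\<close>. The two balance when \<alpha> is of
  order \<open>\<surd>d n^(-1/4)\<close>, and then neither depends on \<open>d\<close>. The outcome
  is a constant over \<open>n^(1/4)\<close>, uniform in \<open>r\<close>; it is wanted only for
  \<open>n^(1/4) \<ge> 15.34\<close>, because below that the claimed bound is at least 1.

  Two obstacles shape the argument. The Stein solution is controlled only on the open half-line,
  whereas \<open>F\<close> may vanish; it is therefore shifted by some \<open>s > 0\<close>, and
  \<open>s\<close> tends to 0 at the end. And one degree of freedom escapes this route altogether:
  its density is unbounded at 0, so narrow windows are not cheap near 0, the barrier asks for
  \<open>m \<ge> 2\<close>, and smoothing would give only \<open>n^(-1/4)\<close> where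
  \<open>n^(-1/2)\<close> is claimed.\<close>

abbreviation perms :: "nat \<Rightarrow> (nat \<Rightarrow> nat) set" where
  "perms r \<equiv> {p. p permutes {1..r}}"

lemma finite_perms: "finite (perms r)"
  by (simp add: finite_permutations)

lemma card_perms: "card (perms r) = fact r"
  by (simp add: card_permutations)

lemma sum_friedman_rho_power:
  assumes "p \<in> perms r"
  shows "(\<Sum>j=1..r. friedman_rho r p j ^ k) = (\<Sum>j=1..r. (real j - (real r + 1) / 2) ^ k)"
  unfolding friedman_rho_def
  using sum.permute[of p "{1..r}" "\<lambda>j. (real j - (real r + 1) / 2) ^ k"] assms
  by (simp add: o_def)

lemma sum_friedman_rho:
  assumes "p \<in> perms r"
  shows "(\<Sum>j=1..r. friedman_rho r p j) = 0"
proof -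
  have "(\<Sum>j=1..r. (real j - (real r + 1) / 2)) = 0"
  proof -
    \<comment> \<open>The centre is detached from the upper limit so that induction on
      \<open>m\<close> goes through.\<close>
    have "(\<Sum>j=1..m. (real j - a)) = real m * (real m + 1) / 2 - real m * a" for m and a :: real
      by (induction m) (auto simp: field_simps)
    from this[where a = "(real r + 1) / 2" and m = r] show ?thesis by simp
  qed
  then show ?thesis using sum_friedman_rho_power[OF assms, of 1] by simp
qed

lemma sum_friedman_rho_square:
  assumes "p \<in> perms r"
  shows "(\<Sum>j=1..r. (friedman_rho r p j)\<^sup>2) = real r * ((real r)\<^sup>2 - 1) / 12"
proof -
  have "(\<Sum>j=1..m. (real j - a)\<^sup>2)
      = real m * (real m + 1) * (2 * real m + 1) / 6 - a * real m * (real m + 1) + real m * a\<^sup>2" for m and a :: real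
    by (induction m) (auto simp: field_simps power2_eq_square)
  from this[where a = "(real r + 1) / 2" and m = r]
  have "(\<Sum>j=1..r. (real j - (real r + 1) / 2)\<^sup>2) = real r * ((real r)\<^sup>2 - 1) / 12"
    by (simp add: field_simps power2_eq_square)
  then show ?thesis using sum_friedman_rho_power[OF assms, of 2] by simp
qed

text \<open>A linear rank statistic. With \<open>w\<close> the rank sum of the other permutations it
  is, up to scale, the inner product \<eta> of the overview.\<close>

definition rank_stat :: "nat \<Rightarrow> (nat \<Rightarrow> real) \<Rightarrow> (nat \<Rightarrow> nat) \<Rightarrow> real" where
  "rank_stat r w p = (\<Sum>j=1..r. w j * friedman_rho r p j)"

text \<open>Replacing each rank \<open>k\<close> by \<open>r + 1 - k\<close> is a bijection of the
  permutations and negates every centred rank. Hence the statistic is symmetric and its odd moments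
  vanish.\<close>

lemma sum_perms_reverse:
  fixes g :: "real \<Rightarrow> real"
  shows "(\<Sum>p\<in>perms r. g (rank_stat r w p)) = (\<Sum>p\<in>perms r. g (- rank_stat r w p))"
proof -
  define s where "s = (\<lambda>j::nat. if j \<in> {1..r} then r + 1 - j else j)"
  have s: "s permutes {1..r}"
    by (rule bij_imp_permutes, rule bij_betw_byWitness[where f' = s]) (auto simp: s_def)
  have "rank_stat r w (s \<circ> p) = - rank_stat r w p" if "p \<in> perms r" for p
  proof -
    have "friedman_rho r (s \<circ> p) j = - friedman_rho r p j" if j: "j \<in> {1..r}" for j
    proof -
      have "p j \<in> {1..r}" using \<open>p \<in> perms r\<close> j permutes_in_image[of p "{1..r}" j] by simp
      then show ?thesis unfolding friedman_rho_def s_def by (auto simp: of_nat_diff field_simps)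
    qed
    then show ?thesis unfolding rank_stat_def by (simp add: sum_negf)
  qed
  moreover have "(\<Sum>p\<in>perms r. g (rank_stat r w p)) = (\<Sum>p\<in>perms r. g (rank_stat r w (s \<circ> p)))"
    using setum_permutations_compose_left[OF s, of "\<lambda>p. g (rank_stat r w p)"] by simp
  ultimately show ?thesis by simp
qed

lemma sum_rank_stat: "(\<Sum>p\<in>perms r. rank_stat r w p) = 0"
  using sum_perms_reverse[of "\<lambda>x. x" r w] by (simp add: sum_negf)

lemma sum_rank_stat_cube: "(\<Sum>p\<in>perms r. rank_stat r w p ^ 3) = 0"
  using sum_perms_reverse[of "\<lambda>x. x ^ 3" r w] by (simp add: sum_negf)

text \<open>Only the two swapped summands change. The increment is a product of a difference of
  weights and a difference of ranks, which is what makes the exchangeable pair tractable.\<close>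

lemma rank_stat_transpose:
  assumes I: "I \<in> {1..r}" and J: "J \<in> {1..r}"
  shows "rank_stat r w (p \<circ> Transposition.transpose I J)
    = rank_stat r w p - (w I - w J) * (friedman_rho r p I - friedman_rho r p J)"
proof (cases "I = J")
  case True
  then show ?thesis by simp
next
  case False
  have rho: "friedman_rho r (p \<circ> Transposition.transpose I J) j = friedman_rho r p (Transposition.transpose I J j)" for j
    by (simp add: friedman_rho_def)
  have split: "(\<Sum>j=1..r. f j) = f I + f J + (\<Sum>j\<in>{1..r} - {I, J}. f j)" for f :: "nat \<Rightarrow> real"
    using False I J sum.subset_diff[of "{I, J}" "{1..r}" f] by simp
  have "(\<Sum>j\<in>{1..r} - {I, J}. w j * friedman_rho r p (Transposition.transpose I J j))
      = (\<Sum>j\<in>{1..r} - {I, J}. w j * friedman_rho r p j)"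
    by (rule sum.cong) (auto simp: Transposition.transpose_def)
  then show ?thesis
    unfolding rank_stat_def rho split[of "\<lambda>j. w j * friedman_rho r p (Transposition.transpose I J j)"]
      split[of "\<lambda>j. w j * friedman_rho r p j"]
    by (simp add: algebra_simps)
qed

lemma sum_perms_transpose:
  fixes g :: "(nat \<Rightarrow> nat) \<Rightarrow> real"
  assumes "I \<in> {1..r}" and "J \<in> {1..r}"
  shows "(\<Sum>p\<in>perms r. g (p \<circ> Transposition.transpose I J)) = (\<Sum>p\<in>perms r. g p)"
  using sum_permutations_compose_right[OF permutes_swap_id[OF assms], of g] by simp

lemma sum_pairs_diff_mult:
  fixes a b :: "nat \<Rightarrow> real"
  assumes "finite A"
  shows "(\<Sum>i\<in>A. \<Sum>j\<in>A. (a i - a j) * (b i - b j))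
    = 2 * real (card A) * (\<Sum>i\<in>A. a i * b i) - 2 * (\<Sum>i\<in>A. a i) * (\<Sum>i\<in>A. b i)"
proof -
  have "(\<Sum>i\<in>A. \<Sum>j\<in>A. (a i - a j) * (b i - b j))
     = (\<Sum>i\<in>A. \<Sum>j\<in>A. a i * b i) + (\<Sum>i\<in>A. \<Sum>j\<in>A. a j * b j)
       - (\<Sum>i\<in>A. \<Sum>j\<in>A. a i * b j) - (\<Sum>i\<in>A. \<Sum>j\<in>A. b i * a j)"
    by (simp only: sum.distrib[symmetric] sum_subtractf[symmetric]) (simp add: algebra_simps)
  also have "(\<Sum>i\<in>A. \<Sum>j\<in>A. a i * b j) = (\<Sum>i\<in>A. a i) * (\<Sum>i\<in>A. b i)"
    by (simp add: sum_product)
  also have "(\<Sum>i\<in>A. \<Sum>j\<in>A. b i * a j) = (\<Sum>i\<in>A. b i) * (\<Sum>i\<in>A. a i)"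
    by (simp add: sum_product)
  also have "(\<Sum>i\<in>A. \<Sum>j\<in>A. a i * b i) = real (card A) * (\<Sum>i\<in>A. a i * b i)"
    by (simp add: sum_distrib_left)
  also have "(\<Sum>i\<in>A. \<Sum>j\<in>A. a j * b j) = real (card A) * (\<Sum>i\<in>A. a i * b i)"
    by simp
  finally show ?thesis by simp
qed

text \<open>By invariance under transpositions all coordinates have the same average, and their
  total is deterministic.\<close>

lemma sum_perms_rho_square:
  assumes I: "I \<in> {1..r}"
  shows "(\<Sum>p\<in>perms r. (friedman_rho r p I)\<^sup>2) = fact r * ((real r)\<^sup>2 - 1) / 12"
proof -
  have eq: "(\<Sum>p\<in>perms r. (friedman_rho r p J)\<^sup>2) = (\<Sum>p\<in>perms r. (friedman_rho r p I)\<^sup>2)"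
    if J: "J \<in> {1..r}" for J
    using sum_perms_transpose[OF I J, of "\<lambda>p. (friedman_rho r p I)\<^sup>2"]
    by (simp add: friedman_rho_def)
  have "real r * (\<Sum>p\<in>perms r. (friedman_rho r p I)\<^sup>2)
      = (\<Sum>J=1..r. \<Sum>p\<in>perms r. (friedman_rho r p J)\<^sup>2)"
    using eq by simp
  also have "\<dots> = (\<Sum>p\<in>perms r. \<Sum>J=1..r. (friedman_rho r p J)\<^sup>2)"
    by (rule sum.swap)
  also have "\<dots> = fact r * (real r * ((real r)\<^sup>2 - 1) / 12)"
    by (subst sum.cong[OF refl sum_friedman_rho_square]) (simp_all add: card_permutations)
  finally have "real r * (\<Sum>p\<in>perms r. (friedman_rho r p I)\<^sup>2)
      = real r * (fact r * ((real r)\<^sup>2 - 1) / 12)"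
    by simp
  then show ?thesis using I by simp
qed

text \<open>The average is the same for every partner of \<open>I\<close>; summing over all partners
  leaves the centred sum, which vanishes, and two known sums of squares.\<close>

lemma sum_perms_rho_diff_square:
  assumes I: "I \<in> {1..r}" and J: "J \<in> {1..r}" and "I \<noteq> J"
  shows "(\<Sum>p\<in>perms r. (friedman_rho r p I - friedman_rho r p J)\<^sup>2)
    = fact r * real r * (real r + 1) / 6"
proof -
  let ?D = "\<lambda>J. \<Sum>p\<in>perms r. (friedman_rho r p I - friedman_rho r p J)\<^sup>2"
  have eq: "?D K = ?D J" if K: "K \<in> {1..r}" "K \<noteq> I" for K
    using sum_perms_transpose[OF J K(1), of "\<lambda>p. (friedman_rho r p I - friedman_rho r p J)\<^sup>2"] K \<open>I \<noteq> J\<close>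
    by (simp add: friedman_rho_def Transposition.transpose_def)
  have "(real r - 1) * ?D J = (\<Sum>K\<in>{1..r} - {I}. ?D K)"
    using eq I by (simp add: of_nat_diff)
  also have "\<dots> = (\<Sum>K=1..r. ?D K)"
    using I by (subst sum.remove[of "{1..r}" I]) simp_all
  also have "\<dots> = (\<Sum>p\<in>perms r. \<Sum>K=1..r. (friedman_rho r p I - friedman_rho r p K)\<^sup>2)"
    by (rule sum.swap)
  also have "\<dots> = (\<Sum>p\<in>perms r. real r * (friedman_rho r p I)\<^sup>2 + real r * ((real r)\<^sup>2 - 1) / 12)"
  proof (rule sum.cong[OF refl])
    fix p assume p: "p \<in> perms r"
    have "(\<Sum>K=1..r. (friedman_rho r p I - friedman_rho r p K)\<^sup>2)
       = real r * (friedman_rho r p I)\<^sup>2 - 2 * friedman_rho r p I * (\<Sum>K=1..r. friedman_rho r p K)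
          + (\<Sum>K=1..r. (friedman_rho r p K)\<^sup>2)"
      by (simp add: power2_diff sum.distrib sum_subtractf sum_distrib_left mult.assoc)
    then show "(\<Sum>K=1..r. (friedman_rho r p I - friedman_rho r p K)\<^sup>2)
       = real r * (friedman_rho r p I)\<^sup>2 + real r * ((real r)\<^sup>2 - 1) / 12"
      using sum_friedman_rho[OF p] sum_friedman_rho_square[OF p] by simp
  qed
  also have "\<dots> = real r * (fact r * ((real r)\<^sup>2 - 1) / 12) + fact r * (real r * ((real r)\<^sup>2 - 1) / 12)"
    using sum_perms_rho_square[OF I]
    by (simp only: sum.distrib sum_distrib_left[symmetric]) (simp add: card_permutations)
  also have "\<dots> = (real r - 1) * (fact r * real r * (real r + 1) / 6)"
    by (simp add: field_simps power2_eq_square)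
  finally show ?thesis using I J \<open>I \<noteq> J\<close> by force
qed

section \<open>Second and fourth moments of a centred linear rank statistic\<close>

context
  fixes r :: nat and w :: "nat \<Rightarrow> real"
  assumes centered: "(\<Sum>j=1..r. w j) = 0"
begin

text \<open>The regression property of the exchangeable pair: summed over all transpositions, the
  increment is proportional to the statistic itself.\<close>

lemma sum_pairs_transpose_increment:
  assumes "p \<in> perms r"
  shows "(\<Sum>I=1..r. \<Sum>J=1..r. (w I - w J) * (friedman_rho r p I - friedman_rho r p J))
    = 2 * real r * rank_stat r w p"
  using sum_pairs_diff_mult[of "{1..r}" w "friedman_rho r p"] centered
  by (simp add: rank_stat_def)

lemma sum_pairs_diff_square:
  "(\<Sum>I=1..r. \<Sum>J=1..r. (w I - w J)\<^sup>2) = 2 * real r * (\<Sum>j=1..r. (w j)\<^sup>2)"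
  using sum_pairs_diff_mult[of "{1..r}" w w] centered by (simp add: power2_eq_square)

text \<open>A transposition turns \<open>M\<close> into \<open>M - d\<close> and preserves the total
  of the squares, so \<open>2 M d\<close> and \<open>d^2\<close> have the same total. Summed over
  all transpositions, the former becomes a multiple of \<open>M^2\<close> by the regression property
  and the latter is known from the differences of two ranks.\<close>

lemma sum_rank_stat_square:
  "(\<Sum>p\<in>perms r. (rank_stat r w p)\<^sup>2)
    = fact r * ((\<Sum>j=1..r. (w j)\<^sup>2) * real r * (real r + 1) / 12)"
proof (cases "r = 0")
  case True
  then show ?thesis by (simp add: rank_stat_def)
next
  case False
  let ?d = "\<lambda>p I J. (w I - w J) * (friedman_rho r p I - friedman_rho r p J)"
  have pair: "2 * (\<Sum>p\<in>perms r. rank_stat r w p * ?d p I J) = (\<Sum>p\<in>perms r. (?d p I J)\<^sup>2)"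
    if "I \<in> {1..r}" "J \<in> {1..r}" for I J
  proof -
    have "(\<Sum>p\<in>perms r. (rank_stat r w p - ?d p I J)\<^sup>2) = (\<Sum>p\<in>perms r. (rank_stat r w p)\<^sup>2)"
      using sum_perms_transpose[OF that, of "\<lambda>p. (rank_stat r w p)\<^sup>2"]
      by (simp add: rank_stat_transpose[OF that])
    then show ?thesis
      by (simp add: power2_diff sum.distrib sum_subtractf sum_distrib_left mult.assoc)
  qed
  have "4 * real r * (\<Sum>p\<in>perms r. (rank_stat r w p)\<^sup>2)
      = 2 * (\<Sum>p\<in>perms r. rank_stat r w p * (2 * real r * rank_stat r w p))"
    by (simp add: sum_distrib_left power2_eq_square algebra_simps)
  also have "\<dots> = 2 * (\<Sum>p\<in>perms r. \<Sum>I=1..r. \<Sum>J=1..r. rank_stat r w p * ?d p I J)"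
    by (simp add: sum_pairs_transpose_increment[symmetric] sum_distrib_left)
  also have "(\<Sum>p\<in>perms r. \<Sum>I=1..r. \<Sum>J=1..r. rank_stat r w p * ?d p I J)
      = (\<Sum>I=1..r. \<Sum>J=1..r. \<Sum>p\<in>perms r. rank_stat r w p * ?d p I J)"
    by (subst sum.swap, intro sum.cong refl, rule sum.swap)
  also have "2 * \<dots> = (\<Sum>I=1..r. \<Sum>J=1..r. 2 * (\<Sum>p\<in>perms r. rank_stat r w p * ?d p I J))"
    by (simp only: sum_distrib_left)
  also have "\<dots> = (\<Sum>I=1..r. \<Sum>J=1..r. \<Sum>p\<in>perms r. (?d p I J)\<^sup>2)"
    by (intro sum.cong refl pair)
  also have "\<dots> = (\<Sum>I=1..r. \<Sum>J=1..r. (w I - w J)\<^sup>2 * (fact r * real r * (real r + 1) / 6))"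
  proof (intro sum.cong refl)
    fix I J assume "I \<in> {1..r}" "J \<in> {1..r}"
    then show "(\<Sum>p\<in>perms r. (?d p I J)\<^sup>2) = (w I - w J)\<^sup>2 * (fact r * real r * (real r + 1) / 6)"
      using sum_perms_rho_diff_square[of I r J]
      by (cases "I = J") (simp_all add: power_mult_distrib sum_distrib_left[symmetric])
  qed
  also have "\<dots> = 2 * real r * (\<Sum>j=1..r. (w j)\<^sup>2) * (fact r * real r * (real r + 1) / 6)"
    by (simp only: sum_distrib_right[symmetric] sum_pairs_diff_square)
  finally have "real r * (\<Sum>p\<in>perms r. (rank_stat r w p)\<^sup>2)
      = real r * (fact r * ((\<Sum>j=1..r. (w j)\<^sup>2) * real r * (real r + 1) / 12))"
    by (simp add: field_simps)
  then show ?thesis using False by simp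
qed

text \<open>Composing with a transposition gives an exchangeable pair, so
  \<open>(M' - M) (M'\<^sup>3 + M\<^sup>3)\<close> averages to zero; summed over all transpositions this
  bounds the fourth moment by the second.\<close>

lemma sum_rank_stat_fourth:
  "(\<Sum>p\<in>perms r. rank_stat r w p ^ 4)
    \<le> 18 * fact r * ((\<Sum>j=1..r. (w j)\<^sup>2) * real r * (real r + 1) / 12)\<^sup>2"
proof (cases "r = 0")
  case True
  then show ?thesis by (simp add: rank_stat_def)
next
  case False
  let ?d = "\<lambda>p I J. (w I - w J) * (friedman_rho r p I - friedman_rho r p J)"
  let ?M = "rank_stat r w"
  let ?W = "\<Sum>j=1..r. (w j)\<^sup>2"
  have pair: "(\<Sum>p\<in>perms r. ?M p ^ 3 * ?d p I J) \<le> 3 / 2 * (\<Sum>p\<in>perms r. (?M p)\<^sup>2 * (?d p I J)\<^sup>2)"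
    if IJ: "I \<in> {1..r}" "J \<in> {1..r}" for I J
  proof -
    let ?t = "Transposition.transpose I J"
    have M': "?M (p \<circ> ?t) = ?M p - ?d p I J" for p
      by (rule rank_stat_transpose[OF IJ])
    have d': "?d (p \<circ> ?t) I J = - ?d p I J" for p
      by (simp add: friedman_rho_def algebra_simps)
    have sw: "(\<Sum>p\<in>perms r. (?M p - ?d p I J) ^ 3 * ?d p I J) = - (\<Sum>p\<in>perms r. ?M p ^ 3 * ?d p I J)"
      using sum_perms_transpose[OF IJ, of "\<lambda>p. ?M p ^ 3 * ?d p I J"]
      unfolding M' d' by (simp add: sum_negf)
    have sw2: "(\<Sum>p\<in>perms r. (?M p - ?d p I J)\<^sup>2 * (?d p I J)\<^sup>2) = (\<Sum>p\<in>perms r. (?M p)\<^sup>2 * (?d p I J)\<^sup>2)"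
      using sum_perms_transpose[OF IJ, of "\<lambda>p. (?M p)\<^sup>2 * (?d p I J)\<^sup>2"]
      unfolding M' d' by simp
    \<comment> \<open>The trapezoidal rule overestimates the integral of the convex function
      \<open>3 s^2\<close> between \<open>m - d\<close> and \<open>m\<close>; after multiplication
      by \<open>d\<close> the excess is \<open>d^4 / 2\<close>.\<close>
    have pt: "(m ^ 3 - (m - d) ^ 3) * d \<le> 3 / 2 * (m\<^sup>2 * d\<^sup>2 + (m - d)\<^sup>2 * d\<^sup>2)" for m d :: real
    proof -
      have "3 / 2 * (m\<^sup>2 * d\<^sup>2 + (m - d)\<^sup>2 * d\<^sup>2) - (m ^ 3 - (m - d) ^ 3) * d = d\<^sup>2 * d\<^sup>2 / 2"
        by (simp add: algebra_simps power2_eq_square power3_eq_cube)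
      moreover have "d\<^sup>2 * d\<^sup>2 / 2 \<ge> 0" by simp
      ultimately show ?thesis by linarith
    qed
    have half: "3 / 2 * (x + x) = 3 * x" for x :: real
      by simp
    have "2 * (\<Sum>p\<in>perms r. ?M p ^ 3 * ?d p I J)
        = (\<Sum>p\<in>perms r. (?M p ^ 3 - (?M p - ?d p I J) ^ 3) * ?d p I J)"
      using sw by (simp only: left_diff_distrib sum_subtractf)
    also have "\<dots> \<le> (\<Sum>p\<in>perms r. 3 / 2 * ((?M p)\<^sup>2 * (?d p I J)\<^sup>2 + (?M p - ?d p I J)\<^sup>2 * (?d p I J)\<^sup>2))"
      by (intro sum_mono pt)
    also have "\<dots> = 3 * (\<Sum>p\<in>perms r. (?M p)\<^sup>2 * (?d p I J)\<^sup>2)"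
      unfolding sum_distrib_left[symmetric] sum.distrib sw2 by (rule half)
    finally show ?thesis by simp
  qed
  \<comment> \<open>Two ranks differ by at most \<open>r - 1\<close>, so one squared increment can
    be replaced by a constant for each pair, and only a second moment of \<open>M\<close>
    remains.\<close>
  have d_le: "(?d p I J)\<^sup>2 \<le> (w I - w J)\<^sup>2 * (real r - 1)\<^sup>2"
    if "p \<in> perms r" "I \<in> {1..r}" "J \<in> {1..r}" for p I J
  proof -
    have "p I \<in> {1..r}" "p J \<in> {1..r}"
      using that permutes_in_image[of p "{1..r}"] by auto
    then have "\<bar>friedman_rho r p I - friedman_rho r p J\<bar> \<le> real r - 1"
      by (auto simp: friedman_rho_def)
    then have "(friedman_rho r p I - friedman_rho r p J)\<^sup>2 \<le> (real r - 1)\<^sup>2"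
      by (metis abs_ge_zero power2_abs power_mono)
    then show ?thesis by (simp add: power_mult_distrib mult_left_mono)
  qed
  have "2 * real r * (\<Sum>p\<in>perms r. ?M p ^ 4)
      = (\<Sum>p\<in>perms r. ?M p ^ 3 * (2 * real r * ?M p))"
    by (simp add: sum_distrib_left power_numeral_reduce algebra_simps)
  also have "\<dots> = (\<Sum>p\<in>perms r. \<Sum>I=1..r. \<Sum>J=1..r. ?M p ^ 3 * ?d p I J)"
    by (simp add: sum_pairs_transpose_increment[symmetric] sum_distrib_left)
  also have "\<dots> = (\<Sum>I=1..r. \<Sum>J=1..r. \<Sum>p\<in>perms r. ?M p ^ 3 * ?d p I J)"
    by (subst sum.swap, intro sum.cong refl, rule sum.swap)
  also have "\<dots> \<le> (\<Sum>I=1..r. \<Sum>J=1..r. 3 / 2 * (\<Sum>p\<in>perms r. (?M p)\<^sup>2 * (?d p I J)\<^sup>2))"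
    by (intro sum_mono pair)
  also have "\<dots> \<le> (\<Sum>I=1..r. \<Sum>J=1..r. 3 / 2 * (\<Sum>p\<in>perms r. (?M p)\<^sup>2 * ((w I - w J)\<^sup>2 * (real r - 1)\<^sup>2)))"
    by (intro sum_mono mult_left_mono d_le) auto
  also have "\<dots> = 3 / 2 * (\<Sum>p\<in>perms r. (?M p)\<^sup>2) * (real r - 1)\<^sup>2 * (\<Sum>I=1..r. \<Sum>J=1..r. (w I - w J)\<^sup>2)"
  proof -
    have "3 / 2 * (\<Sum>p\<in>perms r. (?M p)\<^sup>2 * ((w I - w J)\<^sup>2 * (real r - 1)\<^sup>2))
      = (3 / 2 * (\<Sum>p\<in>perms r. (?M p)\<^sup>2) * (real r - 1)\<^sup>2) * (w I - w J)\<^sup>2" for I J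
      by (simp only: sum_distrib_right[symmetric]) simp
    then show ?thesis by (simp only: sum_distrib_left)
  qed
  also have "\<dots> = 2 * real r * (3 / 2 * (real r - 1)\<^sup>2 * ?W * (fact r * (?W * real r * (real r + 1) / 12)))"
    unfolding sum_pairs_diff_square sum_rank_stat_square by (simp add: algebra_simps)
  finally have "(\<Sum>p\<in>perms r. ?M p ^ 4) \<le> 3 / 2 * (real r - 1)\<^sup>2 * ?W * (fact r * (?W * real r * (real r + 1) / 12))"
    using False by (simp add: mult_le_cancel_left)
  also have "\<dots> = (real r - 1)\<^sup>2 * (3 / 2 * ?W * (fact r * (?W * real r * (real r + 1) / 12)))"
    by simp
  \<comment> \<open>The factor is enlarged to \<open>r (r + 1)\<close>, which is 12 times the
    variance factor \<open>r (r + 1) / 12\<close>; the constant 18 is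
    \<open>3/2 * 12\<close>.\<close>
  also have "\<dots> \<le> (real r * (real r + 1)) * (3 / 2 * ?W * (fact r * (?W * real r * (real r + 1) / 12)))"
  proof (rule mult_right_mono)
    show "(real r - 1)\<^sup>2 \<le> real r * (real r + 1)"
      using False by (simp add: power2_eq_square algebra_simps)
    show "0 \<le> 3 / 2 * ?W * (fact r * (?W * real r * (real r + 1) / 12))"
      by (intro mult_nonneg_nonneg divide_nonneg_nonneg sum_nonneg) auto
  qed
  also have "\<dots> = 18 * fact r * (?W * real r * (real r + 1) / 12)\<^sup>2"
    by (simp add: power2_eq_square field_simps)
  finally show ?thesis .
qed

end

section \<open>The chi-square distribution\<close>

lemma prob_space_std_normal: "prob_space std_normal_distribution"
  using prob_space_normal_density[of 1 0] by simp

lemma sets_chi_square [simp]: "sets (chi_square p) = sets borel"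
  by (simp add: chi_square_def)

lemma measurable_sum_squares:
  "(\<lambda>x. \<Sum>k\<in>A. (x k)\<^sup>2) \<in> borel_measurable (\<Pi>\<^sub>M k\<in>A. std_normal_distribution)"
  by measurable

lemma prob_space_PiM_std_normal: "prob_space (\<Pi>\<^sub>M k\<in>A. std_normal_distribution)"
  by (intro prob_space_PiM prob_space_std_normal)

lemma prob_space_chi_square: "prob_space (chi_square p)"
  unfolding chi_square_def
  by (intro prob_space.prob_space_distr prob_space_PiM_std_normal measurable_sum_squares)

lemma chi_square_1: "chi_square 1 = distr std_normal_distribution borel (\<lambda>x. x\<^sup>2)"
proof -
  have "std_normal_distribution = distr (\<Pi>\<^sub>M k\<in>{..<1::nat}. std_normal_distribution) std_normal_distribution (\<lambda>x. x 0)"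
    by (rule distr_PiM_component[symmetric]) (auto simp: prob_space_std_normal)
  then have "distr std_normal_distribution borel (\<lambda>x. x\<^sup>2)
      = distr (distr (\<Pi>\<^sub>M k\<in>{..<1::nat}. std_normal_distribution) std_normal_distribution (\<lambda>x. x 0)) borel (\<lambda>x. x\<^sup>2)"
    by simp
  also have "\<dots> = distr (\<Pi>\<^sub>M k\<in>{..<1::nat}. std_normal_distribution) borel ((\<lambda>x. x\<^sup>2) \<circ> (\<lambda>x. x 0))"
    by (intro distr_distr) auto
  also have "\<dots> = chi_square 1"
    unfolding chi_square_def by (intro distr_cong) auto
  finally show ?thesis by simp
qed

text \<open>The last coordinate splits off as an independent factor, and the law of an independent
  sum is a convolution.\<close>

lemma chi_square_Suc: "chi_square (Suc p) = (chi_square 1 \<star> chi_square p)"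
proof -
  let ?P = "\<Pi>\<^sub>M k\<in>{..<p}. std_normal_distribution"
  let ?Q = "\<lambda>x::nat \<Rightarrow> real. \<Sum>k<p. (x k)\<^sup>2"
  have ins: "{..<Suc p} = insert p {..<p}" by auto
  have P: "prob_space (\<Pi>\<^sub>M k\<in>{..<p}. std_normal_distribution)" for p by (rule prob_space_PiM_std_normal)
  have upd: "(\<lambda>(x, X). X(p := x)) \<in> std_normal_distribution \<Otimes>\<^sub>M ?P \<rightarrow>\<^sub>M (\<Pi>\<^sub>M k\<in>insert p {..<p}. std_normal_distribution)"
    unfolding split_beta' by (rule measurable_fun_upd[where J = "{..<p}"]) auto
  have Q: "?Q \<in> borel_measurable ?P" by (rule measurable_sum_squares)
  have "chi_square (Suc p) = distr (distr (std_normal_distribution \<Otimes>\<^sub>M ?P) (\<Pi>\<^sub>M k\<in>insert p {..<p}. std_normal_distribution)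
      (\<lambda>(x, X). X(p := x))) borel (\<lambda>x. \<Sum>k<Suc p. (x k)\<^sup>2)"
    unfolding chi_square_def ins
    by (subst distr_pair_PiM_eq_PiM) (auto simp: prob_space_std_normal)
  also have "\<dots> = distr (std_normal_distribution \<Otimes>\<^sub>M ?P) borel ((\<lambda>x. \<Sum>k<Suc p. (x k)\<^sup>2) \<circ> (\<lambda>(x, X). X(p := x)))"
    using measurable_sum_squares[of "insert p {..<p}"] unfolding ins
    by (intro distr_distr upd) auto
  also have "\<dots> = distr (std_normal_distribution \<Otimes>\<^sub>M ?P) borel ((\<lambda>(x, y). x + y) \<circ> (\<lambda>(x, X). (x\<^sup>2, ?Q X)))"
    by (intro distr_cong) (auto simp: sum.lessThan_Suc)
  also have "\<dots> = distr (distr (std_normal_distribution \<Otimes>\<^sub>M ?P) (borel \<Otimes>\<^sub>M borel) (\<lambda>(x, X). (x\<^sup>2, ?Q X))) borel (\<lambda>(x, y). x + y)"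
    using Q by (intro distr_distr[symmetric]) measurable
  also have "distr (std_normal_distribution \<Otimes>\<^sub>M ?P) (borel \<Otimes>\<^sub>M borel) (\<lambda>(x, X). (x\<^sup>2, ?Q X))
     = distr std_normal_distribution borel (\<lambda>x. x\<^sup>2) \<Otimes>\<^sub>M distr ?P borel ?Q"
  proof (rule pair_measure_distr[symmetric])
    show "sigma_finite_measure (distr ?P borel ?Q)"
      using prob_space_chi_square[of p] unfolding chi_square_def
      by (intro prob_space_imp_sigma_finite)
  qed (use Q in auto)
  finally show ?thesis
    unfolding chi_square_1 convolution_def chi_square_def[of p] chi_square_def[of "Suc p"] by simp
qed

text \<open>The Gamma density of shape \<open>a\<close> and rate 1/2, extended by 0;
  \<open>p\<close> degrees of freedom correspond to \<open>a = p / 2\<close>. Parametrised by the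
  real shape, the family is additive under convolution.\<close>

definition chi_density :: "real \<Rightarrow> real \<Rightarrow> real" where
  "chi_density a x = (if 0 < x then x powr (a - 1) * exp (- (x / 2)) / (2 powr a * Gamma a) else 0)"

lemma chi_density_measurable [measurable]: "chi_density a \<in> borel_measurable borel"
  unfolding chi_density_def[abs_def] by measurable

lemma chi_density_nonneg: "0 < a \<Longrightarrow> 0 \<le> chi_density a x"
  by (auto simp: chi_density_def intro!: divide_nonneg_nonneg mult_nonneg_nonneg less_imp_le[OF Gamma_real_pos])

text \<open>The substitution \<open>y = x t\<close> separates the powers of \<open>x\<close> from a
  Beta integral in \<open>t\<close>, and the exponentials multiply to one that does not involve
  \<open>t\<close>.\<close>

lemma convolution_chi_density:
  assumes a: "0 < a" and b: "0 < b"
  shows "(\<integral>\<^sup>+y. ennreal (chi_density a (x - y)) * ennreal (chi_density b y) \<partial>lborel)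
    = ennreal (chi_density (a + b) x)"
proof (cases "0 < x")
  case False
  then have "ennreal (chi_density a (x - y)) * ennreal (chi_density b y) = 0" for y
    by (auto simp: chi_density_def)
  then have "(\<integral>\<^sup>+y. ennreal (chi_density a (x - y)) * ennreal (chi_density b y) \<partial>lborel) = 0"
    by (simp only: nn_integral_const) simp
  then show ?thesis using False by (simp add: chi_density_def)
next
  case x: True
  define K where "K = x powr (a + b - 1) * exp (- (x / 2)) / (2 powr (a + b) * Gamma a * Gamma b)"
  have G: "0 < Gamma a" "0 < Gamma b" "0 < Gamma (a + b)"
    using a b by (auto intro: Gamma_real_pos)
  have K: "0 \<le> K" using x G by (simp add: K_def)
  have "(\<integral>\<^sup>+y. ennreal (chi_density a (x - y)) * ennreal (chi_density b y) \<partial>lborel)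
      = ennreal \<bar>x\<bar> * (\<integral>\<^sup>+t. ennreal (chi_density a (x - (0 + x * t))) * ennreal (chi_density b (0 + x * t)) \<partial>lborel)"
    using x by (intro nn_integral_real_affine) auto
  also have "\<dots> = (\<integral>\<^sup>+t. ennreal K * (ennreal (t powr (b - 1) * (1 - t) powr (a - 1)) * indicator {0..1} t) \<partial>lborel)"
  proof (subst nn_integral_cmult[symmetric], measurable, rule nn_integral_cong)
    fix t :: real
    show "ennreal \<bar>x\<bar> * (ennreal (chi_density a (x - (0 + x * t))) * ennreal (chi_density b (0 + x * t)))
        = ennreal K * (ennreal (t powr (b - 1) * (1 - t) powr (a - 1)) * indicator {0..1} t)"
    proof (cases "0 < t \<and> t < 1")
      case t: True
      have "x - x * t = x * (1 - t)" by (simp add: algebra_simps)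
      then have "x * (chi_density a (x - x * t) * chi_density b (x * t))
          = x * (x * (1 - t)) powr (a - 1) * exp (- (x * (1 - t) / 2)) * ((x * t) powr (b - 1) * exp (- (x * t / 2)))
            / (2 powr a * Gamma a * (2 powr b * Gamma b))"
        using t x by (simp add: chi_density_def)
      also have "\<dots> = (x * x powr (a - 1) * x powr (b - 1)) * (exp (- (x * (1 - t) / 2)) * exp (- (x * t / 2)))
            * (t powr (b - 1) * (1 - t) powr (a - 1)) / ((2 powr a * 2 powr b) * Gamma a * Gamma b)"
        using t x by (simp add: powr_mult mult_ac)
      also have "x * x powr (a - 1) * x powr (b - 1) = x powr (a + b - 1)"
        using x by (simp add: powr_add[symmetric] powr_mult_base add_diff_eq)
      also have "exp (- (x * (1 - t) / 2)) * exp (- (x * t / 2)) = exp (- (x / 2))"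
        by (simp add: exp_add[symmetric] field_simps)
      also have "2 powr a * 2 powr b = 2 powr (a + b)" by (simp add: powr_add)
      finally have "x * (chi_density a (x - x * t) * chi_density b (x * t)) = K * (t powr (b - 1) * (1 - t) powr (a - 1))"
        by (simp add: K_def)
      then show ?thesis
        using t x K chi_density_nonneg[OF a] chi_density_nonneg[OF b]
        by (simp add: ennreal_mult[symmetric] del: ennreal_mult)
    next
      \<comment> \<open>At \<open>t = 0\<close> and \<open>t = 1\<close> both sides are 0: the
        density is set to 0 at the origin, and \<open>0 powr c = 0\<close> for every
        exponent.\<close>
      case False
      then consider "t < 0 \<or> 1 < t" | "t = 0" | "t = 1" by linarith
      then show ?thesis
        using x by cases (auto simp: chi_density_def mult_le_0_iff not_less indicator_def zero_less_mult_iff)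
    qed
  qed
  also have "\<dots> = ennreal K * (\<integral>\<^sup>+t. ennreal (t powr (b - 1) * (1 - t) powr (a - 1)) * indicator {0..1} t \<partial>lborel)"
    by (rule nn_integral_cmult) measurable
  also have "\<dots> = ennreal K * ennreal (Beta b a)"
    using has_integral_Beta_real[OF b a] by (subst nn_integral_has_integral_lebesgue') auto
  also have "\<dots> = ennreal (K * Beta b a)"
    using K by (simp add: ennreal_mult')
  also have "K * Beta b a = chi_density (a + b) x"
    using x G by (simp add: K_def Beta_def chi_density_def add.commute field_simps)
  finally show ?thesis .
qed

text \<open>Half-lines generate the Borel sets, so equality of distribution functions is enough.
  Both equal twice the Gaussian integral from 0 to \<open>sqrt z\<close>: one by symmetry of the
  normal density, the other because it is an antiderivative.\<close>

lemma chi_square_1_density: "chi_square 1 = density lborel (\<lambda>x. ennreal (chi_density (1 / 2) x))"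
proof -
  define \<Phi> where "\<Phi> = (\<lambda>u. integral {0..u} std_normal_density)"
  have cont: "continuous_on A std_normal_density" for A
    unfolding normal_density_def by (intro continuous_intros) auto
  have D\<Phi>: "(\<Phi> has_real_derivative std_normal_density u) (at u)" if "0 < u" for u
  proof -
    have "(\<Phi> has_real_derivative std_normal_density u) (at u within {0..u + 1})"
      unfolding \<Phi>_def by (rule integral_has_real_derivative) (use that cont in auto)
    then show ?thesis using that by (simp add: at_within_Icc_at)
  qed
  have \<Phi>_cont: "continuous_on {0..u} \<Phi>" for u
    unfolding \<Phi>_def by (intro indefinite_integral_continuous_1 integrable_continuous_interval cont)
  have L: "emeasure std_normal_distribution {- u..u} = ennreal (2 * \<Phi> u)" if u: "0 \<le> u" for u
  proof -
    have int: "(std_normal_density has_integral \<Phi> u) {0..u}"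
      unfolding \<Phi>_def by (intro integrable_integral integrable_continuous_interval cont)
    have "((\<lambda>x. std_normal_density (- x)) has_integral \<Phi> u) {- u..- 0}"
      using int by (subst has_integral_reflect_real)
    moreover have "(\<lambda>x. std_normal_density (- x)) = std_normal_density"
      by (simp add: normal_density_def fun_eq_iff)
    ultimately have int': "(std_normal_density has_integral \<Phi> u) {- u..0}"
      by simp
    have "(std_normal_density has_integral (\<Phi> u + \<Phi> u)) {- u..u}"
      by (rule has_integral_combine[OF _ _ int' int]) (use u in auto)
    then have "(\<integral>\<^sup>+x. ennreal (std_normal_density x) * indicator {- u..u} x \<partial>lborel) = ennreal (\<Phi> u + \<Phi> u)"
      by (rule nn_integral_has_integral_lebesgue'[rotated]) simp
    then show ?thesis by (simp add: emeasure_density)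
  qed
  have R: "emeasure (density lborel (\<lambda>x. ennreal (chi_density (1 / 2) x))) {..z} = ennreal (2 * \<Phi> (sqrt z))"
    if z: "0 \<le> z" for z
  proof -
    have "((\<lambda>x. chi_density (1 / 2) x) has_integral (2 * \<Phi> (sqrt z) - 2 * \<Phi> (sqrt 0))) {0..z}"
    \<comment> \<open>The density grows like \<open>x powr (- 1/2)\<close> at 0, so
      differentiability is available only in the interior; continuity holds up to the end
      point.\<close>
    proof (rule fundamental_theorem_of_calculus_interior)
      show "continuous_on {0..z} (\<lambda>x. 2 * \<Phi> (sqrt x))"
        by (intro continuous_intros continuous_on_compose2[OF \<Phi>_cont[of "sqrt z"]]) (use z in auto)
      fix x assume x: "x \<in> {0<..<z}"
      have "((\<lambda>x. 2 * \<Phi> (sqrt x)) has_real_derivative 2 * (std_normal_density (sqrt x) * (inverse (sqrt x) / 2))) (at x)"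
        using x by (intro DERIV_cmult DERIV_chain2[OF D\<Phi>] DERIV_real_sqrt) auto
      also have "2 * (std_normal_density (sqrt x) * (inverse (sqrt x) / 2)) = chi_density (1 / 2) x"
        using x by (simp add: chi_density_def normal_density_def Gamma_one_half_real powr_half_sqrt
            powr_minus real_sqrt_mult field_simps)
      finally show "((\<lambda>x. 2 * \<Phi> (sqrt x)) has_vector_derivative chi_density (1 / 2) x) (at x)"
        by (simp add: has_real_derivative_iff_has_vector_derivative)
    qed (use z in auto)
    then have "(\<integral>\<^sup>+x. ennreal (chi_density (1 / 2) x) * indicator {0..z} x \<partial>lborel) = ennreal (2 * \<Phi> (sqrt z))"
      by (intro nn_integral_has_integral_lebesgue') (auto simp: chi_density_nonneg \<Phi>_def)
    moreover have "ennreal (chi_density (1 / 2) x) * indicator {0..z} x = ennreal (chi_density (1 / 2) x) * indicator {..z} x" for x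
      by (auto simp: indicator_def chi_density_def)
    ultimately show ?thesis by (simp add: emeasure_density)
  qed
  have cdf: "emeasure (chi_square 1) {..z} = emeasure (density lborel (\<lambda>x. ennreal (chi_density (1 / 2) x))) {..z}" for z
  proof (cases "0 \<le> z")
    case True
    have "x\<^sup>2 \<le> z \<longleftrightarrow> \<bar>x\<bar> \<le> sqrt z" for x
      using real_sqrt_le_iff[of "x\<^sup>2" z] by (simp only: real_sqrt_abs)
    then have "(\<lambda>x::real. x\<^sup>2) -` {..z} = {- sqrt z..sqrt z}"
      by (auto simp: abs_le_iff)
    then have "emeasure (chi_square 1) {..z} = emeasure std_normal_distribution {- sqrt z..sqrt z}"
      unfolding chi_square_1 by (subst emeasure_distr) auto
    then show ?thesis using L[of "sqrt z"] R[OF True] True by simp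
  next
    case False
    have "(\<lambda>x::real. x\<^sup>2) -` {..z} = {}"
      using False by (auto simp: not_le) (meson order_trans not_le zero_le_power2)
    then have "emeasure (chi_square 1) {..z} = 0"
      unfolding chi_square_1 by (subst emeasure_distr) auto
    moreover
    have "ennreal (chi_density (1 / 2) x) * indicator {..z} x = 0" for x
      using False by (auto simp: chi_density_def indicator_def)
    then have "(\<integral>\<^sup>+x. ennreal (chi_density (1 / 2) x) * indicator {..z} x \<partial>lborel) = 0"
      by (simp only: nn_integral_const) simp
    ultimately show ?thesis by (simp add: emeasure_density)
  qed
  show ?thesis
  proof (rule measure_eqI_generator_eq[where E = "range (\<lambda>z::real. {..z})" and \<Omega> = UNIV and A = "\<lambda>i. {..real i}"])
    show "Int_stable (range (\<lambda>z::real. {..z}))"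
      by (auto simp: Int_stable_def)
    show "sets (chi_square 1) = sigma_sets UNIV (range (\<lambda>z::real. {..z}))"
      by (simp add: borel_eq_atMost)
    show "sets (density lborel (\<lambda>x. ennreal (chi_density (1 / 2) x))) = sigma_sets UNIV (range (\<lambda>z::real. {..z}))"
      by (simp add: borel_eq_atMost)
    show "(\<Union>i. {..real i}) = UNIV" by (auto simp: real_arch_simple)
    show "emeasure (chi_square 1) {..real i} \<noteq> \<infinity>" for i
      using prob_space.finite_measure[OF prob_space_chi_square] by (simp add: finite_measure.emeasure_finite)
  qed (use cdf in auto)
qed

theorem chi_square_density:
  assumes "0 < p"
  shows "chi_square p = density lborel (\<lambda>x. ennreal (chi_density (real p / 2) x))"
  using assms
proof (induction p rule: nat_induct_non_zero)
  case 1
  then show ?case using chi_square_1_density by simp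
next
  case (Suc p)
  have fin: "finite_measure (chi_square p)" for p
    using prob_space_chi_square[of p] by (simp add: prob_space_def)
  have "chi_square (Suc p) = density lborel (\<lambda>x. \<integral>\<^sup>+y. ennreal (chi_density (1 / 2) (x - y)) * ennreal (chi_density (real p / 2) y) \<partial>lborel)"
    unfolding chi_square_Suc
    using fin[of 1] fin[of p] unfolding chi_square_1_density Suc.IH
    by (intro convolution_density) auto
  also have "\<dots> = density lborel (\<lambda>x. ennreal (chi_density (1 / 2 + real p / 2) x))"
    using Suc.hyps by (subst convolution_chi_density) auto
  also have "1 / 2 + real p / 2 = real (Suc p) / 2" by simp
  finally show ?case .
qed

section \<open>The Stein equation of the chi-square distribution\<close>

text \<open>Both \<open>W - g\<close> and \<open>W + g\<close> are nondecreasing.\<close>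

lemma abs_diff_le_barrier_diff:
  fixes g W :: "real \<Rightarrow> real"
  assumes g: "\<And>x. a \<le> x \<Longrightarrow> x \<le> b \<Longrightarrow> (g has_real_derivative g' x) (at x)"
    and W: "\<And>x. a \<le> x \<Longrightarrow> x \<le> b \<Longrightarrow> (W has_real_derivative W' x) (at x)"
    and le: "\<And>x. a \<le> x \<Longrightarrow> x \<le> b \<Longrightarrow> \<bar>g' x\<bar> \<le> W' x"
    and ab: "a \<le> b"
  shows "\<bar>g b - g a\<bar> \<le> W b - W a"
proof -
  have key: "W a - s * g a \<le> W b - s * g b" if s: "s = 1 \<or> s = -1" for s :: real
  proof (rule DERIV_nonneg_imp_nondecreasing[of a b "\<lambda>y. W y - s * g y"])
    fix y assume y: "a \<le> y" "y \<le> b"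
    have "((\<lambda>y. W y - s * g y) has_real_derivative W' y - s * g' y) (at y)"
      using y by (intro DERIV_diff DERIV_cmult W g) auto
    moreover have "0 \<le> W' y - s * g' y"
      using le[of y] s y by (auto simp: abs_le_iff)
    ultimately show "\<exists>z. ((\<lambda>y. W y - s * g y) has_real_derivative z) (at y) \<and> 0 \<le> z"
      by blast
  qed (rule ab)
  show ?thesis using key[of 1] key[of "-1"] by (auto simp: abs_le_iff)
qed

text \<open>The integrating factor of the operator \<open>2 x u' + (m - x) u\<close>. Divided by
  \<open>x\<close> and normalised it is the chi-square density with \<open>m\<close> degrees of
  freedom.\<close>

definition gamma_weight :: "real \<Rightarrow> real \<Rightarrow> real" where
  "gamma_weight m x = x powr (m / 2) * exp (- (x / 2))"

lemma gamma_weight_pos: "0 < x \<Longrightarrow> 0 < gamma_weight m x"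
  by (simp add: gamma_weight_def)

lemma DERIV_gamma_weight:
  assumes "0 < x"
  shows "(gamma_weight m has_real_derivative gamma_weight m x * ((m - x) / (2 * x))) (at x)"
proof -
  have "((\<lambda>x. x powr (m / 2) * exp (- (x / 2))) has_real_derivative
      m / 2 * x powr (m / 2 - 1) * exp (- (x / 2)) + x powr (m / 2) * (exp (- (x / 2)) * (- (1 / 2)))) (at x)"
    using assms by (auto intro!: derivative_eq_intros)
  also have "x powr (m / 2 - 1) = x powr (m / 2) / x"
    using assms by (simp add: powr_diff)
  also have "m / 2 * (x powr (m / 2) / x) * exp (- (x / 2)) + x powr (m / 2) * (exp (- (x / 2)) * (- (1 / 2)))
      = gamma_weight m x * ((m - x) / (2 * x))"
    using assms unfolding gamma_weight_def by (simp add: field_simps)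
  finally show ?thesis unfolding gamma_weight_def[abs_def] .
qed

text \<open>Let \<open>w\<close> be \<open>gamma_weight m\<close>, so that \<open>(w u)' = w \<psi> / (2 x)\<close>. Then
  \<open>2 B w / (\<bar>m - x\<bar> + \<surd>m)\<close> is a barrier for \<open>w u\<close> on either side of \<open>m\<close>: it vanishes at \<open>0\<close> and
  at infinity, and changes at least as fast as \<open>w u\<close>.\<close>

lemma stein_solution_bound:
  fixes u u' \<psi> :: "real \<Rightarrow> real"
  assumes m: "2 \<le> m"
    and deriv: "\<And>x. 0 < x \<Longrightarrow> (u has_real_derivative u' x) (at x)"
    and ode: "\<And>x. 0 < x \<Longrightarrow> 2 * x * u' x + (m - x) * u x = \<psi> x"
    and bound: "\<And>x. 0 < x \<Longrightarrow> \<bar>\<psi> x\<bar> \<le> B"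
    and lim0: "((\<lambda>x. gamma_weight m x * u x) \<longlongrightarrow> 0) (at_right 0)"
    and lim_top: "((\<lambda>x. gamma_weight m x * u x) \<longlongrightarrow> 0) at_top"
    and x: "0 < x"
  shows "\<bar>u x\<bar> \<le> 2 / sqrt m * B"
proof -
  let ?w = "gamma_weight m"
  define q where "q = sqrt m"
  have B: "0 \<le> B" using bound[of 1] by linarith
  have q: "0 < q" "q * q = m" using m by (auto simp: q_def)
  define g' where "g' = (\<lambda>x. ?w x * \<psi> x / (2 * x))"
  have g: "((\<lambda>x. ?w x * u x) has_real_derivative g' x) (at x)" if "0 < x" for x
  proof -
    have "((\<lambda>x. ?w x * u x) has_real_derivative
        ?w x * ((m - x) / (2 * x)) * u x + u' x * ?w x) (at x)"
      by (rule DERIV_mult[OF DERIV_gamma_weight[OF that] deriv[OF that]])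
    also have "?w x * ((m - x) / (2 * x)) * u x + u' x * ?w x = g' x"
      unfolding g'_def ode[OF that, symmetric] using that by (simp add: field_simps)
    finally show ?thesis .
  qed
  have g'_le: "\<bar>g' x\<bar> \<le> B * (?w x * c)" if "0 < x" "1 / (2 * x) \<le> c" for x c
  proof -
    have "\<bar>g' x\<bar> \<le> B * (?w x * (1 / (2 * x)))"
      using bound[OF that(1)] that gamma_weight_pos[OF that(1), of m]
      by (simp add: g'_def abs_mult mult.commute[of B] divide_right_mono mult_left_mono)
    also have "\<dots> \<le> B * (?w x * c)"
      using that B gamma_weight_pos[OF that(1), of m] by (intro mult_left_mono) auto
    finally show ?thesis .
  qed
  \<comment> \<open>With \<open>a = \<bar>m - y\<bar>\<close> and \<open>b = a + q\<close> this says
    that the barrier changes at least as fast as the weighted solution; multiplied by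
    \<open>2 y b^2\<close> it becomes the quadratic inequality of the premise.\<close>
  have aux1: "1 / (2 * y) \<le> a / (2 * y) * (2 / b) + 2 / b\<^sup>2"
    if "b\<^sup>2 \<le> 2 * (a * b) + 4 * y" "0 < b" "0 < y" for a b y :: real
  proof -
    have "1 / (2 * y) = b\<^sup>2 / (2 * y * b\<^sup>2)" using that by simp
    also have "\<dots> \<le> (2 * (a * b) + 4 * y) / (2 * y * b\<^sup>2)"
      using that by (intro divide_right_mono) auto
    also have "\<dots> = a / (2 * y) * (2 / b) + 2 / b\<^sup>2"
      using that(2,3) by (simp add: add_divide_distrib power2_eq_square)
    finally show ?thesis .
  qed
  have alg: "B * (w * (p * f + e)) = B * (w * p * f + e * w)"
    "B * (w * (- p * f + 2 / b)) = - (B * (w * p * f + - 2 / b * w))" for w p f e b :: real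
    by (simp_all add: algebra_simps)
  have conv: "\<bar>u x\<bar> \<le> 2 / q * B" if "\<bar>?w x * u x\<bar> \<le> B * (?w x * (2 / y))" "q \<le> y" for y
  proof -
    have w: "0 < ?w x" by (rule gamma_weight_pos[OF x])
    then have "?w x * \<bar>u x\<bar> \<le> ?w x * (B * (2 / y))"
      using that(1) by (simp only: abs_mult abs_of_pos mult.left_commute[of B])
    then have "\<bar>u x\<bar> \<le> B * (2 / y)" using w by (simp only: mult_le_cancel_left_pos)
    also have "\<dots> \<le> B * (2 / q)"
      using that(2) q B by (intro mult_left_mono divide_left_mono) auto
    finally show ?thesis by (simp add: mult.commute)
  qed
  show ?thesis
  proof (cases "x \<le> m")
    case True
    let ?W = "\<lambda>x. B * (?w x * (2 / (m - x + q)))"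
    have le: "\<bar>?w x * u x - ?w t * u t\<bar> \<le> ?W x - ?W t" if t: "0 < t" "t < x" for t
    proof (rule abs_diff_le_barrier_diff[where g = "\<lambda>x. ?w x * u x" and W = ?W and g' = g' and
          W' = "\<lambda>x. B * (?w x * ((m - x) / (2 * x)) * (2 / (m - x + q)) + 2 / (m - x + q)\<^sup>2 * ?w x)"])
      fix y assume "t \<le> y" "y \<le> x"
      then have y: "0 < y" "y \<le> m" using t True by auto
      show "((\<lambda>x. ?w x * u x) has_real_derivative g' y) (at y)" by (rule g[OF y(1)])
      show "(?W has_real_derivative
          B * (?w y * ((m - y) / (2 * y)) * (2 / (m - y + q)) + 2 / (m - y + q)\<^sup>2 * ?w y)) (at y)"
        by (intro DERIV_cmult DERIV_mult DERIV_gamma_weight y(1))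
           (use y q in \<open>auto intro!: derivative_eq_intros simp: power2_eq_square\<close>)
      have "(m - y + q)\<^sup>2 \<le> 2 * ((m - y) * (m - y + q)) + 4 * y"
      proof -
        \<comment> \<open>The choice \<open>q^2 = m\<close> pays off here: the mixed terms
          \<open>2 (m - y) q\<close> cancel, and completing the square leaves
          \<open>3 m - 4\<close>, which is nonnegative since \<open>m \<ge> 2\<close>.\<close>
        have "0 \<le> (m - y - 2)\<^sup>2 + (3 * m - 4)" using m by (intro add_nonneg_nonneg) auto
        also have "\<dots> = 2 * ((m - y) * (m - y + q)) + 4 * y - (m - y + q)\<^sup>2"
          by (simp add: power2_eq_square algebra_simps q(2))
        finally show ?thesis by linarith
      qed
      then have "1 / (2 * y) \<le> (m - y) / (2 * y) * (2 / (m - y + q)) + 2 / (m - y + q)\<^sup>2"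
        by (rule aux1) (use y q in auto)
      from g'_le[OF y(1) this]
      show "\<bar>g' y\<bar> \<le> B * (?w y * ((m - y) / (2 * y)) * (2 / (m - y + q)) + 2 / (m - y + q)\<^sup>2 * ?w y)"
        by (simp only: alg(1))
    qed (use t in simp)
    have "((\<lambda>t. \<bar>?w x * u x - ?w t * u t\<bar>) \<longlongrightarrow> \<bar>?w x * u x - 0\<bar>) (at_right 0)"
      by (intro tendsto_intros lim0)
    moreover have "\<forall>\<^sub>F t in at_right 0. \<bar>?w x * u x - ?w t * u t\<bar> \<le> ?W x"
      unfolding eventually_at_right_field
    proof (intro exI[of _ x] conjI allI impI x)
      fix t assume t: "0 < t" "t < x"
      then have "0 \<le> ?W t" using B q True gamma_weight_pos[of t m] by simp
      then show "\<bar>?w x * u x - ?w t * u t\<bar> \<le> ?W x" using le[OF t] by linarith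
    qed
    ultimately have "\<bar>?w x * u x - 0\<bar> \<le> ?W x" by (rule tendsto_upperbound) simp
    then show ?thesis using True unfolding q_def[symmetric] by (intro conv) auto
  next
    case False
    let ?W = "\<lambda>x. B * (?w x * (2 / (x - m + q)))"
    have le: "\<bar>?w t * u t - ?w x * u x\<bar> \<le> - ?W t - - ?W x" if t: "x < t" for t
    proof (rule abs_diff_le_barrier_diff[where g = "\<lambda>x. ?w x * u x" and W = "\<lambda>x. - ?W x" and g' = g' and
          W' = "\<lambda>x. - (B * (?w x * ((m - x) / (2 * x)) * (2 / (x - m + q)) + - 2 / (x - m + q)\<^sup>2 * ?w x))"])
      fix y assume "x \<le> y" "y \<le> t"
      then have y: "0 < y" "m \<le> y" using x False by auto
      show "((\<lambda>x. ?w x * u x) has_real_derivative g' y) (at y)" by (rule g[OF y(1)])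
      show "((\<lambda>x. - ?W x) has_real_derivative
          - (B * (?w y * ((m - y) / (2 * y)) * (2 / (y - m + q)) + - 2 / (y - m + q)\<^sup>2 * ?w y))) (at y)"
        by (intro DERIV_minus DERIV_cmult DERIV_mult DERIV_gamma_weight y(1))
           (use y q in \<open>auto intro!: derivative_eq_intros simp: power2_eq_square\<close>)
      have "(y - m + q)\<^sup>2 \<le> 2 * ((y - m) * (y - m + q)) + 4 * y"
      proof -
        have "0 \<le> (y - m)\<^sup>2 + 4 * (y - m) + 3 * m"
          by (intro add_nonneg_nonneg) (use m y in auto)
        also have "\<dots> = 2 * ((y - m) * (y - m + q)) + 4 * y - (y - m + q)\<^sup>2"
          by (simp add: power2_eq_square algebra_simps q(2))
        finally show ?thesis by linarith
      qed
      then have "1 / (2 * y) \<le> (y - m) / (2 * y) * (2 / (y - m + q)) + 2 / (y - m + q)\<^sup>2"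
        by (rule aux1) (use y q in auto)
      from g'_le[OF y(1) this]
      have "\<bar>g' y\<bar> \<le> B * (?w y * ((y - m) / (2 * y) * (2 / (y - m + q)) + 2 / (y - m + q)\<^sup>2))" .
      also have "(y - m) / (2 * y) = - ((m - y) / (2 * y))"
        by (metis minus_diff_eq minus_divide_left)
      finally show "\<bar>g' y\<bar> \<le> - (B * (?w y * ((m - y) / (2 * y)) * (2 / (y - m + q)) + - 2 / (y - m + q)\<^sup>2 * ?w y))"
        by (simp only: alg(2))
    qed (use t in simp)
    have "((\<lambda>t. \<bar>?w t * u t - ?w x * u x\<bar>) \<longlongrightarrow> \<bar>0 - ?w x * u x\<bar>) at_top"
      by (intro tendsto_intros lim_top)
    moreover have "\<forall>\<^sub>F t in at_top. \<bar>?w t * u t - ?w x * u x\<bar> \<le> ?W x"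
      using eventually_gt_at_top[of x]
    proof eventually_elim
      case (elim t)
      then have "0 \<le> ?W t" using B q False x gamma_weight_pos[of t m] by simp
      then show ?case using le[OF elim] by linarith
    qed
    ultimately have "\<bar>0 - ?w x * u x\<bar> \<le> ?W x" by (rule tendsto_upperbound) simp
    then show ?thesis using False unfolding q_def[symmetric] by (intro conv) auto
  qed
qed

lemma gamma_weight_add_two: "0 < x \<Longrightarrow> gamma_weight (m + 2) x = x * gamma_weight m x"
proof -
  assume "0 < x"
  moreover have "x powr ((m + 2) / 2) = x powr (m / 2 + 1)" by (simp add: add_divide_distrib)
  ultimately show ?thesis by (simp add: gamma_weight_def powr_add)
qed

lemma gamma_weight_tendsto_at_right:
  assumes "0 < m"
  shows "(gamma_weight m \<longlongrightarrow> 0) (at_right 0)"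
proof -
  have "((\<lambda>x::real. x powr (m / 2) * exp (- (x / 2))) \<longlongrightarrow> 0 * exp (- (0 / 2))) (at_right 0)"
  proof (intro tendsto_intros)
    have "((\<lambda>x::real. x powr (m / 2)) \<longlongrightarrow> 0 powr (m / 2)) (at_right 0)"
      using assms by (intro tendsto_powr') (auto intro!: tendsto_intros simp: eventually_at_right_field exI[of _ 1])
    then show "((\<lambda>x::real. x powr (m / 2)) \<longlongrightarrow> 0) (at_right 0)" by simp
  qed simp
  then show ?thesis by (simp add: gamma_weight_def[abs_def])
qed

lemma gamma_weight_tendsto_at_top: "(gamma_weight m \<longlongrightarrow> 0) at_top"
proof -
  obtain N :: nat where N: "m / 2 \<le> real N" using real_arch_simple by blast
  have half: "filterlim (\<lambda>x::real. x / 2) at_top at_top"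
    by real_asymp
  have "((\<lambda>x::real. 2 ^ N * ((x / 2) ^ N / exp (x / 2))) \<longlongrightarrow> 2 ^ N * 0) at_top"
    by (intro tendsto_intros filterlim_compose[OF tendsto_power_div_exp_0 half])
  then have lim: "((\<lambda>x::real. x ^ N * exp (- (x / 2))) \<longlongrightarrow> 0) at_top"
    by (simp add: power_divide exp_minus field_simps)
  show ?thesis
  proof (rule tendsto_sandwich[OF _ _ tendsto_const lim])
    show "\<forall>\<^sub>F x in at_top. 0 \<le> gamma_weight m x"
      by (simp add: gamma_weight_def)
    show "\<forall>\<^sub>F x in at_top. gamma_weight m x \<le> x ^ N * exp (- (x / 2))"
      using eventually_ge_at_top[of "1::real"]
    proof eventually_elim
      case (elim x)
      have "x powr (m / 2) \<le> x powr real N" using elim N by (intro powr_mono)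
      then show ?case using elim by (simp add: gamma_weight_def powr_realpow)
    qed
  qed
qed

text \<open>Differentiating the equation raises \<open>m\<close> by 2 and adds \<open>u\<close> to
  the derivative of the right-hand side. \<open>u'\<close> is differentiable because the equation
  expresses it through \<open>u\<close> and \<psi>. The boundary conditions persist because
  \<open>u\<close> is bounded and the new weight times \<open>u'\<close> is
  \<open>gamma_weight m\<close> times \<open>(\<psi> - (m - x) u) / 2\<close>.\<close>

lemma stein_derivative_step:
  fixes u u' \<psi> \<psi>' :: "real \<Rightarrow> real"
  assumes m: "2 \<le> m"
    and deriv: "\<And>x. 0 < x \<Longrightarrow> (u has_real_derivative u' x) (at x)"
    and ode: "\<And>x. 0 < x \<Longrightarrow> 2 * x * u' x + (m - x) * u x = \<psi> x"
    and bound: "\<And>x. 0 < x \<Longrightarrow> \<bar>\<psi> x\<bar> \<le> B"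
    and lim0: "((\<lambda>x. gamma_weight m x * u x) \<longlongrightarrow> 0) (at_right 0)"
    and lim_top: "((\<lambda>x. gamma_weight m x * u x) \<longlongrightarrow> 0) at_top"
    and deriv_\<psi>: "\<And>x. 0 < x \<Longrightarrow> (\<psi> has_real_derivative \<psi>' x) (at x)"
  obtains u'' where
    "\<And>x. 0 < x \<Longrightarrow> (u' has_real_derivative u'' x) (at x)"
    "\<And>x. 0 < x \<Longrightarrow> 2 * x * u'' x + (m + 2 - x) * u' x = \<psi>' x + u x"
    "((\<lambda>x. gamma_weight (m + 2) x * u' x) \<longlongrightarrow> 0) (at_right 0)"
    "((\<lambda>x. gamma_weight (m + 2) x * u' x) \<longlongrightarrow> 0) at_top"
proof
  define u'' where "u'' = (\<lambda>x. (\<psi>' x + u x - (m + 2 - x) * u' x) / (2 * x))"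
  define A where "A = 2 / sqrt m * B"
  have A: "\<bar>u x\<bar> \<le> A" if "0 < x" for x
    unfolding A_def by (rule stein_solution_bound[OF m deriv ode bound lim0 lim_top that])
  have u': "u' x = (\<psi> x - (m - x) * u x) / (2 * x)" if "0 < x" for x
    using ode[OF that] that by (simp add: field_simps)
  show "2 * x * u'' x + (m + 2 - x) * u' x = \<psi>' x + u x" if "0 < x" for x
    using that by (simp add: u''_def)
  show "(u' has_real_derivative u'' x) (at x)" if x: "0 < x" for x
  proof -
    have "((\<lambda>x. (\<psi> x - (m - x) * u x) / (2 * x)) has_real_derivative
       ((\<psi>' x - ((m - x) * u' x - u x)) * (2 * x) - (\<psi> x - (m - x) * u x) * 2) / (2 * x * (2 * x))) (at x)"
      using x by (auto intro!: derivative_eq_intros deriv deriv_\<psi>)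
    also have "((\<psi>' x - ((m - x) * u' x - u x)) * (2 * x) - (\<psi> x - (m - x) * u x) * 2) / (2 * x * (2 * x)) = u'' x"
      using x unfolding ode[OF x, symmetric] u''_def by (simp add: field_simps)
    finally have "((\<lambda>x. (\<psi> x - (m - x) * u x) / (2 * x)) has_real_derivative u'' x) (at x)" .
    then show ?thesis
      by (rule has_field_derivative_transform_within_open[where S = "{0<..}"]) (use x u' in auto)
  qed
  have bnd: "\<bar>gamma_weight (m + 2) x * u' x\<bar> \<le> (B + m * A) / 2 * gamma_weight m x + A / 2 * gamma_weight (m + 2) x"
    if x: "0 < x" for x
  proof -
    have "\<bar>\<psi> x - (m - x) * u x\<bar> \<le> \<bar>\<psi> x\<bar> + \<bar>m - x\<bar> * \<bar>u x\<bar>"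
      by (metis abs_mult abs_triangle_ineq4)
    also have "\<dots> \<le> B + (m + x) * A"
      using x m bound[OF x] A[OF x] by (intro add_mono mult_mono) auto
    finally have "\<bar>\<psi> x - (m - x) * u x\<bar> \<le> B + (m + x) * A" .
    moreover have "gamma_weight (m + 2) x * u' x = gamma_weight m x / 2 * (\<psi> x - (m - x) * u x)"
      using x by (simp add: u' gamma_weight_add_two)
    ultimately have "\<bar>gamma_weight (m + 2) x * u' x\<bar> \<le> gamma_weight m x / 2 * (B + (m + x) * A)"
      using gamma_weight_pos[OF x, of m] by (simp only: abs_mult) (intro mult_mono, auto)
    then show ?thesis
      using x by (simp add: gamma_weight_add_two algebra_simps add_divide_distrib)
  qed
  have "((\<lambda>x. (B + m * A) / 2 * gamma_weight m x + A / 2 * gamma_weight (m + 2) x)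
       \<longlongrightarrow> (B + m * A) / 2 * 0 + A / 2 * 0) (at_right 0)"
    using m by (intro tendsto_intros gamma_weight_tendsto_at_right) auto
  then have "((\<lambda>x. (B + m * A) / 2 * gamma_weight m x + A / 2 * gamma_weight (m + 2) x) \<longlongrightarrow> 0) (at_right 0)"
    by simp
  moreover have "\<forall>\<^sub>F x in at_right 0. norm (gamma_weight (m + 2) x * u' x)
      \<le> (B + m * A) / 2 * gamma_weight m x + A / 2 * gamma_weight (m + 2) x"
    using eventually_at_right_less[of "0::real"] by eventually_elim (simp only: real_norm_def bnd)
  ultimately show "((\<lambda>x. gamma_weight (m + 2) x * u' x) \<longlongrightarrow> 0) (at_right 0)"
    by (rule Lim_null_comparison[rotated])
  have "((\<lambda>x. (B + m * A) / 2 * gamma_weight m x + A / 2 * gamma_weight (m + 2) x)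
       \<longlongrightarrow> (B + m * A) / 2 * 0 + A / 2 * 0) at_top"
    by (intro tendsto_intros gamma_weight_tendsto_at_top)
  then have "((\<lambda>x. (B + m * A) / 2 * gamma_weight m x + A / 2 * gamma_weight (m + 2) x) \<longlongrightarrow> 0) at_top"
    by simp
  moreover have "\<forall>\<^sub>F x in at_top. norm (gamma_weight (m + 2) x * u' x)
      \<le> (B + m * A) / 2 * gamma_weight m x + A / 2 * gamma_weight (m + 2) x"
    using eventually_gt_at_top[of "0::real"] by eventually_elim (simp only: real_norm_def bnd)
  ultimately show "((\<lambda>x. gamma_weight (m + 2) x * u' x) \<longlongrightarrow> 0) at_top"
    by (rule Lim_null_comparison[rotated])
qed

text \<open>Three differentiations give equations with parameters \<open>d + 2\<close>,
  \<open>d + 4\<close>, \<open>d + 6\<close>, the \<open>k\<close>-th having as right-hand side the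
  \<open>k\<close>-th derivative of \<open>h\<close> plus \<open>k\<close> times the preceding
  derivative of \<open>f\<close>. The constant \<open>2 / sqrt m\<close> decreases in
  \<open>m\<close>, so one \<open>C\<close> serves all of them.\<close>

lemma stein_solution_derivative_bounds:
  fixes f f1 h h1 h2 h3 :: "real \<Rightarrow> real"
  assumes d: "2 \<le> d"
    and f: "\<And>x. 0 < x \<Longrightarrow> (f has_real_derivative f1 x) (at x)"
    and ode: "\<And>x. 0 < x \<Longrightarrow> 2 * x * f1 x + (d - x) * f x = h x - a"
    and lim0: "((\<lambda>x. gamma_weight d x * f x) \<longlongrightarrow> 0) (at_right 0)"
    and lim_top: "((\<lambda>x. gamma_weight d x * f x) \<longlongrightarrow> 0) at_top"
    and h: "\<And>x. (h has_real_derivative h1 x) (at x)"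
    and h1: "\<And>x. (h1 has_real_derivative h2 x) (at x)"
    and h2: "\<And>x. (h2 has_real_derivative h3 x) (at x)"
    and B0: "\<And>x. \<bar>h x - a\<bar> \<le> 1"
    and B1: "\<And>x. \<bar>h1 x\<bar> \<le> B1"
    and B2: "\<And>x. \<bar>h2 x\<bar> \<le> B2"
    and B3: "\<And>x. \<bar>h3 x\<bar> \<le> B3"
    and C: "C = 2 / sqrt d"
  obtains f2 f3 where
    "\<And>x. 0 < x \<Longrightarrow> (f1 has_real_derivative f2 x) (at x)"
    "\<And>x. 0 < x \<Longrightarrow> (f2 has_real_derivative f3 x) (at x)"
    "\<And>x. 0 < x \<Longrightarrow> \<bar>f x\<bar> \<le> C"
    "\<And>x. 0 < x \<Longrightarrow> \<bar>f1 x\<bar> \<le> C * (B1 + C)"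
    "\<And>x. 0 < x \<Longrightarrow> \<bar>f2 x\<bar> \<le> C * (B2 + 2 * (C * (B1 + C)))"
    "\<And>x. 0 < x \<Longrightarrow> \<bar>f3 x\<bar> \<le> C * (B3 + 3 * (C * (B2 + 2 * (C * (B1 + C)))))"
proof -
  have weaken: "y \<le> C * B" if "y \<le> 2 / sqrt m * B" "d \<le> m" "0 \<le> B" for y m B
  proof -
    have "2 / sqrt m \<le> C" unfolding C using d that by (intro divide_left_mono mult_pos_pos) auto
    then show ?thesis using that by (meson mult_right_mono order_trans)
  qed
  have nonneg: "0 \<le> B1" "0 \<le> B2" "0 \<le> B3" "0 \<le> C"
    using B1[of 0] B2[of 0] B3[of 0] d by (auto simp: C)
  note \<psi>0 = DERIV_diff[OF h DERIV_const[of a], simplified]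
  obtain f2 where f2: "\<And>x. 0 < x \<Longrightarrow> (f1 has_real_derivative f2 x) (at x)"
      and ode1: "\<And>x. 0 < x \<Longrightarrow> 2 * x * f2 x + (d + 2 - x) * f1 x = h1 x + f x"
      and lim1: "((\<lambda>x. gamma_weight (d + 2) x * f1 x) \<longlongrightarrow> 0) (at_right 0)"
        "((\<lambda>x. gamma_weight (d + 2) x * f1 x) \<longlongrightarrow> 0) at_top"
    using stein_derivative_step[OF d f ode B0 lim0 lim_top \<psi>0] by metis
  have b0: "\<bar>f x\<bar> \<le> C" if "0 < x" for x
    using stein_solution_bound[OF d f ode B0 lim0 lim_top that] by (simp add: C)
  have \<psi>1: "\<bar>h1 x + f x\<bar> \<le> B1 + C" if "0 < x" for x
    using B1[of x] b0[OF that] by linarith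
  have d2: "2 \<le> d + 2" "2 \<le> d + 2 + 2" "2 \<le> d + 2 + 2 + 2" using d by auto
  have b1: "\<bar>f1 x\<bar> \<le> C * (B1 + C)" if "0 < x" for x
    using stein_solution_bound[OF d2(1) f2 ode1 \<psi>1 lim1 that] d nonneg by (intro weaken) auto
  have D1: "((\<lambda>x. h1 x + f x) has_real_derivative h2 x + f1 x) (at x)" if "0 < x" for x
    by (intro DERIV_add h1 f that)
  obtain f3 where f3: "\<And>x. 0 < x \<Longrightarrow> (f2 has_real_derivative f3 x) (at x)"
      and ode2: "\<And>x. 0 < x \<Longrightarrow> 2 * x * f3 x + (d + 2 + 2 - x) * f2 x = h2 x + f1 x + f1 x"
      and lim2: "((\<lambda>x. gamma_weight (d + 2 + 2) x * f2 x) \<longlongrightarrow> 0) (at_right 0)"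
        "((\<lambda>x. gamma_weight (d + 2 + 2) x * f2 x) \<longlongrightarrow> 0) at_top"
    using stein_derivative_step[OF d2(1) f2 ode1 \<psi>1 lim1 D1] by metis
  have \<psi>2: "\<bar>h2 x + f1 x + f1 x\<bar> \<le> B2 + 2 * (C * (B1 + C))" if "0 < x" for x
    using B2[of x] b1[OF that] by linarith
  have b2: "\<bar>f2 x\<bar> \<le> C * (B2 + 2 * (C * (B1 + C)))" if "0 < x" for x
    using stein_solution_bound[OF d2(2) f3 ode2 \<psi>2 lim2 that] d nonneg by (intro weaken) auto
  have D2: "((\<lambda>x. h2 x + f1 x + f1 x) has_real_derivative h3 x + f2 x + f2 x) (at x)" if "0 < x" for x
    by (intro DERIV_add h2 f2 that)
  obtain f4 where f4: "\<And>x. 0 < x \<Longrightarrow> (f3 has_real_derivative f4 x) (at x)"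
      and ode3: "\<And>x. 0 < x \<Longrightarrow> 2 * x * f4 x + (d + 2 + 2 + 2 - x) * f3 x = h3 x + f2 x + f2 x + f2 x"
      and lim3: "((\<lambda>x. gamma_weight (d + 2 + 2 + 2) x * f3 x) \<longlongrightarrow> 0) (at_right 0)"
        "((\<lambda>x. gamma_weight (d + 2 + 2 + 2) x * f3 x) \<longlongrightarrow> 0) at_top"
    using stein_derivative_step[OF d2(2) f3 ode2 \<psi>2 lim2 D2] by metis
  have \<psi>3: "\<bar>h3 x + f2 x + f2 x + f2 x\<bar> \<le> B3 + 3 * (C * (B2 + 2 * (C * (B1 + C))))" if "0 < x" for x
    using B3[of x] b2[OF that] by linarith
  have b3: "\<bar>f3 x\<bar> \<le> C * (B3 + 3 * (C * (B2 + 2 * (C * (B1 + C)))))" if "0 < x" for x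
    using stein_solution_bound[OF d2(3) f4 ode3 \<psi>3 lim3 that] d nonneg by (intro weaken) auto
  show ?thesis by (rule that[OF f2 f3 b0 b1 b2 b3])
qed

section \<open>A smooth step with explicit derivative bounds\<close>

definition clamp01 :: "real \<Rightarrow> real" where
  "clamp01 t = max 0 (min 1 t)"

text \<open>Outside the unit interval the composition is constant; at its two ends the one-sided
  difference quotients agree because \<open>Q'\<close> vanishes there.\<close>

lemma DERIV_comp_clamp01:
  assumes Q: "\<And>t. (Q has_real_derivative Q' t) (at t)" and "Q' 0 = 0" and "Q' 1 = 0"
  shows "((\<lambda>t. Q (clamp01 t)) has_real_derivative Q' (clamp01 t)) (at t)"
proof -
  have Qs: "((\<lambda>y. (Q y - Q t) / (y - t)) \<longlongrightarrow> Q' t) (at_left t)"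
    "((\<lambda>y. (Q y - Q t) / (y - t)) \<longlongrightarrow> Q' t) (at_right t)" for t
    using Q[of t] by (auto simp: has_field_derivative_iff filterlim_at_split)
  have left: "((\<lambda>y. (Q (clamp01 y) - Q (clamp01 t)) / (y - t)) \<longlongrightarrow> Q' (clamp01 t)) (at_left t)"
  proof (cases "0 < t \<and> t \<le> 1")
    case True
    have "eventually (\<lambda>y. 0 < y \<and> y < t) (at_left t)"
      using True by (auto simp: eventually_at_left_field)
    then have "eventually (\<lambda>y. (Q y - Q t) / (y - t) = (Q (clamp01 y) - Q (clamp01 t)) / (y - t)) (at_left t)"
      by eventually_elim (use True in \<open>auto simp: clamp01_def\<close>)
    moreover have "Q' (clamp01 t) = Q' t" using True by (simp add: clamp01_def)
    ultimately show ?thesis using Lim_transform_eventually[OF Qs(1)[of t]] by simp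
  next
    case False
    have "eventually (\<lambda>y. y < t \<and> (t > 1 \<longrightarrow> 1 < y)) (at_left t)"
      by (auto simp: eventually_at_left_field intro!: exI[of _ "if t > 1 then 1 else t - 1"])
    then have "eventually (\<lambda>y. (Q (clamp01 y) - Q (clamp01 t)) / (y - t) = 0) (at_left t)"
      by eventually_elim (use False in \<open>auto simp: clamp01_def min_def max_def\<close>)
    then have "((\<lambda>y. (Q (clamp01 y) - Q (clamp01 t)) / (y - t)) \<longlongrightarrow> 0) (at_left t)"
      by (rule tendsto_eventually)
    moreover have "Q' (clamp01 t) = 0" using False assms by (auto simp: clamp01_def)
    ultimately show ?thesis by (simp only:)
  qed
  have right: "((\<lambda>y. (Q (clamp01 y) - Q (clamp01 t)) / (y - t)) \<longlongrightarrow> Q' (clamp01 t)) (at_right t)"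
  proof (cases "0 \<le> t \<and> t < 1")
    case True
    have "eventually (\<lambda>y. t < y \<and> y < 1) (at_right t)"
      using True by (auto simp: eventually_at_right_field)
    then have "eventually (\<lambda>y. (Q y - Q t) / (y - t) = (Q (clamp01 y) - Q (clamp01 t)) / (y - t)) (at_right t)"
      by eventually_elim (use True in \<open>auto simp: clamp01_def\<close>)
    moreover have "Q' (clamp01 t) = Q' t" using True by (simp add: clamp01_def)
    ultimately show ?thesis using Lim_transform_eventually[OF Qs(2)[of t]] by simp
  next
    case False
    have "eventually (\<lambda>y. t < y \<and> (t < 0 \<longrightarrow> y < 0)) (at_right t)"
      by (auto simp: eventually_at_right_field intro!: exI[of _ "if t < 0 then 0 else t + 1"])
    then have "eventually (\<lambda>y. (Q (clamp01 y) - Q (clamp01 t)) / (y - t) = 0) (at_right t)"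
      by eventually_elim (use False in \<open>auto simp: clamp01_def min_def max_def\<close>)
    then have "((\<lambda>y. (Q (clamp01 y) - Q (clamp01 t)) / (y - t)) \<longlongrightarrow> 0) (at_right t)"
      by (rule tendsto_eventually)
    moreover have "Q' (clamp01 t) = 0" using False assms by (auto simp: clamp01_def)
    ultimately show ?thesis by (simp only:)
  qed
  show ?thesis
    unfolding has_field_derivative_iff using left right by (rule filterlim_split_at)
qed

text \<open>The profile \<open>q0\<close> falls from 1 to 0 with slope
  \<open>- 140 (t (1 - t))^3\<close>, where 140 is \<open>1 / Beta 4 4\<close>. The triple zeros at
  0 and 1 make the first three derivatives vanish there, so clamping the argument keeps three
  derivatives.\<close>

lemma smooth_step:
  assumes \<alpha>: "0 < \<alpha>"
  obtains h h1 h2 h3 :: "real \<Rightarrow> real" where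
    "\<And>x. (h has_real_derivative h1 x) (at x)"
    "\<And>x. (h1 has_real_derivative h2 x) (at x)"
    "\<And>x. (h2 has_real_derivative h3 x) (at x)"
    "\<And>x. 0 \<le> h x" "\<And>x. h x \<le> 1"
    "\<And>x. x \<le> z \<Longrightarrow> h x = 1" "\<And>x. z + \<alpha> \<le> x \<Longrightarrow> h x = 0"
    "\<And>x. \<bar>h1 x\<bar> \<le> 2.2 / \<alpha>" "\<And>x. \<bar>h2 x\<bar> \<le> 8 / \<alpha> ^ 2" "\<And>x. \<bar>h3 x\<bar> \<le> 53 / \<alpha> ^ 3"
proof -
  define q0 :: "real \<Rightarrow> real" where "q0 = (\<lambda>t. 1 - (35 * t^4 - 84 * t^5 + 70 * t^6 - 20 * t^7))"
  define q1 :: "real \<Rightarrow> real" where "q1 = (\<lambda>t. - (140 * (t * (1 - t))^3))"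
  define q2 :: "real \<Rightarrow> real" where "q2 = (\<lambda>t. - (420 * (t * (1 - t))^2 * (1 - 2 * t)))"
  define q3 :: "real \<Rightarrow> real" where "q3 = (\<lambda>t. - (840 * (t * (1 - t)) * (1 - 5 * (t * (1 - t)))))"
  define s where "s = (\<lambda>x. (x - z) / \<alpha>)"
  have D0: "((\<lambda>t. q0 (clamp01 t)) has_real_derivative q1 (clamp01 t)) (at t)" for t
  proof (rule DERIV_comp_clamp01)
    show "(q0 has_real_derivative q1 t) (at t)" for t
      unfolding q0_def q1_def
      by ((rule derivative_eq_intros refl | simp)+; simp add: algebra_simps power_numeral_reduce)
  qed (simp_all add: q1_def)
  have D1: "((\<lambda>t. q1 (clamp01 t)) has_real_derivative q2 (clamp01 t)) (at t)" for t
  proof (rule DERIV_comp_clamp01)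
    show "(q1 has_real_derivative q2 t) (at t)" for t
      unfolding q1_def q2_def
      by ((rule derivative_eq_intros refl | simp)+; simp add: algebra_simps power_numeral_reduce)
  qed (simp_all add: q2_def)
  have D2: "((\<lambda>t. q2 (clamp01 t)) has_real_derivative q3 (clamp01 t)) (at t)" for t
  proof (rule DERIV_comp_clamp01)
    show "(q2 has_real_derivative q3 t) (at t)" for t
      unfolding q2_def q3_def
      by ((rule derivative_eq_intros refl | simp)+; simp add: algebra_simps power_numeral_reduce)
  qed (simp_all add: q3_def)
  have s: "(s has_real_derivative 1 / \<alpha>) (at x)" for x
    unfolding s_def using \<alpha> by (auto intro!: derivative_eq_intros)
  have c: "0 \<le> clamp01 t" "clamp01 t \<le> 1" for t by (auto simp: clamp01_def)
  have p: "0 \<le> t * (1 - t)" "t * (1 - t) \<le> 1 / 4" if "0 \<le> t" "t \<le> 1" for t :: real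
  proof -
    show "0 \<le> t * (1 - t)" using that by simp
    have "0 \<le> (t - 1 / 2)\<^sup>2" by simp
    then show "t * (1 - t) \<le> 1 / 4" by (simp add: power2_eq_square algebra_simps)
  qed
  have b1: "\<bar>q1 t\<bar> \<le> 2.2" "q1 t \<le> 0" if t: "0 \<le> t" "t \<le> 1" for t
  proof -
    have "(t * (1 - t))^3 \<le> (1 / 4)^3" using p[OF t] by (intro power_mono)
    moreover have "0 \<le> (t * (1 - t))^3" using p[OF t] by simp
    ultimately show "\<bar>q1 t\<bar> \<le> 2.2" "q1 t \<le> 0" by (auto simp: q1_def power3_eq_cube)
  qed
  have b2: "\<bar>q2 t\<bar> \<le> 8" if t: "0 \<le> t" "t \<le> 1" for t
  proof -
    let ?y = "t * (1 - t)"
    have y: "0 \<le> ?y" "?y \<le> 1 / 4" by (fact p[OF t])+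
    have sq: "(1 - 2 * t)\<^sup>2 = 1 - 4 * ?y" by (simp add: power2_eq_square algebra_simps)
    \<comment> \<open>After squaring, \<open>(1 - 2 t)^2\<close> is \<open>1 - 4 y\<close>, so a
      polynomial in \<open>y\<close> is to be bounded. Its maximum is at \<open>y = 1/5\<close>,
      whence the double factor; the true bound for \<open>q2\<close> is about 7.52, rounded up to
      8.\<close>
    have y4: "x ^ 4 * (1 - 4 * x) \<le> 7 / 20000" if "0 \<le> x" for x :: real
    proof -
      have "0 \<le> (x - 1 / 5)\<^sup>2 * (4 * x ^ 3 + 3 / 5 * x\<^sup>2 + 2 / 25 * x + 1 / 125)"
        using that by simp
      also have "\<dots> = 1 / 3125 - x ^ 4 * (1 - 4 * x)"
        by (simp add: power2_eq_square power3_eq_cube power4_eq_xxxx field_simps)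
      finally show ?thesis by linarith
    qed
    have "(q2 t)\<^sup>2 = 420\<^sup>2 * (?y ^ 4 * (1 - 4 * ?y))"
      unfolding q2_def sq[symmetric] by (simp add: power_mult_distrib)
    also from y4[OF y(1)] have "420\<^sup>2 * (?y ^ 4 * (1 - 4 * ?y)) \<le> 420\<^sup>2 * (7 / 20000)"
      by (rule mult_left_mono) simp
    finally have "(q2 t)\<^sup>2 \<le> 8\<^sup>2" by simp
    then show ?thesis by (metis abs_le_square_iff abs_numeral)
  qed
  have b3: "\<bar>q3 t\<bar> \<le> 53" if t: "0 \<le> t" "t \<le> 1" for t
  proof -
    let ?y = "t * (1 - t)"
    have y: "0 \<le> ?y" "?y \<le> 1 / 4" by (fact p[OF t])+
    have "0 \<le> (?y - 1 / 10)\<^sup>2" by simp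
    then have "?y * (1 - 5 * ?y) \<le> 1 / 20" by (simp add: power2_eq_square algebra_simps)
    \<comment> \<open>The minimum is at \<open>y = 1/4\<close>; it gives
      \<open>840 / 16 = 52.5\<close> and decides the constant 53.\<close>
    moreover have "- (1 / 16) \<le> ?y * (1 - 5 * ?y)"
    proof -
      have "0 \<le> (1 / 4 - ?y) * (5 * ?y + 1 / 4)" using y by simp
      then show ?thesis by (simp add: algebra_simps)
    qed
    ultimately show ?thesis unfolding q3_def abs_le_iff by (simp only: mult.assoc) linarith
  qed
  have q0_bounds: "0 \<le> q0 t" "q0 t \<le> 1" if t: "0 \<le> t" "t \<le> 1" for t
  proof -
    have D: "(q0 has_real_derivative q1 t) (at t)" for t
      unfolding q0_def q1_def
      by ((rule derivative_eq_intros refl | simp)+; simp add: algebra_simps power_numeral_reduce)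
    have "q0 1 \<le> q0 t"
      by (rule DERIV_nonpos_imp_nonincreasing[OF t(2)]) (use D b1(2) t in \<open>meson order_trans\<close>)
    moreover have "q0 t \<le> q0 0"
      by (rule DERIV_nonpos_imp_nonincreasing[OF t(1)]) (use D b1(2) t in \<open>meson order_trans\<close>)
    ultimately show "0 \<le> q0 t" "q0 t \<le> 1" by (simp_all add: q0_def)
  qed
  show ?thesis
  proof (rule that[of "\<lambda>x. q0 (clamp01 (s x))" "\<lambda>x. q1 (clamp01 (s x)) / \<alpha>"
        "\<lambda>x. q2 (clamp01 (s x)) / \<alpha> ^ 2" "\<lambda>x. q3 (clamp01 (s x)) / \<alpha> ^ 3"])
    fix x
    show "((\<lambda>x. q0 (clamp01 (s x))) has_real_derivative q1 (clamp01 (s x)) / \<alpha>) (at x)"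
      using DERIV_chain2[OF D0 s] by simp
    show "((\<lambda>x. q1 (clamp01 (s x)) / \<alpha>) has_real_derivative q2 (clamp01 (s x)) / \<alpha> ^ 2) (at x)"
      using DERIV_cdivide[OF DERIV_chain2[OF D1 s], of \<alpha>] by (simp add: power2_eq_square)
    show "((\<lambda>x. q2 (clamp01 (s x)) / \<alpha> ^ 2) has_real_derivative q3 (clamp01 (s x)) / \<alpha> ^ 3) (at x)"
      using DERIV_cdivide[OF DERIV_chain2[OF D2 s], of "\<alpha> ^ 2"]
      by (simp add: power2_eq_square power3_eq_cube mult.assoc)
    show "0 \<le> q0 (clamp01 (s x))" "q0 (clamp01 (s x)) \<le> 1"
      using q0_bounds c by auto
    show "\<bar>q1 (clamp01 (s x)) / \<alpha>\<bar> \<le> 2.2 / \<alpha>"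
      using divide_right_mono[OF b1(1)[OF c], of "\<alpha>"] \<alpha> by simp
    show "\<bar>q2 (clamp01 (s x)) / \<alpha> ^ 2\<bar> \<le> 8 / \<alpha> ^ 2"
      using divide_right_mono[OF b2[OF c], of "\<alpha> ^ 2"] \<alpha> by simp
    show "\<bar>q3 (clamp01 (s x)) / \<alpha> ^ 3\<bar> \<le> 53 / \<alpha> ^ 3"
      using divide_right_mono[OF b3[OF c], of "\<alpha> ^ 3"] \<alpha> by simp
  next
    fix x assume "x \<le> z"
    then have "s x \<le> 0" using \<alpha> by (simp add: s_def divide_nonpos_pos)
    then show "q0 (clamp01 (s x)) = 1" by (simp add: clamp01_def q0_def)
  next
    fix x assume "z + \<alpha> \<le> x"
    then have "1 \<le> s x" using \<alpha> by (simp add: s_def field_simps)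
    then show "q0 (clamp01 (s x)) = 0" by (simp add: clamp01_def q0_def)
  qed
qed

section \<open>A uniform bound on the chi-square density\<close>

lemma powr_mult_exp_le:
  fixes b x :: real
  assumes "0 < b" and "0 < x"
  shows "x powr b * exp (- (x / 2)) \<le> (2 * b) powr b * exp (- b)"
proof -
  \<comment> \<open>The tangent of the logarithm is taken at the maximiser
    \<open>x = 2 b\<close>.\<close>
  have "ln (x / (2 * b)) \<le> x / (2 * b) - 1"
    using assms by (intro ln_le_minus_one) auto
  then have "b * ln (x / (2 * b)) \<le> b * (x / (2 * b) - 1)"
    using assms by (intro mult_left_mono) auto
  then have "b * ln x - x / 2 \<le> b * ln (2 * b) - b"
    using assms by (simp add: ln_div algebra_simps)
  then have "exp (b * ln x - x / 2) \<le> exp (b * ln (2 * b) - b)" by simp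
  moreover have "x powr b * exp (- (x / 2)) = exp (b * ln x - x / 2)"
    using assms by (simp add: powr_def exp_add[symmetric])
  moreover have "(2 * b) powr b * exp (- b) = exp (b * ln (2 * b) - b)"
    using assms by (simp add: powr_def exp_add[symmetric])
  ultimately show ?thesis by simp
qed

text \<open>The derivative of the difference is half a square. The bound agrees with the logarithm
  to second order at 1, a precision that \<open>ln t \<le> t - 1\<close> lacks and that the
  recursion for the Gamma function uses.\<close>

lemma ln_le_half_diff_inverse:
  fixes t :: real
  assumes "1 \<le> t"
  shows "ln t \<le> (t - 1 / t) / 2"
proof -
  have "(\<lambda>t::real. (t - 1 / t) / 2 - ln t) 1 \<le> (\<lambda>t::real. (t - 1 / t) / 2 - ln t) t"
  proof (rule DERIV_nonneg_imp_nondecreasing[OF assms])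
    fix s :: real assume "1 \<le> s" "s \<le> t"
    then have "((\<lambda>t::real. (t - 1 / t) / 2 - ln t) has_real_derivative (1 - 1 / s)\<^sup>2 / 2) (at s)"
      by (auto intro!: derivative_eq_intros simp: field_simps power2_eq_square)
    then show "\<exists>y. ((\<lambda>t::real. (t - 1 / t) / 2 - ln t) has_real_derivative y) (at s) \<and> 0 \<le> y"
      by (intro exI[of _ "(1 - 1 / s)\<^sup>2 / 2"]) auto
  qed
  then show ?thesis by simp
qed

text \<open>The quotient \<open>b\<^sup>b e\<^sup>-\<^sup>b \<surd>(b + 1) / \<Gamma>(b + 1)\<close> decreases along
  \<open>b \<mapsto> b + 1\<close>, so that Stirling's formula is not needed.\<close>

lemma Gamma_lower_bound:
  assumes "0 < k"
  shows "(real k / 2) powr (real k / 2) * exp (- (real k / 2)) * sqrt (real k / 2 + 1)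
    \<le> 0.61 * Gamma (real k / 2 + 1)"
  using assms
proof (induction k rule: less_induct)
  case (less k)
  consider "k = 1" | "k = 2" | "2 < k" using less.prems by linarith
  then show ?case
  proof cases
    \<comment> \<open>The quotient decreases along \<open>k\<close>, \<open>k + 2\<close>, so the
      cases 1 and 2 decide. It is largest at \<open>k = 1\<close>, with value
      \<open>sqrt (3 / (exp 1 * pi)) < 0.593\<close>; 0.61 leaves room for the crude bounds on
      \<open>exp 1\<close> and \<open>pi\<close>.\<close>
    case 1
    have "(1 / 2 :: real) \<notin> \<int>\<^sub>\<le>\<^sub>0"
    proof
      assume "(1 / 2 :: real) \<in> \<int>\<^sub>\<le>\<^sub>0"
      then obtain m where "(1 / 2 :: real) = of_int m" "m \<le> 0" by (auto elim!: nonpos_Ints_cases)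
      moreover from this(2) have "real_of_int m \<le> 0" by simp
      ultimately show False by linarith
    qed
    then have G: "Gamma (1 / 2 + 1) = sqrt pi / (2 :: real)"
      using Gamma_plus1[of "1 / 2 :: real"] by (simp add: Gamma_one_half_real)
    have e: "2.7 < exp (1::real)" using e_approx_32 by (simp add: abs_if split: if_splits)
    have pi: "3 < pi" by (rule pi_gt3)
    have "3 \<le> 0.3721 * (2.7 * 3 :: real)" by simp
    also have "\<dots> \<le> 0.3721 * (exp 1 * pi)"
      using e pi by (intro mult_left_mono mult_mono) auto
    finally have "3 / exp 1 \<le> 0.3721 * pi" by (simp add: field_simps)
    then have "sqrt (3 / exp 1) \<le> sqrt (0.61\<^sup>2 * pi)"
      by (intro real_sqrt_le_mono) (simp add: power2_eq_square)
    then have sq: "sqrt (3 / exp 1) \<le> 0.61 * sqrt pi"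
      unfolding real_sqrt_mult by simp
    have "exp (- (1 / 2) :: real) = sqrt (exp (- 1))"
      by (rule real_sqrt_unique[symmetric]) (simp_all add: power2_eq_square exp_add[symmetric])
    then have "(1 / 2) powr (1 / 2) * exp (- (1 / 2)) * sqrt (1 / 2 + 1)
        = sqrt (1 / 2 * exp (- 1) * (3 / 2) :: real)"
      by (simp add: powr_half_sqrt real_sqrt_mult[symmetric])
    also have "1 / 2 * exp (- 1) * (3 / 2) = (1 / 2)\<^sup>2 * (3 / exp 1 :: real)"
      by (simp add: exp_minus power2_eq_square field_simps)
    also have "sqrt ((1 / 2)\<^sup>2 * (3 / exp 1)) = sqrt (3 / exp 1) / 2"
      unfolding real_sqrt_mult by simp
    also have "\<dots> \<le> 0.61 * Gamma (1 / 2 + 1)"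
      using sq G by simp
    finally show ?thesis using 1 by simp
  next
    case 2
    have "2.7 \<le> exp (1::real)" using e_approx_32 by (simp add: abs_if split: if_splits)
    moreover have "sqrt 2 \<le> 1.5" by (rule real_le_lsqrt) (auto simp: power2_eq_square)
    ultimately have "sqrt 2 / exp 1 \<le> 1.5 / (2.7 :: real)" by (intro frac_le) auto
    then have "sqrt 2 / exp 1 \<le> (0.61 :: real)" by simp
    then show ?thesis using 2 Gamma_fact[of 1, where 'a = real] by (simp add: exp_minus field_simps)
  next
    case 3
    define b where "b = real k / 2 - 1"
    have b: "0 < b" using 3 by (simp add: b_def)
    have kb: "real k / 2 = b + 1" by (simp add: b_def)
    have IH: "b powr b * exp (- b) * sqrt (b + 1) \<le> 0.61 * Gamma (b + 1)"
      using less.IH[of "k - 2"] 3 by (simp add: b_def of_nat_diff diff_divide_distrib)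
    \<comment> \<open>The monotonicity of the quotient in logarithmic form. The second-order bound
      saves \<open>1 / (2 (b + 1))\<close> in the first term, which is just what the second term may
      cost.\<close>
    have "b * ln ((b + 1) / b) + ln ((b + 2) / (b + 1)) / 2 \<le> 1"
    proof -
      have "b * ln ((b + 1) / b) \<le> b * (((b + 1) / b - 1 / ((b + 1) / b)) / 2)"
        using b by (intro mult_left_mono ln_le_half_diff_inverse) auto
      also have "\<dots> = 1 - 1 / (2 * (b + 1))"
        using b by (simp add: divide_simps) (simp add: algebra_simps)
      finally have 1: "b * ln ((b + 1) / b) \<le> 1 - 1 / (2 * (b + 1))" .
      have "ln ((b + 2) / (b + 1)) \<le> (b + 2) / (b + 1) - 1"
        using b by (intro ln_le_minus_one) auto
      also have "\<dots> = 1 / (b + 1)" using b by (simp add: field_simps)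
      finally have "ln ((b + 2) / (b + 1)) / 2 \<le> 1 / (2 * (b + 1))"
        using b by (simp add: field_simps)
      then show ?thesis using 1 by linarith
    qed
    then have "b * ln (b + 1) + ln (b + 2) / 2 - 1 \<le> b * ln b + ln (b + 1) / 2"
      using b by (simp add: ln_div algebra_simps diff_divide_distrib)
    then have "exp (b * ln (b + 1) + ln (b + 2) / 2 - 1) \<le> exp (b * ln b + ln (b + 1) / 2)" by simp
    moreover have "exp (ln x / 2) = sqrt x" if "0 < x" for x :: real
      using that powr_half_sqrt[of x] by (simp add: powr_def)
    ultimately have key: "(b + 1) powr b * sqrt (b + 2) / exp 1 \<le> b powr b * sqrt (b + 1)"
      using b by (simp add: powr_def exp_add exp_diff)
    have "(b + 1) powr (b + 1) * exp (- (b + 1)) * sqrt (b + 1 + 1)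
        = (b + 1) * exp (- b) * ((b + 1) powr b * sqrt (b + 2) / exp 1)"
      using b by (simp add: powr_add exp_add exp_minus exp_diff field_simps)
    also have "\<dots> \<le> (b + 1) * exp (- b) * (b powr b * sqrt (b + 1))"
      using key b by (intro mult_left_mono) auto
    also have "\<dots> = (b + 1) * (b powr b * exp (- b) * sqrt (b + 1))" by simp
    also have "\<dots> \<le> (b + 1) * (0.61 * Gamma (b + 1))"
      using IH b by (intro mult_left_mono) auto
    also have "\<dots> = 0.61 * Gamma (b + 1 + 1)"
      using b Gamma_plus1[of "b + 1"] by (simp add: nonpos_Ints_def)
    finally show ?thesis unfolding kb .
  qed
qed

text \<open>The density peaks at \<open>x = p - 2\<close>; its value there is controlled by
  \<open>Gamma_lower_bound\<close> with \<open>k = p - 2\<close>, which is positive for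
  \<open>p \<ge> 3\<close>.\<close>

lemma chi_density_le:
  assumes "3 \<le> p"
  shows "chi_density (real p / 2) x \<le> 0.61 / sqrt (2 * real p)"
proof (cases "0 < x")
  case False
  then show ?thesis by (simp add: chi_density_def)
next
  case x: True
  define b where "b = real (p - 2) / 2"
  have b: "0 < b" "real p / 2 = b + 1" using assms by (auto simp: b_def of_nat_diff field_simps)
  have G: "0 < Gamma (b + 1)" using b by (intro Gamma_real_pos) auto
  have "sqrt (2 * real p) = sqrt (4 * (b + 1))" using b(2) by (intro arg_cong[where f = sqrt]) (simp add: field_simps)
  then have sq: "sqrt (2 * real p) = 2 * sqrt (b + 1)" using real_sqrt_mult[of 4 "b + 1"] by simp
  have "chi_density (real p / 2) x = x powr b * exp (- (x / 2)) / (2 powr (b + 1) * Gamma (b + 1))"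
    unfolding b(2) using x by (simp add: chi_density_def)
  also have "\<dots> \<le> (2 * b) powr b * exp (- b) / (2 powr (b + 1) * Gamma (b + 1))"
    using powr_mult_exp_le[OF b(1) x] G by (intro divide_right_mono) auto
  also have "\<dots> = b powr b * exp (- b) * sqrt (b + 1) / (2 * sqrt (b + 1) * Gamma (b + 1))"
    using b by (simp add: powr_mult powr_add field_simps)
  also have "\<dots> \<le> 0.61 * Gamma (b + 1) / (2 * sqrt (b + 1) * Gamma (b + 1))"
    using Gamma_lower_bound[of "p - 2"] assms b G
    by (intro divide_right_mono) (auto simp: b_def)
  also have "\<dots> = 0.61 / sqrt (2 * real p)" using G unfolding sq by simp
  finally show ?thesis .
qed

lemma chi_density_2_le: "chi_density (real 2 / 2) x \<le> 1 / 2"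
  by (auto simp: chi_density_def)

lemma chi_square_window:
  assumes p: "0 < p" and L: "\<And>x. chi_density (real p / 2) x \<le> L" and ab: "a \<le> b"
  shows "measure (chi_square p) {..b} \<le> measure (chi_square p) {..a} + L * (b - a)"
proof -
  interpret prob_space "chi_square p" by (rule prob_space_chi_square)
  have L0: "0 \<le> L" using L[of 0] by (simp add: chi_density_def)
  have "emeasure (chi_square p) {a<..b} = (\<integral>\<^sup>+x. ennreal (chi_density (real p / 2) x) * indicator {a<..b} x \<partial>lborel)"
    unfolding chi_square_density[OF p] by (subst emeasure_density) auto
  also have "\<dots> \<le> (\<integral>\<^sup>+x. ennreal L * indicator {a<..b} x \<partial>lborel)"
    by (intro nn_integral_mono mult_right_mono ennreal_leI L) auto
  also have "\<dots> = ennreal (L * (b - a))"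
    using ab L0 by (simp add: nn_integral_cmult ennreal_mult)
  finally have "measure (chi_square p) {a<..b} \<le> L * (b - a)"
    using ab L0 by (simp add: emeasure_eq_measure)
  moreover have "measure (chi_square p) {..b} = measure (chi_square p) {..a} + measure (chi_square p) {a<..b}"
    using ab by (subst finite_measure_Union[symmetric]) (auto simp: ivl_disj_un)
  ultimately show ?thesis by simp
qed

section \<open>Existence of the Stein solution\<close>

lemma chi_density_eq_gamma_weight:
  "0 < x \<Longrightarrow> chi_density (m / 2) x = gamma_weight m x / (x * (2 powr (m / 2) * Gamma (m / 2)))"
  by (simp add: chi_density_def gamma_weight_def powr_diff)

text \<open>Variation of constants: the weighted solution is a multiple of the integral
  \<open>I\<close> of \<open>h - a\<close> against the chi-square law up to \<open>x\<close>. It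
  vanishes at infinity because \<open>a\<close> is the mean of \<open>h\<close>, and at 0 because
  the density is bounded for \<open>p \<ge> 2\<close>, so that \<open>I\<close> grows at most
  linearly.\<close>

lemma stein_solution_exists:
  fixes h h1 :: "real \<Rightarrow> real"
  assumes p: "2 \<le> p"
    and h: "\<And>x. (h has_real_derivative h1 x) (at x)"
    and bnd: "\<And>x. \<bar>h x\<bar> \<le> B"
    and a: "a = integral\<^sup>L (chi_square p) h"
  obtains f f1 where
    "\<And>x. 0 < x \<Longrightarrow> (f has_real_derivative f1 x) (at x)"
    "\<And>x. 0 < x \<Longrightarrow> 2 * x * f1 x + (real p - x) * f x = h x - a"
    "((\<lambda>x. gamma_weight (real p) x * f x) \<longlongrightarrow> 0) (at_right 0)"
    "((\<lambda>x. gamma_weight (real p) x * f x) \<longlongrightarrow> 0) at_top"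
proof
  interpret prob_space "chi_square p" by (rule prob_space_chi_square)
  let ?w = "gamma_weight (real p)"
  let ?g = "chi_density (real p / 2)"
  define c where "c = 2 powr (real p / 2) * Gamma (real p / 2)"
  have c: "0 < c" using p by (simp add: c_def Gamma_real_pos)
  define k where "k = (\<lambda>x. ?g x * (h x - a))"
  define I where "I = (\<lambda>x. LINT t|lborel. indicator {..x} t *\<^sub>R k t)"
  have hc: "continuous_on UNIV h"
    using h by (meson DERIV_continuous_on has_field_derivative_at_within)
  have hm [measurable]: "h \<in> borel_measurable borel"
    by (rule borel_measurable_continuous_onI[OF hc])
  have inth: "integrable (chi_square p) h"
    by (rule integrable_const_bound[of _ B]) (use bnd in \<open>auto simp: chi_square_def\<close>)
  have g0: "0 \<le> ?g x" for x using p by (intro chi_density_nonneg) auto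
  have "integrable (chi_square p) (\<lambda>x. h x - a)" using inth by simp
  then have intk: "integrable lborel k"
    unfolding chi_square_density[OF order_less_le_trans[OF zero_less_numeral p]] k_def
    by (subst (asm) integrable_density) (auto simp: g0)
  have "integral\<^sup>L lborel k = integral\<^sup>L (chi_square p) (\<lambda>x. h x - a)"
    unfolding chi_square_density[OF order_less_le_trans[OF zero_less_numeral p]] k_def
    by (subst integral_density) (auto simp: g0)
  also have "\<dots> = 0" using inth by (simp add: a prob_space)
  finally have int0: "integral\<^sup>L lborel k = 0" .
  have I_lim_top: "(I \<longlongrightarrow> 0) at_top"
    unfolding I_def using tendsto_integral_at_top[OF _ intk] int0 by simp
  have g_le: "?g x \<le> 1" for x
  proof (cases "p = 2")
    case True
    then show ?thesis using chi_density_2_le[of x] by simp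
  next
    case False
    then have "?g x \<le> 0.61 / sqrt (2 * real p)" using p by (intro chi_density_le) auto
    also have "\<dots> \<le> 0.61 / 1" using p by (intro divide_left_mono) auto
    finally show ?thesis by simp
  qed
  have B0: "0 \<le> B" using bnd[of 0] by linarith
  have k_le: "\<bar>k t\<bar> \<le> B + \<bar>a\<bar>" for t
  proof -
    have "\<bar>k t\<bar> = ?g t * \<bar>h t - a\<bar>" using g0[of t] by (simp add: k_def abs_mult)
    also have "\<dots> \<le> 1 * (B + \<bar>a\<bar>)" using g_le[of t] g0[of t] bnd[of t] by (intro mult_mono) auto
    finally show ?thesis by simp
  qed
  have intk_ind: "integrable lborel (\<lambda>t. indicator A t *\<^sub>R k t)" if "A \<in> sets borel" for A
    using intk that by (intro integrable_mult_indicator) auto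
  have intk_set: "set_integrable lborel A k" if "A \<in> sets borel" for A
    unfolding set_integrable_def by (rule intk_ind[OF that])
  have I_le: "norm (I x) \<le> (B + \<bar>a\<bar>) * x" if x: "0 < x" for x
  proof -
    have "norm (I x) \<le> (LINT t|lborel. (B + \<bar>a\<bar>) * indicator {0..x} t)"
      unfolding I_def
    proof (rule Bochner_Integration.integral_norm_bound_integral)
      show "norm (indicator {..x} t *\<^sub>R k t) \<le> (B + \<bar>a\<bar>) * indicator {0..x} t" for t
        using k_le[of t] B0 by (auto simp: indicator_def k_def chi_density_def)
      show "integrable lborel (\<lambda>t. indicator {..x} t *\<^sub>R k t)" by (rule intk_ind) simp
      show "integrable lborel (\<lambda>t. (B + \<bar>a\<bar>) * indicator {0..x} t)"
        by (intro integrable_mult_right integrable_real_indicator) (auto simp: emeasure_lborel_Icc_eq)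
    qed
    then show ?thesis using x by simp
  qed
  have "((\<lambda>x. (B + \<bar>a\<bar>) * x) \<longlongrightarrow> (B + \<bar>a\<bar>) * 0) (at_right 0)"
    by (intro tendsto_intros)
  then have "((\<lambda>x. (B + \<bar>a\<bar>) * x) \<longlongrightarrow> 0) (at_right 0)" by simp
  moreover have "\<forall>\<^sub>F x in at_right 0. norm (I x) \<le> (B + \<bar>a\<bar>) * x"
    using eventually_at_right_less[of "0::real"] by eventually_elim (rule I_le)
  ultimately have I_lim0: "(I \<longlongrightarrow> 0) (at_right 0)"
    by (rule Lim_null_comparison[rotated])
  have DI: "(I has_real_derivative k x) (at x)" if x: "0 < x" for x
  proof -
    \<comment> \<open>The integrand may jump at 0, as for \<open>p = 2\<close>. Splitting off the
      part below \<open>l > 0\<close> leaves a continuous integrand on a compact interval around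
      \<open>x\<close>.\<close>
    define l where "l = x / 2"
    have l: "0 < l" "l < x" using x by (auto simp: l_def)
    have I_eq: "I y = (LINT t:{..<l}|lborel. k t) + integral {l..y} k" if y: "l \<le> y" for y
    proof -
      have "{..y} = {..<l} \<union> {l..y}" using y by auto
      then have "I y = (LINT t:{..<l} \<union> {l..y}|lborel. k t)"
        by (simp add: I_def set_lebesgue_integral_def)
      also have "\<dots> = (LINT t:{..<l}|lborel. k t) + (LINT t:{l..y}|lborel. k t)"
        by (rule set_integral_Un) (auto simp: intk_set)
      also have "(LINT t:{l..y}|lborel. k t) = integral {l..y} k"
        by (rule set_borel_integral_eq_integral) (simp add: intk_set)
      finally show ?thesis .
    qed
    have "continuous_on {l..x + 1} (\<lambda>t. t powr (real p / 2 - 1) * exp (- (t / 2)) / c * (h t - a))"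
      using l c by (intro continuous_intros continuous_on_subset[OF hc]) auto
    moreover have "t powr (real p / 2 - 1) * exp (- (t / 2)) / c * (h t - a) = k t" if "t \<in> {l..x + 1}" for t
      using that l by (simp add: k_def chi_density_def c_def)
    ultimately have kc: "continuous_on {l..x + 1} k"
      by (metis (no_types, lifting) continuous_on_eq)
    have "((\<lambda>y. integral {l..y} k) has_real_derivative k x) (at x within {l..x + 1})"
      by (rule integral_has_real_derivative[OF kc]) (use l in auto)
    then have "((\<lambda>y. (LINT t:{..<l}|lborel. k t) + integral {l..y} k) has_real_derivative 0 + k x) (at x)"
      using l by (intro DERIV_add DERIV_const) (simp add: at_within_Icc_at)
    then have "((\<lambda>y. (LINT t:{..<l}|lborel. k t) + integral {l..y} k) has_real_derivative k x) (at x)"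
      by simp
    then show ?thesis
      by (rule has_field_derivative_transform_within_open[where S = "{l<..}"]) (use l I_eq in auto)
  qed
  define f where "f = (\<lambda>x. c / 2 * I x / ?w x)"
  define f1 where "f1 = (\<lambda>x. (h x - a - (real p - x) * f x) / (2 * x))"
  show "2 * x * f1 x + (real p - x) * f x = h x - a" if "0 < x" for x
    using that by (simp add: f1_def)
  show "(f has_real_derivative f1 x) (at x)" if x: "0 < x" for x
  proof -
    have w: "0 < ?w x" by (rule gamma_weight_pos[OF x])
    have "((\<lambda>x. c / 2 * I x / ?w x) has_real_derivative
        ((c / 2 * k x) * ?w x - (c / 2 * I x) * (?w x * ((real p - x) / (2 * x)))) / (?w x * ?w x)) (at x)"
      using w by (intro DERIV_divide DERIV_cmult DI DERIV_gamma_weight x) auto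
    also have "((c / 2 * k x) * ?w x - (c / 2 * I x) * (?w x * ((real p - x) / (2 * x)))) / (?w x * ?w x) = f1 x"
      using x w c unfolding f1_def f_def k_def chi_density_eq_gamma_weight[OF x] c_def[symmetric]
      by (simp add: field_simps)
    finally show ?thesis unfolding f_def .
  qed
  have wf: "?w x * f x = c / 2 * I x" if "0 < x" for x
    using gamma_weight_pos[OF that, of "real p"] by (simp add: f_def)
  have "((\<lambda>x. c / 2 * I x) \<longlongrightarrow> c / 2 * 0) (at_right 0)"
    by (intro tendsto_intros I_lim0)
  moreover have "\<forall>\<^sub>F x in at_right 0. c / 2 * I x = ?w x * f x"
    using eventually_at_right_less[of "0::real"] by eventually_elim (simp add: wf)
  ultimately show "((\<lambda>x. ?w x * f x) \<longlongrightarrow> 0) (at_right 0)"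
    by (simp add: Lim_transform_eventually)
  have "((\<lambda>x. c / 2 * I x) \<longlongrightarrow> c / 2 * 0) at_top"
    by (intro tendsto_intros I_lim_top)
  moreover have "\<forall>\<^sub>F x in at_top. c / 2 * I x = ?w x * f x"
    using eventually_gt_at_top[of "0::real"] by eventually_elim (simp add: wf)
  ultimately show "((\<lambda>x. ?w x * f x) \<longlongrightarrow> 0) at_top"
    by (simp add: Lim_transform_eventually)
qed

section \<open>Averages over independent permutations\<close>

text \<open>Finite averages stand in for expectations, so that measurability and integrability are
  not at issue; \<open>prob_eq_family_avg\<close> returns to the probability space.\<close>

definition perm_avg :: "nat \<Rightarrow> ((nat \<Rightarrow> nat) \<Rightarrow> real) \<Rightarrow> real" where
  "perm_avg r g = (\<Sum>p\<in>perms r. g p) / fact r"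

definition family_avg :: "nat \<Rightarrow> nat set \<Rightarrow> ((nat \<Rightarrow> nat \<Rightarrow> nat) \<Rightarrow> real) \<Rightarrow> real" where
  "family_avg r I g = (\<Sum>x\<in>(\<Pi>\<^sub>E i\<in>I. perms r). g x) / fact r ^ card I"

lemma perm_avg_add: "perm_avg r (\<lambda>p. f p + g p) = perm_avg r f + perm_avg r g"
  by (simp add: perm_avg_def sum.distrib add_divide_distrib)

lemma perm_avg_diff: "perm_avg r (\<lambda>p. f p - g p) = perm_avg r f - perm_avg r g"
  by (simp add: perm_avg_def sum_subtractf diff_divide_distrib)

lemma perm_avg_cmult: "perm_avg r (\<lambda>p. c * f p) = c * perm_avg r f"
  by (simp add: perm_avg_def sum_distrib_left)

lemma perm_avg_const: "perm_avg r (\<lambda>p. c) = c"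
  by (simp add: perm_avg_def card_permutations)

lemma perm_avg_mono: "(\<And>p. p \<in> perms r \<Longrightarrow> f p \<le> g p) \<Longrightarrow> perm_avg r f \<le> perm_avg r g"
  unfolding perm_avg_def by (intro divide_right_mono sum_mono) auto

lemma perm_avg_cong: "(\<And>p. p \<in> perms r \<Longrightarrow> f p = g p) \<Longrightarrow> perm_avg r f = perm_avg r g"
  unfolding perm_avg_def by (auto intro: sum.cong)

lemma perm_avg_abs_le: "\<bar>perm_avg r f\<bar> \<le> perm_avg r (\<lambda>p. \<bar>f p\<bar>)"
  by (simp add: perm_avg_def divide_right_mono)

lemma finite_families: "finite I \<Longrightarrow> finite (\<Pi>\<^sub>E i\<in>I. perms r)"
  by (intro finite_PiE finite_perms)

lemma card_families: "finite I \<Longrightarrow> card (\<Pi>\<^sub>E i\<in>I. perms r) = fact r ^ card I"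
  by (simp add: card_PiE card_permutations)

lemma family_avg_add: "family_avg r I (\<lambda>p. f p + g p) = family_avg r I f + family_avg r I g"
  by (simp add: family_avg_def sum.distrib add_divide_distrib)

lemma family_avg_diff: "family_avg r I (\<lambda>p. f p - g p) = family_avg r I f - family_avg r I g"
  by (simp add: family_avg_def sum_subtractf diff_divide_distrib)

lemma family_avg_cmult: "family_avg r I (\<lambda>p. c * f p) = c * family_avg r I f"
  by (simp add: family_avg_def sum_distrib_left)

lemma family_avg_sum: "family_avg r I (\<lambda>p. \<Sum>a\<in>A. f a p) = (\<Sum>a\<in>A. family_avg r I (f a))"
  by (simp add: family_avg_def sum.swap[of _ A] sum_divide_distrib)

lemma family_avg_const: "finite I \<Longrightarrow> family_avg r I (\<lambda>p. c) = c"
  by (simp only: family_avg_def sum_constant card_families) simp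

lemma family_avg_mono:
  "(\<And>x. x \<in> (\<Pi>\<^sub>E i\<in>I. perms r) \<Longrightarrow> f x \<le> g x) \<Longrightarrow> family_avg r I f \<le> family_avg r I g"
  unfolding family_avg_def by (intro divide_right_mono sum_mono) auto

lemma family_avg_cong:
  "(\<And>x. x \<in> (\<Pi>\<^sub>E i\<in>I. perms r) \<Longrightarrow> f x = g x) \<Longrightarrow> family_avg r I f = family_avg r I g"
  unfolding family_avg_def by (auto intro: sum.cong)

lemma family_avg_abs_le: "\<bar>family_avg r I f\<bar> \<le> family_avg r I (\<lambda>x. \<bar>f x\<bar>)"
  by (simp add: family_avg_def divide_right_mono)

text \<open>Fubini for one coordinate. It drives the inductions on the index set and amounts to
  conditioning on the other permutations.\<close>

lemma family_avg_insert:
  assumes "finite J" and "i \<notin> J"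
  shows "family_avg r (insert i J) g = family_avg r J (\<lambda>x. perm_avg r (\<lambda>p. g (x(i := p))))"
proof -
  have "(\<Sum>x\<in>(\<Pi>\<^sub>E i\<in>insert i J. perms r). g x)
      = (\<Sum>(p, x)\<in>perms r \<times> (\<Pi>\<^sub>E i\<in>J. perms r). g (x(i := p)))"
    unfolding PiE_insert_eq
    by (subst sum.reindex[OF inj_combinator[OF assms(2)]]) (simp add: case_prod_beta)
  also have "\<dots> = (\<Sum>x\<in>(\<Pi>\<^sub>E i\<in>J. perms r). \<Sum>p\<in>perms r. g (x(i := p)))"
    by (subst sum.cartesian_product[symmetric], rule sum.swap)
  finally show ?thesis
    using assms by (simp add: family_avg_def perm_avg_def sum_divide_distrib[symmetric])
qed

section \<open>Moments of the squared length of a rank sum\<close>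

definition rank_sum :: "nat \<Rightarrow> nat set \<Rightarrow> (nat \<Rightarrow> nat \<Rightarrow> nat) \<Rightarrow> nat \<Rightarrow> real" where
  "rank_sum r I x j = (\<Sum>i\<in>I. friedman_rho r (x i) j)"

definition rank_norm2 :: "nat \<Rightarrow> nat set \<Rightarrow> (nat \<Rightarrow> nat \<Rightarrow> nat) \<Rightarrow> real" where
  "rank_norm2 r I x = (\<Sum>j=1..r. (rank_sum r I x j)\<^sup>2)"

lemma rank_sum_insert:
  assumes "finite J" and "i \<notin> J"
  shows "rank_sum r (insert i J) (x(i := p)) j = rank_sum r J x j + friedman_rho r p j"
proof -
  have "(\<Sum>k\<in>J. friedman_rho r ((x(i := p)) k) j) = (\<Sum>k\<in>J. friedman_rho r (x k) j)"
    using assms by (intro sum.cong) auto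
  then show ?thesis using assms by (simp add: rank_sum_def add.commute)
qed

lemma rank_sum_centered:
  assumes "x \<in> (\<Pi>\<^sub>E i\<in>I. perms r)"
  shows "(\<Sum>j=1..r. rank_sum r I x j) = 0"
proof -
  have "(\<Sum>j=1..r. rank_sum r I x j) = (\<Sum>i\<in>I. \<Sum>j=1..r. friedman_rho r (x i) j)"
    unfolding rank_sum_def by (rule sum.swap)
  also have "\<dots> = 0"
    using assms by (intro sum.neutral ballI sum_friedman_rho) (auto simp: PiE_iff)
  finally show ?thesis .
qed

lemma rank_norm2_nonneg: "0 \<le> rank_norm2 r I x"
  by (simp add: rank_norm2_def sum_nonneg)

lemma rank_norm2_insert:
  assumes "finite J" and "i \<notin> J" and p: "p \<in> perms r"
  shows "rank_norm2 r (insert i J) (x(i := p))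
    = rank_norm2 r J x + real r * ((real r)\<^sup>2 - 1) / 12 + 2 * rank_stat r (rank_sum r J x) p"
  unfolding rank_norm2_def rank_sum_insert[OF assms(1,2)] sum_friedman_rho_square[OF p, symmetric] rank_stat_def
  by (simp add: power2_sum sum.distrib sum_distrib_left mult.assoc)

lemma friedman_F_eq_rank_norm2:
  "friedman_F n r x = 12 / (real r * (real r + 1) * real n) * rank_norm2 r {1..n} x"
proof -
  have "(sqrt 12 / sqrt (real r * (real r + 1) * real n))\<^sup>2 = 12 / (real r * (real r + 1) * real n)"
    by (simp add: power_divide)
  then show ?thesis
    unfolding friedman_F_def friedman_S_def rank_norm2_def rank_sum_def power_mult_distrib
    by (simp add: sum_distrib_left)
qed

lemma friedman_F_nonneg: "0 \<le> friedman_F n r x"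
  by (simp add: friedman_F_def sum_nonneg)

lemma perm_avg_rank_stat: "perm_avg r (rank_stat r w) = 0"
  by (simp only: perm_avg_def sum_rank_stat div_0)

lemma perm_avg_rank_stat_cube: "perm_avg r (\<lambda>p. rank_stat r w p ^ 3) = 0"
  by (simp only: perm_avg_def sum_rank_stat_cube div_0)

lemma perm_avg_rank_stat_square:
  assumes "(\<Sum>j=1..r. w j) = 0"
  shows "perm_avg r (\<lambda>p. (rank_stat r w p)\<^sup>2) = (\<Sum>j=1..r. (w j)\<^sup>2) * (real r * (real r + 1) / 12)"
  unfolding perm_avg_def sum_rank_stat_square[OF assms] by simp

lemma perm_avg_rank_stat_fourth:
  assumes "(\<Sum>j=1..r. w j) = 0"
  shows "perm_avg r (\<lambda>p. rank_stat r w p ^ 4)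
    \<le> 18 * ((\<Sum>j=1..r. (w j)\<^sup>2) * (real r * (real r + 1) / 12))\<^sup>2"
proof -
  have "perm_avg r (\<lambda>p. rank_stat r w p ^ 4)
      \<le> (18 * fact r * ((\<Sum>j=1..r. (w j)\<^sup>2) * real r * (real r + 1) / 12)\<^sup>2) / fact r"
    unfolding perm_avg_def by (intro divide_right_mono sum_rank_stat_fourth assms) simp
  then show ?thesis by (simp add: mult.assoc)
qed

lemma family_avg_rank_norm2:
  assumes "finite J"
  shows "family_avg r J (rank_norm2 r J) = real (card J) * (real r * ((real r)\<^sup>2 - 1) / 12)"
  using assms
proof (induction J)
  case empty
  then show ?case by (simp add: family_avg_def rank_norm2_def rank_sum_def)
next
  case (insert i J)
  have "family_avg r (insert i J) (rank_norm2 r (insert i J))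
     = family_avg r J (\<lambda>x. perm_avg r (\<lambda>p. (rank_norm2 r J x + real r * ((real r)\<^sup>2 - 1) / 12)
         + 2 * rank_stat r (rank_sum r J x) p))"
    unfolding family_avg_insert[OF insert.hyps]
    by (intro family_avg_cong perm_avg_cong) (simp only: rank_norm2_insert[OF insert.hyps])
  also have "\<dots> = family_avg r J (\<lambda>x. rank_norm2 r J x + real r * ((real r)\<^sup>2 - 1) / 12)"
    by (simp only: perm_avg_add perm_avg_const perm_avg_cmult perm_avg_rank_stat) simp
  also have "\<dots> = real (card J) * (real r * ((real r)\<^sup>2 - 1) / 12) + real r * ((real r)\<^sup>2 - 1) / 12"
    using insert by (simp only: family_avg_add family_avg_const)
  finally show ?case
    by (simp only: card_insert_disjoint[OF insert.hyps] of_nat_Suc distrib_right mult_1_left add.commute)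
qed

text \<open>Adding a permutation expands the square: the term linear in the inner product averages
  to zero, and the squared inner product averages to \<open>v\<close> times the old squared length.
  This is a linear recursion in the number of permutations. Scaled, with \<open>d = r - 1\<close>
  and \<open>k = n\<close>, the value is \<open>d^2 + 2 d (1 - 1 / n)\<close>, close to the
  chi-square moment \<open>d^2 + 2 d\<close>.\<close>

lemma family_avg_rank_norm2_square:
  fixes r :: nat
  assumes "finite J"
  defines "v \<equiv> real r * (real r + 1) / 12"
  shows "family_avg r J (\<lambda>x. (rank_norm2 r J x)\<^sup>2)
    = v\<^sup>2 * ((real (card J))\<^sup>2 * (real r - 1)\<^sup>2 + 2 * real (card J) * (real (card J) - 1) * (real r - 1))"
  using assms(1)
proof (induction J)
  case empty
  then show ?case by (simp add: family_avg_def rank_norm2_def rank_sum_def)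
next
  case (insert i J)
  let ?e = "real r * ((real r)\<^sup>2 - 1) / 12"
  have e: "?e = v * (real r - 1)" by (simp add: v_def power2_eq_square field_simps)
  let ?k = "real (card J)"
  have "family_avg r (insert i J) (\<lambda>x. (rank_norm2 r (insert i J) x)\<^sup>2)
     = family_avg r J (\<lambda>x. perm_avg r (\<lambda>p. (rank_norm2 r J x + ?e + 2 * rank_stat r (rank_sum r J x) p)\<^sup>2))"
    unfolding family_avg_insert[OF insert.hyps]
    by (intro family_avg_cong perm_avg_cong) (simp only: rank_norm2_insert[OF insert.hyps])
  also have "\<dots> = family_avg r J (\<lambda>x. (rank_norm2 r J x)\<^sup>2 + ((2 * ?e + 4 * v) * rank_norm2 r J x + ?e\<^sup>2))"
  proof (rule family_avg_cong)
    fix x assume x: "x \<in> (\<Pi>\<^sub>E i\<in>J. perms r)"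
    let ?M = "rank_stat r (rank_sum r J x)"
    have sq: "(a + e + 2 * m)\<^sup>2 = (a + e)\<^sup>2 + (4 * (a + e) * m + 4 * m\<^sup>2)" for a e m :: real
      by (simp add: power2_eq_square algebra_simps)
    have sq': "(a + e)\<^sup>2 + 4 * (a * v) = a\<^sup>2 + ((2 * e + 4 * v) * a + e\<^sup>2)" for a e :: real
      by (simp add: power2_eq_square algebra_simps)
    have "perm_avg r (\<lambda>p. (rank_norm2 r J x + ?e + 2 * ?M p)\<^sup>2)
        = perm_avg r (\<lambda>p. (rank_norm2 r J x + ?e)\<^sup>2 + (4 * (rank_norm2 r J x + ?e) * ?M p + 4 * (?M p)\<^sup>2))"
      by (intro perm_avg_cong) (rule sq)
    also have "\<dots> = (rank_norm2 r J x + ?e)\<^sup>2 + 4 * (rank_norm2 r J x * v)"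
      unfolding perm_avg_add perm_avg_const perm_avg_cmult perm_avg_rank_stat
        perm_avg_rank_stat_square[OF rank_sum_centered[OF x]] v_def rank_norm2_def by simp
    also have "\<dots> = (rank_norm2 r J x)\<^sup>2 + ((2 * ?e + 4 * v) * rank_norm2 r J x + ?e\<^sup>2)"
      by (rule sq')
    finally show "perm_avg r (\<lambda>p. (rank_norm2 r J x + ?e + 2 * ?M p)\<^sup>2)
      = (rank_norm2 r J x)\<^sup>2 + ((2 * ?e + 4 * v) * rank_norm2 r J x + ?e\<^sup>2)" .
  qed
  also have "\<dots> = v\<^sup>2 * (?k\<^sup>2 * (real r - 1)\<^sup>2 + 2 * ?k * (?k - 1) * (real r - 1))
      + ((2 * ?e + 4 * v) * (?k * ?e) + ?e\<^sup>2)"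
    using insert by (simp only: family_avg_add family_avg_const family_avg_cmult family_avg_rank_norm2)
  also have "\<dots> = v\<^sup>2 * ((?k + 1)\<^sup>2 * (real r - 1)\<^sup>2 + 2 * (?k + 1) * ?k * (real r - 1))"
    unfolding e by (simp add: power2_eq_square algebra_simps)
  finally show ?case using insert.hyps by (simp add: add.commute)
qed

section \<open>The Stein operator applied to the statistic\<close>

lemma taylor_bound_1:
  fixes g g' g'' :: "real \<Rightarrow> real"
  assumes g: "\<And>x. 0 \<le> x \<Longrightarrow> (g has_real_derivative g' x) (at x)"
    and g': "\<And>x. 0 \<le> x \<Longrightarrow> (g' has_real_derivative g'' x) (at x)"
    and A: "\<And>x. 0 \<le> x \<Longrightarrow> \<bar>g'' x\<bar> \<le> A"
    and ab: "0 \<le> a" "0 \<le> b"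
  shows "\<bar>g b - (g a + g' a * (b - a))\<bar> \<le> A * (b - a)\<^sup>2 / 2"
proof (cases "a = b")
  case False
  define D where "D = (\<lambda>m::nat. if m = 0 then g else if m = 1 then g' else g'')"
  have "\<exists>t. (if b < a then b < t \<and> t < a else a < t \<and> t < b) \<and>
      g b = (\<Sum>m<2. D m a / fact m * (b - a) ^ m) + D 2 t / fact 2 * (b - a) ^ 2"
  proof (rule Taylor[where a = 0 and b = "max a b"])
    show "\<forall>m t. m < 2 \<and> 0 \<le> t \<and> t \<le> max a b \<longrightarrow> (D m has_real_derivative D (Suc m) t) (at t)"
      using g g' by (auto simp: D_def less_2_cases_iff)
  qed (use ab False in \<open>auto simp: D_def\<close>)
  then obtain t where "if b < a then b < t \<and> t < a else a < t \<and> t < b"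
      and "g b = (\<Sum>m<2. D m a / fact m * (b - a) ^ m) + D 2 t / fact 2 * (b - a) ^ 2"
    by blast
  then have t: "0 \<le> t" "g b = g a + g' a * (b - a) + g'' t / 2 * (b - a)\<^sup>2"
    using ab by (auto simp: D_def numeral_2_eq_2 split: if_splits)
  then have "\<bar>g b - (g a + g' a * (b - a))\<bar> = \<bar>g'' t\<bar> * ((b - a)\<^sup>2 / 2)"
    by (simp add: abs_mult)
  also have "\<dots> \<le> A * ((b - a)\<^sup>2 / 2)" by (intro mult_right_mono A t) auto
  finally show ?thesis by simp
qed simp

lemma taylor_bound_2:
  fixes g g' g'' h3 :: "real \<Rightarrow> real"
  assumes g: "\<And>x. 0 \<le> x \<Longrightarrow> (g has_real_derivative g' x) (at x)"
    and g': "\<And>x. 0 \<le> x \<Longrightarrow> (g' has_real_derivative g'' x) (at x)"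
    and g'': "\<And>x. 0 \<le> x \<Longrightarrow> (g'' has_real_derivative h3 x) (at x)"
    and A: "\<And>x. 0 \<le> x \<Longrightarrow> \<bar>h3 x\<bar> \<le> A"
    and ab: "0 \<le> a" "0 \<le> b"
  shows "\<bar>g b - (g a + g' a * (b - a) + g'' a * (b - a)\<^sup>2 / 2)\<bar> \<le> A * \<bar>b - a\<bar> ^ 3 / 6"
proof (cases "a = b")
  case False
  define D where "D = (\<lambda>m::nat. if m = 0 then g else if m = 1 then g' else if m = 2 then g'' else h3)"
  have "\<exists>t. (if b < a then b < t \<and> t < a else a < t \<and> t < b) \<and>
      g b = (\<Sum>m<3. D m a / fact m * (b - a) ^ m) + D 3 t / fact 3 * (b - a) ^ 3"
  proof (rule Taylor[where a = 0 and b = "max a b"])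
    show "\<forall>m t. m < 3 \<and> 0 \<le> t \<and> t \<le> max a b \<longrightarrow> (D m has_real_derivative D (Suc m) t) (at t)"
      using g g' g'' by (auto simp: D_def less_Suc_eq numeral_3_eq_3)
  qed (use ab False in \<open>auto simp: D_def\<close>)
  then obtain t where "if b < a then b < t \<and> t < a else a < t \<and> t < b"
      and "g b = (\<Sum>m<3. D m a / fact m * (b - a) ^ m) + D 3 t / fact 3 * (b - a) ^ 3"
    by blast
  then have t: "0 \<le> t"
      "g b = g a + g' a * (b - a) + g'' a * (b - a)\<^sup>2 / 2 + h3 t / 6 * (b - a) ^ 3"
    using ab by (auto simp: D_def eval_nat_numeral split: if_splits)
  then have "\<bar>g b - (g a + g' a * (b - a) + g'' a * (b - a)\<^sup>2 / 2)\<bar> = \<bar>h3 t\<bar> * (\<bar>b - a\<bar> ^ 3 / 6)"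
    by (simp add: abs_mult power_abs)
  also have "\<dots> \<le> A * (\<bar>b - a\<bar> ^ 3 / 6)" by (intro mult_right_mono A t) auto
  finally show ?thesis by simp
qed simp

text \<open>Control is asked on the closed half-line, since the statistic can be 0; a Stein solution
  meets this only after a shift to the left.\<close>

locale smooth_test =
  fixes g g1 g2 g3 :: "real \<Rightarrow> real" and A1 A2 A3 :: real
  assumes g: "\<And>x. 0 \<le> x \<Longrightarrow> (g has_real_derivative g1 x) (at x)"
    and g1: "\<And>x. 0 \<le> x \<Longrightarrow> (g1 has_real_derivative g2 x) (at x)"
    and g2: "\<And>x. 0 \<le> x \<Longrightarrow> (g2 has_real_derivative g3 x) (at x)"
    and A1: "\<And>x. 0 \<le> x \<Longrightarrow> \<bar>g1 x\<bar> \<le> A1"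
    and A2: "\<And>x. 0 \<le> x \<Longrightarrow> \<bar>g2 x\<bar> \<le> A2"
    and A3: "\<And>x. 0 \<le> x \<Longrightarrow> \<bar>g3 x\<bar> \<le> A3"
begin

lemma nonneg: "0 \<le> A1" "0 \<le> A2" "0 \<le> A3"
  using A1[of 0] A2[of 0] A3[of 0] by auto

text \<open>Taylor's formula at \<open>a\<close>, to second order for \<open>g\<close> and to first
  order for \<open>g1\<close>. The subtracted polynomial collects the terms whose averages are known
  exactly: odd powers of \<eta> average to zero and the coefficient of \<open>\<eta>^2\<close> will
  cancel against \<open>2 a g1 a\<close>. The term \<open>8 \<eta>^2 g2 a\<close> is small enough to
  be estimated outright.\<close>

lemma stein_operator_expansion:
  fixes a \<eta> n :: real
  assumes a: "0 \<le> a" and y: "0 \<le> a + 2 * \<eta>" and n: "0 \<le> n"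
  shows "\<bar>2 * (a + 2 * \<eta>) * g1 (a + 2 * \<eta>) - n * \<eta> * g (a + 2 * \<eta>)
      - (2 * a * g1 a - 2 * n * g1 a * \<eta>\<^sup>2 + (4 * g1 a + 4 * a * g2 a - n * g a) * \<eta> - 2 * n * g2 a * \<eta> ^ 3)\<bar>
    \<le> 8 * A2 * \<eta>\<^sup>2 + 4 * A3 * (a + 2 * \<eta>) * \<eta>\<^sup>2 + 4 / 3 * n * A3 * \<eta> ^ 4"
proof -
  let ?y = "a + 2 * \<eta>"
  define R2 where "R2 = g1 ?y - (g1 a + g2 a * (2 * \<eta>))"
  define R3 where "R3 = g ?y - (g a + g1 a * (2 * \<eta>) + g2 a * (2 * \<eta>)\<^sup>2 / 2)"
  have R2: "\<bar>R2\<bar> \<le> 2 * A3 * \<eta>\<^sup>2"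
    using taylor_bound_1[OF g1 g2 A3 a y] by (simp add: R2_def power_mult_distrib)
  have R3: "\<bar>R3\<bar> \<le> 4 / 3 * A3 * \<bar>\<eta>\<bar> ^ 3"
    using taylor_bound_2[OF g g1 g2 A3 a y] by (simp add: R3_def power_mult_distrib abs_mult)
  have "2 * ?y * g1 ?y - n * \<eta> * g ?y
      - (2 * a * g1 a - 2 * n * g1 a * \<eta>\<^sup>2 + (4 * g1 a + 4 * a * g2 a - n * g a) * \<eta> - 2 * n * g2 a * \<eta> ^ 3)
      = 8 * \<eta>\<^sup>2 * g2 a + 2 * ?y * R2 - n * \<eta> * R3"
    by (simp add: R2_def R3_def power2_eq_square power3_eq_cube algebra_simps)
  moreover have "\<bar>8 * \<eta>\<^sup>2 * g2 a\<bar> \<le> 8 * \<eta>\<^sup>2 * A2"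
    using A2[OF a] by (simp add: abs_mult mult_left_mono)
  moreover have "\<bar>2 * ?y * R2\<bar> \<le> 2 * ?y * (2 * A3 * \<eta>\<^sup>2)"
    using mult_left_mono[OF R2, of "2 * ?y"] y by (simp add: abs_mult)
  moreover have "\<bar>n * \<eta> * R3\<bar> \<le> n * \<bar>\<eta>\<bar> * (4 / 3 * A3 * \<bar>\<eta>\<bar> ^ 3)"
    using mult_left_mono[OF R3, of "n * \<bar>\<eta>\<bar>"] n by (simp add: abs_mult)
  moreover have "n * \<bar>\<eta>\<bar> * (4 / 3 * A3 * \<bar>\<eta>\<bar> ^ 3) = 4 / 3 * n * A3 * \<eta> ^ 4"
  proof -
    have "\<bar>\<eta>\<bar> * \<bar>\<eta>\<bar> ^ 3 = \<bar>\<eta>\<bar> ^ 4" by (simp add: power4_eq_xxxx power3_eq_cube)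
    also have "\<dots> = \<eta> ^ 4" by (rule power_even_abs_numeral) simp
    finally have "\<bar>\<eta>\<bar> * \<bar>\<eta>\<bar> ^ 3 = \<eta> ^ 4" .
    then show ?thesis by (simp add: mult.left_commute[of "\<bar>\<eta>\<bar>"])
  qed
  moreover have "2 * ?y * (2 * A3 * \<eta>\<^sup>2) = 4 * A3 * ?y * \<eta>\<^sup>2" "8 * \<eta>\<^sup>2 * A2 = 8 * A2 * \<eta>\<^sup>2" by simp_all
  ultimately show ?thesis by linarith
qed

lemma scale_cancel:
  fixes y n :: real
  shows "0 < y \<Longrightarrow> 12 / (y * n) * (y / 12) = 1 / n"
  by simp

text \<open>Given the other permutations, \<eta> has variance \<open>q / n\<close>, so the main
  terms \<open>2 a g1 a\<close> and \<open>2 n g1 a \<eta>^2\<close> differ on average only by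
  \<open>2 e g1 a\<close>, as \<open>a = q + e\<close>. The remainder of fourth order carries the
  factor \<open>24 = 4/3 * 18\<close> from the fourth moment.\<close>

lemma stein_one_coordinate:
  fixes n q e :: real and w :: "nat \<Rightarrow> real"
  assumes n: "0 < n" and r: "1 \<le> r"
    and centered: "(\<Sum>j=1..r. w j) = 0"
    and c: "c = 12 / (real r * (real r + 1) * n)"
    and q: "q = c * (\<Sum>j=1..r. (w j)\<^sup>2)" and e: "0 \<le> e"
    and nonneg_F: "\<And>p. p \<in> perms r \<Longrightarrow> 0 \<le> q + e + 2 * (c * rank_stat r w p)"
  shows "\<bar>perm_avg r (\<lambda>p. 2 * (q + e + 2 * (c * rank_stat r w p)) * g1 (q + e + 2 * (c * rank_stat r w p))
        - n * (c * rank_stat r w p) * g (q + e + 2 * (c * rank_stat r w p)))\<bar>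
    \<le> 2 * A1 * e + 8 * A2 * (q / n) + 4 * A3 * ((q + e) * q / n) + 24 * A3 * (q\<^sup>2 / n)"
proof -
  define \<eta> where "\<eta> = (\<lambda>p. c * rank_stat r w p)"
  define a where "a = q + e"
  have c0: "0 < c" using c n r by simp
  have q0: "0 \<le> q" unfolding q using c0 by (intro mult_nonneg_nonneg sum_nonneg) auto
  have a0: "0 \<le> a" using q0 e by (simp add: a_def)
  have cv: "c * (real r * (real r + 1) / 12) = 1 / n"
    unfolding c using r by (intro scale_cancel) simp
  have \<eta>1: "perm_avg r \<eta> = 0"
    by (simp only: \<eta>_def perm_avg_cmult perm_avg_rank_stat mult_zero_right)
  have \<eta>3: "perm_avg r (\<lambda>p. \<eta> p ^ 3) = 0"
    by (simp only: \<eta>_def power_mult_distrib perm_avg_cmult perm_avg_rank_stat_cube mult_zero_right)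
  have \<eta>2: "perm_avg r (\<lambda>p. (\<eta> p)\<^sup>2) = q / n"
  proof -
    have "perm_avg r (\<lambda>p. (\<eta> p)\<^sup>2) = (c * (\<Sum>j=1..r. (w j)\<^sup>2)) * (c * (real r * (real r + 1) / 12))"
      unfolding \<eta>_def power_mult_distrib perm_avg_cmult perm_avg_rank_stat_square[OF centered]
      by (simp add: power2_eq_square)
    then show ?thesis unfolding cv q[symmetric] by simp
  qed
  have \<eta>4: "perm_avg r (\<lambda>p. \<eta> p ^ 4) \<le> 18 * (q / n)\<^sup>2"
  proof -
    have "perm_avg r (\<lambda>p. \<eta> p ^ 4)
        \<le> c ^ 4 * (18 * ((\<Sum>j=1..r. (w j)\<^sup>2) * (real r * (real r + 1) / 12))\<^sup>2)"
      unfolding \<eta>_def power_mult_distrib[of c] perm_avg_cmult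
      by (intro mult_left_mono perm_avg_rank_stat_fourth centered) auto
    also have "\<dots> = 18 * ((c * (\<Sum>j=1..r. (w j)\<^sup>2)) * (c * (real r * (real r + 1) / 12)))\<^sup>2"
      by (simp add: power_mult_distrib power4_eq_xxxx power2_eq_square)
    finally show ?thesis unfolding cv q[symmetric] by simp
  qed
  let ?T = "\<lambda>p. 2 * (a + 2 * \<eta> p) * g1 (a + 2 * \<eta> p) - n * \<eta> p * g (a + 2 * \<eta> p)"
  let ?L = "\<lambda>p. 2 * a * g1 a - 2 * n * g1 a * (\<eta> p)\<^sup>2 + (4 * g1 a + 4 * a * g2 a - n * g a) * \<eta> p - 2 * n * g2 a * \<eta> p ^ 3"
  \<comment> \<open>\<open>(a + 2 \<eta>) \<eta>^2\<close> is split so that its cubic part can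
    average to zero.\<close>
  let ?E = "\<lambda>p. 8 * A2 * (\<eta> p)\<^sup>2 + 4 * A3 * (a * (\<eta> p)\<^sup>2 + 2 * \<eta> p ^ 3) + 4 / 3 * n * A3 * \<eta> p ^ 4"
  have L: "perm_avg r ?L = 2 * e * g1 a"
  proof -
    have "perm_avg r ?L = 2 * a * g1 a - 2 * n * g1 a * (q / n)"
      unfolding perm_avg_add perm_avg_diff perm_avg_const perm_avg_cmult \<eta>1 \<eta>2 \<eta>3 by simp
    then show ?thesis using n by (simp add: a_def algebra_simps)
  qed
  have "\<bar>perm_avg r ?T - perm_avg r ?L\<bar> \<le> perm_avg r (\<lambda>p. \<bar>?T p - ?L p\<bar>)"
    unfolding perm_avg_diff[symmetric] by (rule perm_avg_abs_le)
  also have "\<dots> \<le> perm_avg r ?E"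
  proof (rule perm_avg_mono)
    fix p assume p: "p \<in> perms r"
    have "0 \<le> a + 2 * \<eta> p" using nonneg_F[OF p] by (simp add: a_def \<eta>_def)
    then have "\<bar>?T p - ?L p\<bar> \<le> 8 * A2 * (\<eta> p)\<^sup>2 + 4 * A3 * (a + 2 * \<eta> p) * (\<eta> p)\<^sup>2 + 4 / 3 * n * A3 * \<eta> p ^ 4"
      using n by (intro stein_operator_expansion a0) auto
    also have "\<dots> = ?E p" by (simp add: power2_eq_square power3_eq_cube algebra_simps)
    finally show "\<bar>?T p - ?L p\<bar> \<le> ?E p" .
  qed
  also have "\<dots> = 8 * A2 * (q / n) + 4 * A3 * (a * (q / n)) + 4 / 3 * n * A3 * perm_avg r (\<lambda>p. \<eta> p ^ 4)"
    unfolding perm_avg_add perm_avg_cmult \<eta>2 \<eta>3 by simp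
  also have "\<dots> \<le> 8 * A2 * (q / n) + 4 * A3 * (a * (q / n)) + 4 / 3 * n * A3 * (18 * (q / n)\<^sup>2)"
    using n nonneg by (intro add_left_mono mult_left_mono \<eta>4) auto
  also have "\<dots> = 8 * A2 * (q / n) + 4 * A3 * ((q + e) * q / n) + 24 * A3 * (q\<^sup>2 / n)"
    using n by (simp add: a_def power2_eq_square)
  finally have "\<bar>perm_avg r ?T - 2 * e * g1 a\<bar> \<le> 8 * A2 * (q / n) + 4 * A3 * ((q + e) * q / n) + 24 * A3 * (q\<^sup>2 / n)"
    unfolding L .
  moreover have "\<bar>2 * e * g1 a\<bar> \<le> 2 * A1 * e"
    using mult_left_mono[OF A1[OF a0] e] e by (simp add: abs_mult mult.commute)
  ultimately have "\<bar>perm_avg r ?T\<bar> \<le> 2 * A1 * e + 8 * A2 * (q / n) + 4 * A3 * ((q + e) * q / n) + 24 * A3 * (q\<^sup>2 / n)"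
    by linarith
  then show ?thesis by (simp add: \<eta>_def a_def)
qed

text \<open>Each inner product with the other rank vectors is the inner product with the full sum
  minus a deterministic squared length. After scaling, the \<eta>'s add up to
  \<open>F - d\<close>.\<close>

lemma sum_rank_stat_leave_one_out:
  assumes I: "finite I" and x: "x \<in> (\<Pi>\<^sub>E i\<in>I. perms r)"
  shows "(\<Sum>i\<in>I. rank_stat r (rank_sum r (I - {i}) x) (x i))
    = rank_norm2 r I x - real (card I) * (real r * ((real r)\<^sup>2 - 1) / 12)"
proof -
  have xi: "x i \<in> perms r" if "i \<in> I" for i using x that by auto
  have one: "rank_stat r (rank_sum r (I - {i}) x) (x i)
      = (\<Sum>j=1..r. rank_sum r I x j * friedman_rho r (x i) j) - real r * ((real r)\<^sup>2 - 1) / 12" if "i \<in> I" for i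
  proof -
    have "rank_sum r (I - {i}) x j = rank_sum r I x j - friedman_rho r (x i) j" for j
      using I that by (simp add: rank_sum_def sum_diff1)
    then have "rank_stat r (rank_sum r (I - {i}) x) (x i)
        = (\<Sum>j=1..r. (rank_sum r I x j - friedman_rho r (x i) j) * friedman_rho r (x i) j)"
      by (simp only: rank_stat_def)
    then show ?thesis
      unfolding sum_friedman_rho_square[OF xi[OF that], symmetric]
      by (simp only: left_diff_distrib sum_subtractf power2_eq_square)
  qed
  have "(\<Sum>i\<in>I. rank_stat r (rank_sum r (I - {i}) x) (x i))
      = (\<Sum>i\<in>I. (\<Sum>j=1..r. rank_sum r I x j * friedman_rho r (x i) j) - real r * ((real r)\<^sup>2 - 1) / 12)"
    by (intro sum.cong refl one)
  also have "\<dots> = (\<Sum>i\<in>I. \<Sum>j=1..r. rank_sum r I x j * friedman_rho r (x i) j) - real (card I) * (real r * ((real r)\<^sup>2 - 1) / 12)"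
    by (simp only: sum_subtractf sum_constant)
  also have "(\<Sum>i\<in>I. \<Sum>j=1..r. rank_sum r I x j * friedman_rho r (x i) j) = rank_norm2 r I x"
    by (subst sum.swap) (simp add: rank_norm2_def power2_eq_square rank_sum_def sum_distrib_left)
  finally show ?thesis .
qed

text \<open>Since \<open>F - d\<close> is the sum of the \<eta>'s, the Stein operator is the mean of
  \<open>n\<close> terms, each of which involves a single \<eta> and falls under
  \<open>stein_one_coordinate\<close>. What is left are the first two moments of \<open>q\<close>;
  they are at most \<open>d\<close> and \<open>d^2 + 2 d\<close>, and \<open>28 = 4 + 24\<close>
  joins the two contributions of \<open>A3\<close>.\<close>

lemma family_avg_stein_operator:
  fixes n r :: nat
  assumes n: "1 \<le> n" and r: "1 \<le> r"
  defines "d \<equiv> real r - 1"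
  shows "\<bar>family_avg r {1..n} (\<lambda>x. 2 * friedman_F n r x * g1 (friedman_F n r x)
        + (d - friedman_F n r x) * g (friedman_F n r x))\<bar>
    \<le> (2 * d * A1 + 8 * d * A2 + 28 * (d\<^sup>2 + 2 * d) * A3) / real n"
proof -
  \<comment> \<open>The squared normalisation: it turns the squared rank length into
    \<open>F\<close> and the variance factor \<open>r (r + 1) / 12\<close> into
    \<open>1 / n\<close>.\<close>
  define c where "c = 12 / (real r * (real r + 1) * real n)"
  let ?I = "{1..n}"
  let ?F = "\<lambda>x. c * rank_norm2 r ?I x"
  let ?\<eta> = "\<lambda>i x. c * rank_stat r (rank_sum r (?I - {i}) x) (x i)"
  let ?T = "\<lambda>i x. 2 * ?F x * g1 (?F x) - real n * ?\<eta> i x * g (?F x)"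
  let ?B = "2 * d * A1 + 8 * d * A2 + 28 * (d\<^sup>2 + 2 * d) * A3"
  have c0: "0 < c" using n r by (simp add: c_def)
  have d0: "0 \<le> d" using r by (simp add: d_def)
  have cv: "c * (real r * (real r + 1) / 12) = 1 / real n"
    unfolding c_def using r by (intro scale_cancel) simp
  have "c * (real r * ((real r)\<^sup>2 - 1) / 12) = c * (real r * (real r + 1) / 12) * d"
    by (simp add: d_def power2_eq_square algebra_simps)
  then have ce: "c * (real r * ((real r)\<^sup>2 - 1) / 12) = d / real n"
    unfolding cv by simp
  have op: "2 * ?F x * g1 (?F x) + (d - ?F x) * g (?F x) = 1 / real n * (\<Sum>i\<in>?I. ?T i x)"
    if x: "x \<in> (\<Pi>\<^sub>E i\<in>?I. perms r)" for x
  proof -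
    have "(\<Sum>i\<in>?I. ?\<eta> i x) = c * (rank_norm2 r ?I x - real n * (real r * ((real r)\<^sup>2 - 1) / 12))"
      using sum_rank_stat_leave_one_out[OF _ x] by (simp add: sum_distrib_left[symmetric])
    also have "\<dots> = ?F x - real n * (c * (real r * ((real r)\<^sup>2 - 1) / 12))"
      by (simp only: right_diff_distrib mult.left_commute)
    also have "\<dots> = ?F x - d" unfolding ce using n by simp
    finally have "(\<Sum>i\<in>?I. ?\<eta> i x) = ?F x - d" .
    moreover have "(\<Sum>i\<in>?I. ?T i x) = real n * (2 * ?F x * g1 (?F x)) - real n * g (?F x) * (\<Sum>i\<in>?I. ?\<eta> i x)"
      by (simp add: sum_subtractf sum_distrib_left mult_ac)
    moreover have "a + (d - f) * g' = 1 / real n * t" if "s = f - d" "t = real n * a - real n * g' * s" for a f g' s t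
      unfolding that(2) that(1) using n by (simp add: field_simps)
    ultimately show ?thesis by blast
  qed
  have one: "\<bar>family_avg r ?I (?T i)\<bar> \<le> ?B / real n" if i: "i \<in> ?I" for i
  proof -
    let ?J = "?I - {i}"
    let ?q = "\<lambda>x. c * rank_norm2 r ?J x"
    have ins: "insert i ?J = ?I" "finite ?J" "i \<notin> ?J" using i by auto
    have card: "card ?J = n - 1" using i by simp
    let ?G = "\<lambda>x. perm_avg r (\<lambda>p. ?T i (x(i := p)))"
    have m1: "c * family_avg r ?J (rank_norm2 r ?J) = real (n - 1) * (d / n)"
      unfolding family_avg_rank_norm2[OF ins(2)] card ce[symmetric] by simp
    have "c\<^sup>2 * family_avg r ?J (\<lambda>x. (rank_norm2 r ?J x)\<^sup>2)
        = (c * (real r * (real r + 1) / 12))\<^sup>2 * ((real (n - 1))\<^sup>2 * d\<^sup>2 + 2 * real (n - 1) * (real (n - 1) - 1) * d)"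
      unfolding family_avg_rank_norm2_square[OF ins(2)] card d_def power_mult_distrib[of c] by simp
    then have m2: "c\<^sup>2 * family_avg r ?J (\<lambda>x. (rank_norm2 r ?J x)\<^sup>2)
        = (1 / n)\<^sup>2 * ((real (n - 1))\<^sup>2 * d\<^sup>2 + 2 * real (n - 1) * (real (n - 1) - 1) * d)"
      unfolding cv .
    have split: "family_avg r ?I (?T i) = family_avg r ?J ?G"
      using family_avg_insert[OF ins(2,3), of r "?T i"] unfolding ins(1) .
    have "\<bar>family_avg r ?I (?T i)\<bar> \<le> family_avg r ?J (\<lambda>x. \<bar>?G x\<bar>)"
      unfolding split by (rule family_avg_abs_le)
    also have "\<dots> \<le> family_avg r ?J (\<lambda>x. 2 * A1 * (d / n) + 8 * A2 * (?q x / n)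
        + 4 * A3 * ((?q x + d / n) * ?q x / n) + 24 * A3 * ((?q x)\<^sup>2 / n))"
    proof (rule family_avg_mono)
      fix x assume x: "x \<in> (\<Pi>\<^sub>E i\<in>?J. perms r)"
      let ?w = "rank_sum r ?J x"
      have F: "?F (x(i := p)) = ?q x + d / n + 2 * (c * rank_stat r ?w p)" if "p \<in> perms r" for p
      proof -
        have "?F (x(i := p)) = c * rank_norm2 r ?J x + c * (real r * ((real r)\<^sup>2 - 1) / 12) + 2 * (c * rank_stat r ?w p)"
          using rank_norm2_insert[OF ins(2,3) that, of x] unfolding ins(1) by (simp add: distrib_left)
        then show ?thesis unfolding ce .
      qed
      have \<eta>: "?\<eta> i (x(i := p)) = c * rank_stat r ?w p" for p
      proof -
        have "rank_sum r ?J (x(i := p)) = ?w" by (auto simp: rank_sum_def fun_eq_iff intro!: sum.cong)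
        then show ?thesis by simp
      qed
      have G: "?G x = perm_avg r (\<lambda>p. 2 * (?q x + d / n + 2 * (c * rank_stat r ?w p)) * g1 (?q x + d / n + 2 * (c * rank_stat r ?w p))
        - n * (c * rank_stat r ?w p) * g (?q x + d / n + 2 * (c * rank_stat r ?w p)))"
        by (intro perm_avg_cong) (simp only: F \<eta>)
      show "\<bar>?G x\<bar> \<le> 2 * A1 * (d / n) + 8 * A2 * (?q x / n)
        + 4 * A3 * ((?q x + d / n) * ?q x / n) + 24 * A3 * ((?q x)\<^sup>2 / n)"
        unfolding G
      proof (rule stein_one_coordinate)
        show "0 \<le> ?q x + d / n + 2 * (c * rank_stat r ?w p)" if "p \<in> perms r" for p
          unfolding F[OF that, symmetric] using c0 rank_norm2_nonneg[of r ?I] by simp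
      qed (use n r d0 rank_sum_centered[OF x] in \<open>auto simp: c_def rank_norm2_def\<close>)
    qed
    also have "\<dots> = family_avg r ?J (\<lambda>x. 2 * A1 * (d / n) + ((8 * A2 * c / n + 4 * A3 * (d / n) * c / n) * rank_norm2 r ?J x
        + 28 * A3 * c\<^sup>2 / n * (rank_norm2 r ?J x)\<^sup>2))"
      using n by (intro family_avg_cong) (simp add: field_simps power2_eq_square)
    also have "\<dots> = 2 * A1 * (d / n) + ((8 * A2 / n + 4 * A3 * (d / n) / n) * (c * family_avg r ?J (rank_norm2 r ?J))
        + 28 * A3 / n * (c\<^sup>2 * family_avg r ?J (\<lambda>x. (rank_norm2 r ?J x)\<^sup>2)))"
      unfolding family_avg_add family_avg_cmult family_avg_const[OF ins(2)] by (simp add: field_simps)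
    also have "\<dots> = 2 * A1 * (d / n) + ((8 * A2 / n + 4 * A3 * (d / n) / n) * (real (n - 1) * (d / n))
        + 28 * A3 / n * ((1 / n)\<^sup>2 * ((real (n - 1))\<^sup>2 * d\<^sup>2 + 2 * real (n - 1) * (real (n - 1) - 1) * d)))"
      unfolding m1 m2 ..
    also have "\<dots>
        \<le> ?B / n"
    proof -
      \<comment> \<open>In terms of \<open>k = n - 1 \<ge> 0\<close> the difference of the two sides
        is a quotient of polynomials with nonnegative coefficients.\<close>
      define k where "k = real n - 1"
      have k: "real (n - 1) = k" "real n = k + 1" "0 \<le> k" using n by (auto simp: k_def of_nat_diff)
      have e1: "?B / n - (2 * A1 * (d / n) + ((8 * A2 / n + 4 * A3 * (d / n) / n) * (k * (d / n))
        + 28 * A3 / n * ((1 / n)\<^sup>2 * (k\<^sup>2 * d\<^sup>2 + 2 * k * (k - 1) * d))))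
        = (d * A2 * (8 * k + 8) + d * d * A3 * (52 * k + 28) + d * A3 * (168 * k + 56)) / (k + 1) ^ 3"
        unfolding k(2) using k(3) by (simp add: divide_simps) (simp add: power2_eq_square power3_eq_cube algebra_simps)
      moreover have "0 \<le> (d * A2 * (8 * k + 8) + d * d * A3 * (52 * k + 28) + d * A3 * (168 * k + 56)) / (k + 1) ^ 3"
        using d0 nonneg k(3) by simp
      ultimately show ?thesis unfolding k(1) by (metis diff_ge_0_iff_ge)
    qed
    finally show ?thesis by simp
  qed
  have "family_avg r ?I (\<lambda>x. 2 * ?F x * g1 (?F x) + (d - ?F x) * g (?F x))
      = family_avg r ?I (\<lambda>x. 1 / real n * (\<Sum>i\<in>?I. ?T i x))"
    by (rule family_avg_cong) (rule op)
  then have split: "family_avg r ?I (\<lambda>x. 2 * ?F x * g1 (?F x) + (d - ?F x) * g (?F x))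
      = 1 / real n * (\<Sum>i\<in>?I. family_avg r ?I (?T i))"
    by (simp only: family_avg_cmult family_avg_sum)
  have "\<bar>\<Sum>i\<in>?I. family_avg r ?I (?T i)\<bar> \<le> (\<Sum>i\<in>?I. ?B / real n)"
    by (intro order_trans[OF sum_abs] sum_mono one)
  then have "1 / real n * \<bar>\<Sum>i\<in>?I. family_avg r ?I (?T i)\<bar> \<le> 1 / real n * (\<Sum>i\<in>?I. ?B / real n)"
    by (intro mult_left_mono) auto
  moreover have "\<bar>family_avg r ?I (\<lambda>x. 2 * ?F x * g1 (?F x) + (d - ?F x) * g (?F x))\<bar>
      = 1 / real n * \<bar>\<Sum>i\<in>?I. family_avg r ?I (?T i)\<bar>"
    unfolding split abs_mult by simp
  moreover have "1 / real n * (\<Sum>i\<in>?I. ?B / real n) = ?B / real n"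
    using n by simp
  ultimately show ?thesis by (simp only: friedman_F_eq_rank_norm2 c_def)
qed


end

section \<open>From smooth test functions to distribution functions\<close>

lemma friedman_smooth_bound:
  fixes n r :: nat and h h1 h2 h3 :: "real \<Rightarrow> real"
  assumes n: "1 \<le> n" and r: "3 \<le> r"
    and h: "\<And>x. (h has_real_derivative h1 x) (at x)"
    and h1: "\<And>x. (h1 has_real_derivative h2 x) (at x)"
    and h2: "\<And>x. (h2 has_real_derivative h3 x) (at x)"
    and h01: "\<And>x. 0 \<le> h x" "\<And>x. h x \<le> 1"
    and B1: "\<And>x. \<bar>h1 x\<bar> \<le> B1" and B2: "\<And>x. \<bar>h2 x\<bar> \<le> B2" and B3: "\<And>x. \<bar>h3 x\<bar> \<le> B3"
  defines "d \<equiv> real r - 1"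
  defines "C \<equiv> 2 / sqrt d"
  defines "A1 \<equiv> C * (B1 + C)"
  defines "A2 \<equiv> C * (B2 + 2 * A1)"
  defines "A3 \<equiv> C * (B3 + 3 * A2)"
  shows "\<bar>family_avg r {1..n} (\<lambda>x. h (friedman_F n r x))
      - integral\<^sup>L (chi_square (r - 1)) h\<bar>
    \<le> (2 * d * A1 + 8 * d * A2 + 28 * (d\<^sup>2 + 2 * d) * A3) / real n"
proof -
  let ?F = "friedman_F n r"
  let ?B = "(2 * d * A1 + 8 * d * A2 + 28 * (d\<^sup>2 + 2 * d) * A3) / real n"
  define a where "a = integral\<^sup>L (chi_square (r - 1)) h"
  interpret chi: prob_space "chi_square (r - 1)" by (rule prob_space_chi_square)
  have d: "real (r - 1) = d" "2 \<le> d" using r by (auto simp: d_def of_nat_diff)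
  have hm: "h \<in> borel_measurable borel"
    by (intro borel_measurable_continuous_onI) (meson h DERIV_continuous_on has_field_derivative_at_within)
  have hb: "\<bar>h x\<bar> \<le> 1" for x using h01[of x] by simp
  have inth: "integrable (chi_square (r - 1)) h"
    by (rule chi.integrable_const_bound[where f = h and B = 1])
       (simp_all only: measurable_cong_sets[OF sets_chi_square refl] hm hb real_norm_def AE_I2)
  have a01: "0 \<le> a" "a \<le> 1"
    unfolding a_def using chi.integral_le_const[OF inth, of 1] chi.integral_ge_const[OF inth, of 0] h01 by auto
  have B0: "\<bar>h x - a\<bar> \<le> 1" for x using h01[of x] a01 by (simp add: abs_le_iff)
  have r2: "2 \<le> r - 1" using r by simp
  obtain f f1 where f: "\<And>x. 0 < x \<Longrightarrow> (f has_real_derivative f1 x) (at x)"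
      and ode: "\<And>x. 0 < x \<Longrightarrow> 2 * x * f1 x + (d - x) * f x = h x - a"
      and lim: "((\<lambda>x. gamma_weight d x * f x) \<longlongrightarrow> 0) (at_right 0)"
        "((\<lambda>x. gamma_weight d x * f x) \<longlongrightarrow> 0) at_top"
    using stein_solution_exists[OF r2 h hb a_def] unfolding d(1) by blast
  obtain f2 f3 where f1: "\<And>x. 0 < x \<Longrightarrow> (f1 has_real_derivative f2 x) (at x)"
      and f2: "\<And>x. 0 < x \<Longrightarrow> (f2 has_real_derivative f3 x) (at x)"
      and b: "\<And>x. 0 < x \<Longrightarrow> \<bar>f x\<bar> \<le> C" "\<And>x. 0 < x \<Longrightarrow> \<bar>f1 x\<bar> \<le> A1"
        "\<And>x. 0 < x \<Longrightarrow> \<bar>f2 x\<bar> \<le> A2" "\<And>x. 0 < x \<Longrightarrow> \<bar>f3 x\<bar> \<le> A3"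
    using stein_solution_derivative_bounds[OF d(2) f ode lim h h1 h2 B0 B1 B2 B3 C_def[THEN meta_eq_to_obj_eq]]
    unfolding A3_def A2_def A1_def by blast
  have nonneg: "0 \<le> C" "0 \<le> A1" "0 \<le> B1" using b(1)[of 1] b(2)[of 1] B1[of 0] by auto
  have F0: "0 \<le> ?F x" for x by (rule friedman_F_nonneg)
  \<comment> \<open>The solution \<open>f\<close> is controlled only for positive arguments, while
    the statistic may be 0. The operator is applied to \<open>f (x + s)\<close> instead, at a cost
    proportional to \<open>s\<close>, which is removed by letting \<open>s\<close> tend to
    0.\<close>
  have step: "\<bar>family_avg r {1..n} (\<lambda>x. h (?F x)) - a\<bar> \<le> ?B + s * (2 * A1 + C + B1)" if s: "0 < s" for s
  proof -
    let ?g = "\<lambda>x. f (x + s)" and ?g1 = "\<lambda>x. f1 (x + s)"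
    interpret smooth_test ?g ?g1 "\<lambda>x. f2 (x + s)" "\<lambda>x. f3 (x + s)" A1 A2 A3
    proof
      fix x :: real assume "0 \<le> x"
      then have x: "0 < x + s" using s by simp
      show "(?g has_real_derivative f1 (x + s)) (at x)"
        using f[OF x] by (simp add: DERIV_shift)
      show "(?g1 has_real_derivative f2 (x + s)) (at x)"
        using f1[OF x] by (simp add: DERIV_shift)
      show "((\<lambda>x. f2 (x + s)) has_real_derivative f3 (x + s)) (at x)"
        using f2[OF x] by (simp add: DERIV_shift)
    qed (use s b in auto)
    let ?T = "\<lambda>x. 2 * ?F x * ?g1 (?F x) + (d - ?F x) * ?g (?F x)"
    have T: "\<bar>family_avg r {1..n} ?T\<bar> \<le> ?B"
      unfolding d_def using n r by (intro family_avg_stein_operator) auto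
    have pt: "\<bar>(h (?F x) - a) - ?T x\<bar> \<le> s * (2 * A1 + C + B1)" for x
    proof -
      define y where "y = ?F x"
      have y: "0 \<le> y" "0 < y + s" using F0[of x] s by (auto simp: y_def)
      have "\<bar>h (y + s) - h y\<bar> \<le> B1 * s"
      proof -
        obtain t where "h (y + s) - h y = (y + s - y) * h1 t"
          using MVT2[of y "y + s" h h1] h s by auto
        then show ?thesis using B1[of t] s by (simp add: abs_mult mult.commute mult_right_mono)
      qed
      moreover have "h (y + s) - a = (2 * y * f1 (y + s) + (d - y) * f (y + s)) + s * (2 * f1 (y + s) - f (y + s))"
        unfolding ode[OF y(2), symmetric] by (simp add: algebra_simps)
      moreover have "\<bar>s * (2 * f1 (y + s) - f (y + s))\<bar> \<le> s * (2 * A1 + C)"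
        using b(1)[OF y(2)] b(2)[OF y(2)] s by (simp add: abs_mult)
      ultimately show ?thesis unfolding y_def[symmetric] by (simp add: algebra_simps abs_le_iff)
    qed
    have "\<bar>family_avg r {1..n} (\<lambda>x. (h (?F x) - a) - ?T x)\<bar> \<le> family_avg r {1..n} (\<lambda>x. s * (2 * A1 + C + B1))"
      by (intro order_trans[OF family_avg_abs_le] family_avg_mono pt)
    then have "\<bar>family_avg r {1..n} (\<lambda>x. h (?F x)) - a - family_avg r {1..n} ?T\<bar> \<le> s * (2 * A1 + C + B1)"
      by (simp only: family_avg_diff family_avg_const finite_atLeastAtMost)
    then show ?thesis using T by linarith
  qed
  show ?thesis
    unfolding a_def[symmetric]
  proof (rule field_le_epsilon)
    fix e :: real assume e: "0 < e"
    have K: "0 < 2 * A1 + C + B1 + 1" using nonneg by simp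
    have "e / (2 * A1 + C + B1 + 1) * (2 * A1 + C + B1) \<le> e"
      using K e by (simp add: field_simps)
    then show "\<bar>family_avg r {1..n} (\<lambda>x. h (?F x)) - a\<bar> \<le> ?B + e"
      using step[of "e / (2 * A1 + C + B1 + 1)"] K e by simp
  qed
qed

text \<open>The indicator lies between the smooth steps that descend on
  \<open>[z - \<alpha>, z]\<close> and on \<open>[z, z + \<alpha>]\<close>. Either replacement costs
  the chi-square mass of one window, at most \<open>L * \<alpha>\<close>.\<close>

lemma friedman_cdf_bound:
  fixes n r :: nat and \<alpha> z L :: real
  assumes n: "1 \<le> n" and r: "3 \<le> r" and \<alpha>: "0 < \<alpha>"
    and L: "\<And>x. chi_density (real (r - 1) / 2) x \<le> L"
  defines "d \<equiv> real r - 1"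
  defines "C \<equiv> 2 / sqrt d"
  defines "A1 \<equiv> C * (2.2 / \<alpha> + C)"
  defines "A2 \<equiv> C * (8 / \<alpha> ^ 2 + 2 * A1)"
  defines "A3 \<equiv> C * (53 / \<alpha> ^ 3 + 3 * A2)"
  shows "\<bar>family_avg r {1..n} (\<lambda>x. if friedman_F n r x \<le> z then 1 else 0)
      - measure (chi_square (r - 1)) {..z}\<bar>
    \<le> L * \<alpha> + (2 * d * A1 + 8 * d * A2 + 28 * (d\<^sup>2 + 2 * d) * A3) / real n"
proof -
  let ?F = "friedman_F n r"
  let ?B = "(2 * d * A1 + 8 * d * A2 + 28 * (d\<^sup>2 + 2 * d) * A3) / real n"
  let ?P = "family_avg r {1..n} (\<lambda>x. if ?F x \<le> z then 1 else 0)"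
  let ?\<chi> = "chi_square (r - 1)"
  interpret chi: prob_space "?\<chi>" by (rule prob_space_chi_square)
  have smooth: "\<exists>h. \<bar>family_avg r {1..n} (\<lambda>x. h (?F x)) - integral\<^sup>L ?\<chi> h\<bar> \<le> ?B \<and> integrable ?\<chi> h
      \<and> (\<forall>x. 0 \<le> h x \<and> h x \<le> 1) \<and> (\<forall>x\<le>u. h x = 1) \<and> (\<forall>x\<ge>u + \<alpha>. h x = 0)" for u
  proof -
    obtain h h1 h2 h3 :: "real \<Rightarrow> real" where h: "\<And>x. (h has_real_derivative h1 x) (at x)"
      "\<And>x. (h1 has_real_derivative h2 x) (at x)"
      "\<And>x. (h2 has_real_derivative h3 x) (at x)"
      and h01: "\<And>x. 0 \<le> h x" "\<And>x. h x \<le> 1"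
      and step: "\<And>x. x \<le> u \<Longrightarrow> h x = 1" "\<And>x. u + \<alpha> \<le> x \<Longrightarrow> h x = 0"
      and hb: "\<And>x. \<bar>h1 x\<bar> \<le> 2.2 / \<alpha>" "\<And>x. \<bar>h2 x\<bar> \<le> 8 / \<alpha> ^ 2" "\<And>x. \<bar>h3 x\<bar> \<le> 53 / \<alpha> ^ 3"
      using smooth_step[OF \<alpha>, of u] by metis
    have "h \<in> borel_measurable borel"
      by (intro borel_measurable_continuous_onI) (meson h(1) DERIV_continuous_on has_field_derivative_at_within)
    moreover have "\<bar>h x\<bar> \<le> 1" for x using h01[of x] by simp
    ultimately have "integrable ?\<chi> h"
      by (intro chi.integrable_const_bound[where f = h and B = 1])
         (simp_all only: measurable_cong_sets[OF sets_chi_square refl] real_norm_def AE_I2)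
    moreover have "\<bar>family_avg r {1..n} (\<lambda>x. h (?F x)) - integral\<^sup>L ?\<chi> h\<bar> \<le> ?B"
      using friedman_smooth_bound[OF n r h h01 hb]
      unfolding d_def C_def A1_def A2_def A3_def .
    ultimately show ?thesis using h01 step by blast
  qed
  have r1: "0 < r - 1" using r by simp
  have ind: "integrable ?\<chi> (indicator {..u} :: real \<Rightarrow> real)" "integral\<^sup>L ?\<chi> (indicator {..u}) = measure ?\<chi> {..u}" for u
  proof -
    have "emeasure ?\<chi> {..u} < \<infinity>"
      unfolding chi.emeasure_eq_measure infinity_ennreal_def by (rule ennreal_less_top)
    then show "integrable ?\<chi> (indicator {..u} :: real \<Rightarrow> real)"
      by (intro integrable_real_indicator) auto
  qed simp
  have "?P \<le> measure ?\<chi> {..z} + L * \<alpha> + ?B"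
  proof -
    obtain h where h: "\<bar>family_avg r {1..n} (\<lambda>x. h (?F x)) - integral\<^sup>L ?\<chi> h\<bar> \<le> ?B" "integrable ?\<chi> h"
      "\<And>x. 0 \<le> h x \<and> h x \<le> 1" "\<And>x. x \<le> z \<Longrightarrow> h x = 1" "\<And>x. z + \<alpha> \<le> x \<Longrightarrow> h x = 0"
      using smooth[of z] by blast
    have "?P \<le> family_avg r {1..n} (\<lambda>x. h (?F x))"
      using h(3,4) by (intro family_avg_mono) auto
    moreover have "integral\<^sup>L ?\<chi> h \<le> integral\<^sup>L ?\<chi> (indicator {..z + \<alpha>})"
      using h(2,3,5) ind by (intro integral_mono) (auto simp: indicator_def not_le less_imp_le)
    moreover have "measure ?\<chi> {..z + \<alpha>} \<le> measure ?\<chi> {..z} + L * (z + \<alpha> - z)"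
      using \<alpha> by (intro chi_square_window[OF r1 L]) auto
    ultimately show ?thesis using h(1) unfolding ind by (simp add: abs_le_iff)
  qed
  moreover have "measure ?\<chi> {..z} \<le> ?P + L * \<alpha> + ?B"
  proof -
    obtain h where h: "\<bar>family_avg r {1..n} (\<lambda>x. h (?F x)) - integral\<^sup>L ?\<chi> h\<bar> \<le> ?B" "integrable ?\<chi> h"
      "\<And>x. 0 \<le> h x \<and> h x \<le> 1" "\<And>x. x \<le> z - \<alpha> \<Longrightarrow> h x = 1" "\<And>x. z \<le> x \<Longrightarrow> h x = 0"
      using smooth[of "z - \<alpha>"] by auto
    have "family_avg r {1..n} (\<lambda>x. h (?F x)) \<le> ?P"
      using h(3,5) by (intro family_avg_mono) (auto simp: not_le less_imp_le)
    moreover have "integral\<^sup>L ?\<chi> (indicator {..z - \<alpha>}) \<le> integral\<^sup>L ?\<chi> h"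
      using h(2,3,4) ind by (intro integral_mono) (auto simp: indicator_def)
    moreover have "measure ?\<chi> {..z} \<le> measure ?\<chi> {..z - \<alpha>} + L * (z - (z - \<alpha>))"
      using \<alpha> by (intro chi_square_window[OF r1 L]) auto
    ultimately show ?thesis using h(1) unfolding ind by (simp add: abs_le_iff)
  qed
  ultimately show ?thesis by (simp add: abs_le_iff)
qed

text \<open>With \<open>u = \<surd>d / \<alpha> = N / 16\<close> and \<open>s = \<surd>d\<close> the
  bounds become \<open>a1 / s^2\<close>, \<open>a2 / s^3\<close>, \<open>a3 / s^4\<close>, where
  \<open>a1\<close>, \<open>a2\<close>, \<open>a3\<close> are polynomials in \<open>u\<close> alone.
  The powers of \<open>d\<close> in the Stein bound then cancel up to factors decreasing in
  \<open>d\<close>, and \<open>u^3 / n\<close> is a constant over \<open>N\<close>.\<close>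

lemma stein_constant_bound:
  fixes d N n \<alpha> :: real
  assumes d: "2 \<le> d" and N: "15.34 \<le> N" and n: "n = N ^ 4" and \<alpha>: "\<alpha> = 16 / N * sqrt d"
  defines "C \<equiv> 2 / sqrt d"
  defines "A1 \<equiv> C * (2.2 / \<alpha> + C)"
  defines "A2 \<equiv> C * (8 / \<alpha> ^ 2 + 2 * A1)"
  defines "A3 \<equiv> C * (53 / \<alpha> ^ 3 + 3 * A2)"
  shows "(2 * d * A1 + 8 * d * A2 + 28 * (d\<^sup>2 + 2 * d) * A3) / n \<le> 6.1 / N"
proof -
  define s where "s = sqrt d"
  have s: "1 \<le> s" "s\<^sup>2 = d" using d by (auto simp: s_def)
  define u where "u = N / 16"
  \<comment> \<open>\<open>1.045 * 15.34 / 16\<close> just exceeds 1, so every lower power of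
    \<open>u\<close> is absorbed into \<open>u ^ 3\<close> at a small factor.\<close>
  have u: "1 \<le> 1.045 * u" "0 < u" using N by (auto simp: u_def)
  have u1: "1 \<le> 1.0921 * u\<^sup>2"
    using power_mono[OF u(1), of 2] by (simp add: power_mult_distrib power2_eq_square)
  have u2: "1 \<le> 1.1412 * u ^ 3" "u \<le> 1.0921 * u ^ 3" "u\<^sup>2 \<le> 1.045 * u ^ 3"
  proof -
    have "1 \<le> (1.045 * u) ^ 3" using power_mono[OF u(1), of 3] by simp
    also have "\<dots> \<le> 1.1412 * u ^ 3" using u(2) by (simp add: power_mult_distrib power3_eq_cube)
    finally show "1 \<le> 1.1412 * u ^ 3" .
    show "u \<le> 1.0921 * u ^ 3"
      using mult_left_mono[OF u1, of u] u(2) by (simp add: power2_eq_square power3_eq_cube)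
    show "u\<^sup>2 \<le> 1.045 * u ^ 3"
      using mult_left_mono[OF u(1), of "u\<^sup>2"] u(2) by (simp add: power2_eq_square power3_eq_cube)
  qed
  define a1 where "a1 = 2 * (2.2 * u + 2)"
  define a2 where "a2 = 2 * (8 * u\<^sup>2 + 2 * a1)"
  define a3 where "a3 = 2 * (53 * u ^ 3 + 3 * a2)"
  have \<alpha>': "\<alpha> = s / u" using u by (simp add: \<alpha> u_def s_def)
  have C: "C = 2 / s" by (simp add: C_def s_def)
  have A1: "A1 = a1 / s\<^sup>2"
    unfolding A1_def C \<alpha>' a1_def using s(1) u(2) by (simp add: field_simps power2_eq_square)
  have A2: "A2 = a2 / s ^ 3"
    unfolding A2_def A1 C \<alpha>' a2_def using s(1) u(2)
    by (simp add: field_simps power2_eq_square power3_eq_cube)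
  have A3: "A3 = a3 / s ^ 4"
    unfolding A3_def A2 C \<alpha>' a3_def using s(1) u(2)
    by (simp add: field_simps power2_eq_square power3_eq_cube power4_eq_xxxx)
  have b1: "a1 \<le> 9.4 * u ^ 3" unfolding a1_def using u2 by simp
  have b2: "a2 \<le> 54.32 * u ^ 3" unfolding a2_def using u2 b1 by simp
  have b3: "a3 \<le> 431.92 * u ^ 3" unfolding a3_def using b2 zero_less_power[OF u(2), of 3] by simp
  have pos: "0 \<le> a1" "0 \<le> a2" "0 \<le> a3"
    using u(2) by (auto simp: a1_def a2_def a3_def intro!: mult_nonneg_nonneg add_nonneg_nonneg)
  have "2 * d * A1 + 8 * d * A2 + 28 * (d\<^sup>2 + 2 * d) * A3 = 2 * a1 + 8 * a2 / s + 28 * (1 + 2 / d) * a3"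
  proof -
    have "28 * (d\<^sup>2 + 2 * d) * A3 = 28 * (d\<^sup>2 + 2 * d) * a3 / d\<^sup>2"
      unfolding A3 s(2)[symmetric] by (simp add: power_mult[symmetric])
    also have "\<dots> = 28 * (1 + 2 / d) * a3" using d by (simp add: field_simps power2_eq_square)
    finally have 3: "28 * (d\<^sup>2 + 2 * d) * A3 = 28 * (1 + 2 / d) * a3" .
    have 2: "8 * d * A2 = 8 * a2 / s" unfolding A2 s(2)[symmetric] using s(1) by (simp add: power2_eq_square power3_eq_cube)
    have 1: "2 * d * A1 = 2 * a1" unfolding A1 s(2)[symmetric] using s(1) by simp
    show ?thesis unfolding 1 2 3 ..
  qed
  also have "\<dots> \<le> 2 * a1 + 8 * a2 / 1 + 28 * 2 * a3"
    using s(1) pos d by (intro add_mono mult_left_mono mult_right_mono divide_left_mono) (auto simp: field_simps)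
  also have "\<dots> \<le> 2 * (9.4 * u ^ 3) + 8 * (54.32 * u ^ 3) / 1 + 28 * 2 * (431.92 * u ^ 3)"
    by (intro add_mono mult_left_mono divide_right_mono b1 b2 b3) auto
  also have "\<dots> = 24640.88 * u ^ 3" by simp
  \<comment> \<open>24985 is \<open>6.1 * 16^3 = 24985.6\<close> rounded down.\<close>
  also have "\<dots> \<le> 24985 * u ^ 3"
    using u(2) by (intro mult_right_mono) auto
  also have "\<dots> \<le> 6.1 * N ^ 3" using N by (simp add: u_def power_divide)
  finally have "(2 * d * A1 + 8 * d * A2 + 28 * (d\<^sup>2 + 2 * d) * A3) / n \<le> 6.1 * N ^ 3 / n"
    using n N by (intro divide_right_mono) auto
  also have "\<dots> = 6.1 / N" using N unfolding n by (simp add: power3_eq_cube power4_eq_xxxx)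
  finally show ?thesis .
qed

section \<open>Reduction to averages\<close>

text \<open>The event is a disjoint union of boxes, one for each family of permutations satisfying
  \<open>Q\<close>, and independence gives all boxes the same probability. Averages run over
  extensional families, which the random family need not be; hence the assumption that
  \<open>Q\<close> sees only the indices up to \<open>n\<close>.\<close>

lemma (in prob_space) prob_eq_family_avg:
  fixes \<pi> :: "nat \<Rightarrow> 'a \<Rightarrow> nat \<Rightarrow> nat" and n r :: nat and Q :: "(nat \<Rightarrow> nat \<Rightarrow> nat) \<Rightarrow> bool"
  assumes n: "1 \<le> n"
    and indep: "indep_vars (\<lambda>_. count_space (perms r)) \<pi> {1..n}"
    and unif: "\<And>i. i \<in> {1..n} \<Longrightarrow> distr M (count_space (perms r)) (\<pi> i) = uniform_count_measure (perms r)"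
    and Q: "\<And>x. Q x \<longleftrightarrow> Q (restrict x {1..n})"
  shows "prob {\<omega> \<in> space M. Q (\<lambda>i. \<pi> i \<omega>)} = family_avg r {1..n} (\<lambda>x. if Q x then 1 else 0)"
proof -
  let ?I = "{1..n}"
  let ?X = "\<Pi>\<^sub>E i\<in>?I. perms r"
  let ?E = "\<lambda>x. \<Inter>i\<in>?I. \<pi> i -` {x i} \<inter> space M"
  have meas: "\<pi> i \<in> measurable M (count_space (perms r))" if "i \<in> ?I" for i
    using indep that by (auto simp: indep_vars_def)
  have val: "\<pi> i \<omega> \<in> perms r" if "i \<in> ?I" "\<omega> \<in> space M" for i \<omega>
    using measurable_space[OF meas[OF that(1)] that(2)] by simp
  have single: "prob (\<pi> i -` {p} \<inter> space M) = 1 / fact r" if "i \<in> ?I" "p \<in> perms r" for i p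
  proof -
    have "prob (\<pi> i -` {p} \<inter> space M) = measure (distr M (count_space (perms r)) (\<pi> i)) {p}"
      using meas[OF that(1)] that(2) by (subst measure_distr) auto
    also have "\<dots> = real (card {p}) / real (card (perms r))"
      unfolding unif[OF that(1)] using that(2)
      by (intro measure_uniform_count_measure finite_perms) auto
    finally show ?thesis by (simp only: card_perms) simp
  qed
  have box: "prob (?E x) = 1 / fact r ^ n" if x: "x \<in> ?X" for x
  proof -
    have "prob (?E x) = (\<Prod>i\<in>?I. prob (\<pi> i -` {x i} \<inter> space M))"
    proof (rule indep_varsD[OF indep])
      show "{x i} \<in> sets (count_space (perms r))" if "i \<in> ?I" for i
        using x that by (auto simp: PiE_iff)
    qed (use n in auto)
    also have "\<dots> = (\<Prod>i\<in>?I. 1 / fact r)"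
      using x by (intro prod.cong refl single) auto
    finally show ?thesis by (simp add: power_one_over)
  qed
  have E_sets: "?E x \<in> events" if x: "x \<in> ?X" for x
  proof (rule sets.finite_INT)
    show "\<pi> i -` {x i} \<inter> space M \<in> events" if "i \<in> ?I" for i
      using measurable_sets[OF meas[OF that], of "{x i}"] x that by (auto simp: PiE_iff)
  qed (use n in auto)
  have decomp: "{\<omega> \<in> space M. Q (\<lambda>i. \<pi> i \<omega>)} = (\<Union>x\<in>{x\<in>?X. Q x}. ?E x)"
  proof (intro set_eqI iffI)
    fix \<omega> assume \<omega>: "\<omega> \<in> {\<omega> \<in> space M. Q (\<lambda>i. \<pi> i \<omega>)}"
    let ?x = "restrict (\<lambda>i. \<pi> i \<omega>) ?I"
    have "?x \<in> ?X" using val \<omega> by auto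
    moreover have "Q ?x" using \<omega> Q[of "\<lambda>i. \<pi> i \<omega>"] by auto
    moreover have "\<omega> \<in> ?E ?x" using \<omega> by auto
    ultimately show "\<omega> \<in> (\<Union>x\<in>{x\<in>?X. Q x}. ?E x)" by blast
  next
    fix \<omega> assume "\<omega> \<in> (\<Union>x\<in>{x\<in>?X. Q x}. ?E x)"
    then obtain x where x: "x \<in> ?X" "Q x" "\<omega> \<in> ?E x" by blast
    then have "\<omega> \<in> space M" using n by auto
    moreover have "\<pi> i \<omega> = x i" if "i \<in> ?I" for i using x(3) that by blast
    then have "restrict (\<lambda>i. \<pi> i \<omega>) ?I = restrict x ?I" by (rule restrict_ext)
    then have "Q (\<lambda>i. \<pi> i \<omega>)" using Q[of x] Q[of "\<lambda>i. \<pi> i \<omega>"] x by simp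
    ultimately show "\<omega> \<in> {\<omega> \<in> space M. Q (\<lambda>i. \<pi> i \<omega>)}" by simp
  qed
  have disj: "disjoint_family_on ?E {x\<in>?X. Q x}"
  proof (unfold disjoint_family_on_def, intro ballI impI)
    fix x y assume xy: "x \<in> {x\<in>?X. Q x}" "y \<in> {x\<in>?X. Q x}" "x \<noteq> y"
    then obtain i where "i \<in> ?I" "x i \<noteq> y i" using PiE_ext[of x ?I "\<lambda>_. perms r" y] by blast
    then show "?E x \<inter> ?E y = {}" by auto
  qed
  have "prob {\<omega> \<in> space M. Q (\<lambda>i. \<pi> i \<omega>)} = (\<Sum>x\<in>{x\<in>?X. Q x}. prob (?E x))"
    unfolding decomp using E_sets disj finite_families[of ?I r]
    by (intro finite_measure_finite_Union) auto
  also have "\<dots> = (\<Sum>x\<in>{x\<in>?X. Q x}. 1 / fact r ^ n)"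
    by (intro sum.cong refl box) auto
  also have "\<dots> = (\<Sum>x\<in>?X. if Q x then 1 / fact r ^ n else 0)"
    by (intro sum.mono_neutral_cong_left finite_families) auto
  also have "\<dots> = family_avg r ?I (\<lambda>x. if Q x then 1 else 0)"
    unfolding family_avg_def sum_divide_distrib by (intro sum.cong) auto
  finally show ?thesis .
qed

lemma friedman_cdf_eq_family_avg:
  fixes M :: "'a measure" and \<pi> :: "nat \<Rightarrow> 'a \<Rightarrow> nat \<Rightarrow> nat" and n r :: nat
  assumes "prob_space M" and n: "1 \<le> n"
    and indep: "prob_space.indep_vars M (\<lambda>_. count_space (perms r)) \<pi> {1..n}"
    and unif: "\<And>i. i \<in> {1..n} \<Longrightarrow> distr M (count_space (perms r)) (\<pi> i) = uniform_count_measure (perms r)"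
  shows "measure (distr M borel (\<lambda>\<omega>. friedman_F n r (\<lambda>i. \<pi> i \<omega>))) {..z}
    = family_avg r {1..n} (\<lambda>x. if friedman_F n r x \<le> z then 1 else 0)"
proof -
  interpret prob_space M by fact
  have meas: "\<pi> i \<in> measurable M (count_space (perms r))" if "i \<in> {1..n}" for i
    using indep that by (auto simp: indep_vars_def)
  have "(\<lambda>\<omega>. real (\<pi> i \<omega> j)) \<in> borel_measurable M" if "i \<in> {1..n}" for i j
    using measurable_compose[OF meas[OF that], of "\<lambda>p. real (p j)" borel] by simp
  then have F: "(\<lambda>\<omega>. friedman_F n r (\<lambda>i. \<pi> i \<omega>)) \<in> borel_measurable M"
    unfolding friedman_F_def friedman_S_def friedman_rho_def
    by (intro borel_measurable_sum borel_measurable_power borel_measurable_times borel_measurable_diff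
        borel_measurable_const)
  have "rank_norm2 r {1..n} (restrict x {1..n}) = rank_norm2 r {1..n} x" for x
    by (simp add: rank_norm2_def rank_sum_def)
  then have loc: "(friedman_F n r x \<le> z) = (friedman_F n r (restrict x {1..n}) \<le> z)" for x
    by (simp only: friedman_F_eq_rank_norm2)
  have "measure (distr M borel (\<lambda>\<omega>. friedman_F n r (\<lambda>i. \<pi> i \<omega>))) {..z}
      = prob {\<omega> \<in> space M. friedman_F n r (\<lambda>i. \<pi> i \<omega>) \<le> z}"
    by (subst measure_distr[OF F]) (auto simp: vimage_def Int_def conj_commute)
  also have "\<dots> = family_avg r {1..n} (\<lambda>x. if friedman_F n r x \<le> z then 1 else 0)"
    by (rule prob_eq_family_avg[OF n indep unif, where Q = "\<lambda>x. friedman_F n r x \<le> z", OF _ loc])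
  finally show ?thesis .
qed

section \<open>Two treatments: the simple random walk\<close>

lemma exp_minus_bounds:
  fixes x :: real
  assumes "0 \<le> x"
  shows "exp (- x) \<le> 1 - x + x\<^sup>2 / 2" and "1 - x + x\<^sup>2 / 2 - x ^ 3 / 6 \<le> exp (- x)"
proof -
  have upper: "exp (- x) \<le> 1 - x + x\<^sup>2 / 2" if "0 \<le> x" for x :: real
  proof -
    have "(\<lambda>x::real. 1 - x + x\<^sup>2 / 2 - exp (- x)) 0 \<le> (\<lambda>x. 1 - x + x\<^sup>2 / 2 - exp (- x)) x"
    proof (rule DERIV_nonneg_imp_nondecreasing[OF that])
      fix y :: real
      have "((\<lambda>x::real. 1 - x + x\<^sup>2 / 2 - exp (- x)) has_real_derivative - 1 + y + exp (- y)) (at y)"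
        by (auto intro!: derivative_eq_intros)
      moreover have "0 \<le> - 1 + y + exp (- y)" using exp_ge_add_one_self[of "- y"] by linarith
      ultimately show "\<exists>D. ((\<lambda>x::real. 1 - x + x\<^sup>2 / 2 - exp (- x)) has_real_derivative D) (at y) \<and> 0 \<le> D"
        by blast
    qed
    then show ?thesis by simp
  qed
  show "exp (- x) \<le> 1 - x + x\<^sup>2 / 2" by (rule upper[OF assms])
  have "(\<lambda>x::real. exp (- x) - (1 - x + x\<^sup>2 / 2 - x ^ 3 / 6)) 0 \<le> (\<lambda>x. exp (- x) - (1 - x + x\<^sup>2 / 2 - x ^ 3 / 6)) x"
  proof (rule DERIV_nonneg_imp_nondecreasing[OF assms])
    fix y :: real assume "0 \<le> y"
    have "((\<lambda>x::real. exp (- x) - (1 - x + x\<^sup>2 / 2 - x ^ 3 / 6)) has_real_derivative 1 - y + y\<^sup>2 / 2 - exp (- y)) (at y)"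
      by (auto intro!: derivative_eq_intros)
    then show "\<exists>D. ((\<lambda>x::real. exp (- x) - (1 - x + x\<^sup>2 / 2 - x ^ 3 / 6)) has_real_derivative D) (at y) \<and> 0 \<le> D"
      using upper[OF \<open>0 \<le> y\<close>] by (intro exI[of _ "1 - y + y\<^sup>2 / 2 - exp (- y)"]) auto
  qed
  then show "1 - x + x\<^sup>2 / 2 - x ^ 3 / 6 \<le> exp (- x)" by simp
qed

lemma trig_coeff_values:
  "cos_coeff 0 = 1" "cos_coeff 1 = 0" "cos_coeff 2 = - 1 / 2" "cos_coeff 3 = 0"
  "cos_coeff 4 = 1 / 24" "cos_coeff 5 = 0" "cos_coeff 6 = - 1 / 720" "cos_coeff 7 = 0"
  "sin_coeff 0 = 0" "sin_coeff 1 = 1" "sin_coeff 2 = 0"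
  by (simp_all add: cos_coeff_def sin_coeff_def fact_numeral)

lemma sum_lessThan_small:
  fixes f :: "nat \<Rightarrow> real"
  shows "(\<Sum>m<3. f m) = f 0 + f 1 + f 2"
    and "(\<Sum>m<4. f m) = f 0 + f 1 + f 2 + f 3"
    and "(\<Sum>m<6. f m) = f 0 + f 1 + f 2 + f 3 + f 4 + f 5"
    and "(\<Sum>m<8. f m) = f 0 + f 1 + f 2 + f 3 + f 4 + f 5 + f 6 + f 7"
  by (simp_all add: eval_nat_numeral)

lemma cos_upper_4: "cos x \<le> 1 - x\<^sup>2 / 2 + x ^ 4 / 24" for x :: real
proof -
  obtain t where "cos x = (\<Sum>m<4. cos_coeff m * x ^ m) + cos (t + 1/2 * real 4 * pi) / fact 4 * x ^ 4"
    using Maclaurin_cos_expansion by blast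
  moreover have "cos (t + 1/2 * real 4 * pi) / fact 4 * x ^ 4 \<le> 1 / fact 4 * x ^ 4"
    by (intro mult_right_mono divide_right_mono) auto
  ultimately show ?thesis by (simp only: sum_lessThan_small trig_coeff_values) (simp add: fact_numeral)
qed

lemma cos_lower_6: "1 - x\<^sup>2 / 2 + x ^ 4 / 24 - x ^ 6 / 720 \<le> cos x" for x :: real
proof -
  obtain t where "cos x = (\<Sum>m<6. cos_coeff m * x ^ m) + cos (t + 1/2 * real 6 * pi) / fact 6 * x ^ 6"
    using Maclaurin_cos_expansion by blast
  moreover have "- 1 / fact 6 * x ^ 6 \<le> cos (t + 1/2 * real 6 * pi) / fact 6 * x ^ 6"
    by (intro mult_right_mono divide_right_mono) auto
  ultimately show ?thesis by (simp only: sum_lessThan_small trig_coeff_values) (simp add: fact_numeral)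
qed

lemma cos_upper_8: "cos x \<le> 1 - x\<^sup>2 / 2 + x ^ 4 / 24 - x ^ 6 / 720 + x ^ 8 / 40320" for x :: real
proof -
  obtain t where "cos x = (\<Sum>m<8. cos_coeff m * x ^ m) + cos (t + 1/2 * real 8 * pi) / fact 8 * x ^ 8"
    using Maclaurin_cos_expansion by blast
  moreover have "cos (t + 1/2 * real 8 * pi) / fact 8 * x ^ 8 \<le> 1 / fact 8 * x ^ 8"
    by (intro mult_right_mono divide_right_mono) auto
  ultimately show ?thesis by (simp only: sum_lessThan_small trig_coeff_values) (simp add: fact_numeral)
qed

lemma sin_lower_3: "x - x ^ 3 / 6 \<le> sin x" if "0 \<le> x" for x :: real
proof -
  obtain t where "sin x = (\<Sum>m<3. sin_coeff m * x ^ m) + sin (t + 1/2 * real 3 * pi) / fact 3 * x ^ 3"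
    using Maclaurin_sin_expansion by blast
  moreover have "- 1 / fact 3 * x ^ 3 \<le> sin (t + 1/2 * real 3 * pi) / fact 3 * x ^ 3"
    using that by (intro mult_right_mono divide_right_mono) auto
  ultimately show ?thesis by (simp only: sum_lessThan_small trig_coeff_values) (simp add: fact_numeral)
qed

text \<open>The signs of the cosine at 1.55 and 1.58, read off from Taylor polynomials of degrees 6
  and 8, enclose \<open>pi / 2\<close>.\<close>

lemma pi_bounds: "3.1 < pi" "pi < 3.16"
proof -
  have pos: "cos x > 0 \<longleftrightarrow> x < pi / 2" if "0 \<le> x" "x \<le> 2" for x :: real
  proof -
    have "cos x > 0 \<longleftrightarrow> cos x > cos (pi / 2)" by simp
    also have "\<dots> \<longleftrightarrow> x < pi / 2"
      using that pi_gt3 by (intro cos_mono_less_eq) auto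
    finally show ?thesis .
  qed
  have "0 < cos (1.55 :: real)" using cos_lower_6[of "1.55"] by (simp add: eval_nat_numeral)
  then show "3.1 < pi" using pos[of "1.55"] by simp
  have "cos (1.58 :: real) < 0" using cos_upper_8[of "1.58"] by (simp add: eval_nat_numeral)
  then have "\<not> 1.58 < pi / 2" using pos[of "1.58"] by simp
  moreover have "pi / 2 \<noteq> 1.58" using \<open>cos (1.58 :: real) < 0\<close> by (metis cos_pi_half less_irrefl)
  ultimately show "pi < 3.16" by simp
qed

section \<open>The simple random walk as an iterated averaging operator\<close>

primrec walk :: "nat \<Rightarrow> (real \<Rightarrow> real) \<Rightarrow> real \<Rightarrow> real" where
  "walk 0 g s = g s"
| "walk (Suc n) g s = (walk n g (s + 1) + walk n g (s - 1)) / 2"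

text \<open>One step multiplies the cosine of frequency \<open>t\<close> by \<open>cos t\<close>,
  the characteristic function of a fair sign.\<close>

lemma walk_cos: "walk n (\<lambda>s. cos (t * s)) s = cos t ^ n * cos (t * s)"
proof (induction n arbitrary: s)
  case (Suc n)
  have "cos (t * (s + 1)) + cos (t * (s - 1)) = 2 * cos t * cos (t * s)"
    by (simp add: distrib_left right_diff_distrib cos_add cos_diff)
  then show ?case by (simp add: Suc distrib_left[symmetric])
qed simp

lemma walk_cmult: "walk n (\<lambda>s. c * f s) s = c * walk n f s"
  by (induction n arbitrary: s) (simp_all add: distrib_left)

text \<open>The walk started at an integer only sees integers of the right parity.\<close>

lemma walk_cong_parity:
  assumes "\<And>k::int. even (k + a + int n) \<Longrightarrow> f (of_int k) = g (of_int k)"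
  shows "walk n f (of_int a) = walk n g (of_int a)"
  using assms
proof (induction n arbitrary: a)
  case 0
  then show ?case using 0[of a] by simp
next
  case (Suc n)
  have "walk n f (of_int (a + 1)) = walk n g (of_int (a + 1))"
    by (rule Suc.IH, rule Suc.prems) (simp add: algebra_simps)
  moreover have "walk n f (of_int (a - 1)) = walk n g (of_int (a - 1))"
    by (rule Suc.IH, rule Suc.prems) (auto simp: algebra_simps)
  ultimately show ?case by simp
qed

lemma walk_has_integral:
  assumes "\<And>s. (f s has_integral F s) S"
  shows "((\<lambda>t. walk n (\<lambda>s. f s t) s) has_integral walk n F s) S"
proof (induction n arbitrary: s)
  case 0
  then show ?case using assms by simp
next
  case (Suc n)
  show ?case using has_integral_divide[OF has_integral_add[OF Suc Suc], of "s + 1" "s - 1" 2] by simp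
qed

text \<open>The centred rank takes only the values 1/2 and -1/2, and reversing the ranks makes them
  equally likely; the two permutations need not be listed.\<close>

lemma perm_avg_2: "perm_avg 2 (\<lambda>p. g (friedman_rho 2 p 1)) = (g (1 / 2) + g (- (1 / 2))) / 2"
proof -
  define w :: "nat \<Rightarrow> real" where "w = (\<lambda>j. if j = 1 then 1 else 0)"
  have w: "rank_stat 2 w p = friedman_rho 2 p 1" for p
    by (simp add: rank_stat_def w_def numeral_2_eq_2)
  have val: "friedman_rho 2 p 1 = 1 / 2 \<or> friedman_rho 2 p 1 = - (1 / 2)" if "p \<in> perms 2" for p
  proof -
    have "p 1 \<in> {1..2}" using that permutes_in_image[of p "{1..2}" 1] by simp
    then have "p 1 = 1 \<or> p 1 = 2" by auto
    then show ?thesis by (auto simp: friedman_rho_def)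
  qed
  have "2 * (\<Sum>p\<in>perms 2. g (friedman_rho 2 p 1))
      = (\<Sum>p\<in>perms 2. g (friedman_rho 2 p 1)) + (\<Sum>p\<in>perms 2. g (- friedman_rho 2 p 1))"
    using sum_perms_reverse[of g 2 w] unfolding w by simp
  also have "\<dots> = (\<Sum>p\<in>perms 2. g (friedman_rho 2 p 1) + g (- friedman_rho 2 p 1))"
    by (simp only: sum.distrib)
  also have "\<dots> = (\<Sum>p\<in>perms 2. g (1 / 2) + g (- (1 / 2)))"
  proof (rule sum.cong[OF refl])
    fix p assume p: "p \<in> perms 2"
    show "g (friedman_rho 2 p 1) + g (- friedman_rho 2 p 1) = g (1 / 2) + g (- (1 / 2))"
      using val[OF p] by (elim disjE) (simp_all only: minus_minus add.commute)
  qed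
  also have "\<dots> = 2 * (g (1 / 2) + g (- (1 / 2)))"
    by (simp only: sum_constant card_perms) simp
  finally show ?thesis by (simp add: perm_avg_def)
qed

text \<open>For two treatments, twice a centred rank is a fair sign, so each permutation is one step
  of the walk. The starting point stays arbitrary for the induction.\<close>

lemma family_avg_2_eq_walk:
  assumes "finite I"
  shows "family_avg 2 I (\<lambda>x. g (s + 2 * rank_sum 2 I x 1)) = walk (card I) g s"
  using assms
proof (induction I arbitrary: s)
  case empty
  then show ?case by (simp add: family_avg_def rank_sum_def)
next
  case (insert i J)
  have "family_avg 2 (insert i J) (\<lambda>x. g (s + 2 * rank_sum 2 (insert i J) x 1))
      = family_avg 2 J (\<lambda>x. perm_avg 2 (\<lambda>p. g (s + 2 * (rank_sum 2 J x 1 + friedman_rho 2 p 1))))"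
    unfolding family_avg_insert[OF insert.hyps] rank_sum_insert[OF insert.hyps] ..
  also have "\<dots> = family_avg 2 J (\<lambda>x. 1 / 2 * (g ((s + 1) + 2 * rank_sum 2 J x 1) + g ((s - 1) + 2 * rank_sum 2 J x 1)))"
  proof (rule family_avg_cong)
    fix x
    show "perm_avg 2 (\<lambda>p. g (s + 2 * (rank_sum 2 J x 1 + friedman_rho 2 p 1)))
        = 1 / 2 * (g ((s + 1) + 2 * rank_sum 2 J x 1) + g ((s - 1) + 2 * rank_sum 2 J x 1))"
      using perm_avg_2[of "\<lambda>y. g (s + 2 * (rank_sum 2 J x 1 + y))"] by (simp add: algebra_simps)
  qed
  also have "\<dots> = walk (card (insert i J)) g s"
    unfolding family_avg_cmult family_avg_add insert.IH using insert.hyps by simp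
  finally show ?case .
qed

text \<open>The two rank sums are opposite, so one of them determines the statistic. The summand 0
  is the starting point of the walk in \<open>family_avg_2_eq_walk\<close>.\<close>

lemma rank_norm2_2:
  assumes "x \<in> (\<Pi>\<^sub>E i\<in>I. perms 2)"
  shows "rank_norm2 2 I x = (0 + 2 * rank_sum 2 I x 1)\<^sup>2 / 2"
proof -
  have "{1..2::nat} = {1, 2}" by auto
  then have "rank_sum 2 I x 2 = - rank_sum 2 I x 1" "rank_norm2 2 I x = (rank_sum 2 I x 1)\<^sup>2 + (rank_sum 2 I x 2)\<^sup>2"
    using rank_sum_centered[OF assms] by (auto simp: rank_norm2_def)
  then show ?thesis by (simp add: power2_eq_square)
qed

lemma friedman_cdf_2:
  assumes n: "1 \<le> n" and z: "0 \<le> z"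
  shows "family_avg 2 {1..n} (\<lambda>x. if friedman_F n 2 x \<le> z then 1 else 0)
    = walk n (\<lambda>s. if \<bar>s\<bar> \<le> sqrt (real n * z) then 1 else 0) 0"
proof -
  have "friedman_F n 2 x \<le> z
      \<longleftrightarrow> \<bar>0 + 2 * rank_sum 2 {1..n} x 1\<bar> \<le> sqrt (real n * z)" if "x \<in> (\<Pi>\<^sub>E i\<in>{1..n}. perms 2)" for x
  proof -
    have "friedman_F n 2 x \<le> z
        \<longleftrightarrow> (0 + 2 * rank_sum 2 {1..n} x 1)\<^sup>2 \<le> real n * z"
      unfolding friedman_F_eq_rank_norm2 rank_norm2_2[OF that] using n by (simp add: field_simps)
    also have "\<dots> \<longleftrightarrow> \<bar>0 + 2 * rank_sum 2 {1..n} x 1\<bar> \<le> sqrt (real n * z)"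
      using real_sqrt_le_iff[of "(0 + 2 * rank_sum 2 {1..n} x 1)\<^sup>2"] by (simp only: real_sqrt_abs)
    finally show ?thesis .
  qed
  then have "family_avg 2 {1..n} (\<lambda>x. if friedman_F n 2 x \<le> z then 1 else 0)
      = family_avg 2 {1..n} (\<lambda>x. (\<lambda>s. if \<bar>s\<bar> \<le> sqrt (real n * z) then 1 else 0) (0 + 2 * rank_sum 2 {1..n} x 1))"
    by (intro family_avg_cong) simp
  then show ?thesis
    using family_avg_2_eq_walk[of "{1..n}" "\<lambda>s. if \<bar>s\<bar> \<le> sqrt (real n * z) then 1 else 0" 0] by simp
qed

section \<open>Fourier inversion on the lattice\<close>

definition dirichlet_kernel :: "nat \<Rightarrow> real \<Rightarrow> real" where
  "dirichlet_kernel y t = (\<Sum>k<y. cos ((2 * real k - real y + 1) * t))"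

text \<open>The products with \<open>sin t\<close> telescope. The frequencies of the kernel are the
  integers strictly between \<open>- y\<close> and \<open>y\<close> whose parity differs from that
  of \<open>y\<close>.\<close>

lemma sin_mult_dirichlet_kernel: "sin t * dirichlet_kernel y t = sin (real y * t)"
proof -
  have "sin t * cos ((2 * real k - real y + 1) * t)
      = sin ((2 * real (Suc k) - real y) * t) / 2 - sin ((2 * real k - real y) * t) / 2" for k
  proof -
    have "t + (2 * real k - real y + 1) * t = (2 * real (Suc k) - real y) * t"
      "t - (2 * real k - real y + 1) * t = - ((2 * real k - real y) * t)"
      by (simp_all add: algebra_simps)
    then show ?thesis by (simp only: sin_times_cos sin_minus) (simp add: diff_divide_distrib)
  qed
  then have "sin t * dirichlet_kernel y t
      = (\<Sum>k<y. sin ((2 * real (Suc k) - real y) * t) / 2 - sin ((2 * real k - real y) * t) / 2)"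
    by (simp add: dirichlet_kernel_def sum_distrib_left)
  also have "\<dots> = sin ((2 * real y - real y) * t) / 2 - sin ((2 * real 0 - real y) * t) / 2"
    by (rule sum_lessThan_telescope)
  also have "\<dots> = sin (real y * t)" by simp
  finally show ?thesis .
qed

lemma cos_even_has_integral:
  "((\<lambda>t. cos (2 * of_int m * t)) has_integral (if m = 0 then pi / 2 else 0)) {0..pi / 2}"
proof (cases "m = 0")
  case True
  then show ?thesis using has_integral_const_real[of "1::real" 0 "pi / 2"] by simp
next
  case False
  have "((\<lambda>t. cos (2 * of_int m * t)) has_integral
      sin (2 * of_int m * (pi / 2)) / (2 * of_int m) - sin (2 * of_int m * 0) / (2 * of_int m)) {0..pi / 2}"
    by (rule fundamental_theorem_of_calculus)
       (use False in \<open>auto intro!: derivative_eq_intros simp: has_real_derivative_iff_has_vector_derivative[symmetric]\<close>)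
  moreover have "sin (of_int m * pi) = 0" by (simp add: sin_times_pi_eq_0)
  ultimately show ?thesis using False by simp
qed

lemma sum_lattice_delta:
  fixes b :: int
  assumes "odd (b + int y)"
  shows "(\<Sum>k<y. if b = 2 * int k - int y + 1 then c else 0) = (if \<bar>b\<bar> < int y then c else (0::real))"
proof -
  obtain m where m: "b + int y = 2 * m + 1" using assms by (elim oddE)
  have "(\<Sum>k<y. if b = 2 * int k - int y + 1 then c else 0) = (\<Sum>k<y. if k = nat m \<and> 0 \<le> m then c else 0)"
    using m by (intro sum.cong) auto
  also have "\<dots> = (if 0 \<le> m \<and> nat m < y then c else 0)"
    by (cases "0 \<le> m") (auto simp: sum.delta)
  also have "0 \<le> m \<and> nat m < y \<longleftrightarrow> \<bar>b\<bar> < int y" using m by auto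
  finally show ?thesis .
qed

text \<open>\<open>b\<close> has the parity of the frequencies of the kernel, so all sums and
  differences are even and the cosines are orthogonal already on a quarter period. The frequencies
  \<open>b\<close> and \<open>- b\<close> contribute \<open>pi / 4\<close> each.\<close>

lemma cos_dirichlet_has_integral:
  fixes b :: int
  assumes "odd (b + int y)"
  shows "((\<lambda>t. cos (of_int b * t) * dirichlet_kernel y t) has_integral
    (if \<bar>b\<bar> < int y then pi / 2 else 0)) {0..pi / 2}"
proof -
  have one: "((\<lambda>t. cos (of_int b * t) * cos ((2 * real k - real y + 1) * t)) has_integral
      ((if - b = 2 * int k - int y + 1 then pi / 4 else 0) + (if b = 2 * int k - int y + 1 then pi / 4 else 0))) {0..pi / 2}" for k
  proof -
    obtain m where m: "b + int y = 2 * m + 1" using assms by (elim oddE)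
    define m1 where "m1 = m + int k - int y + 1"
    define m2 where "m2 = m - int k"
    have e: "of_int b + (2 * real k - real y + 1) = 2 * of_int m1" "of_int b - (2 * real k - real y + 1) = 2 * of_int m2"
    proof -
      have "of_int (b + int y) = (2 * of_int m + 1 :: real)" unfolding m by simp
      then show "of_int b + (2 * real k - real y + 1) = 2 * of_int m1" "of_int b - (2 * real k - real y + 1) = 2 * of_int m2"
        by (auto simp: m1_def m2_def)
    qed
    have "((\<lambda>t. cos (2 * of_int m2 * t) / 2 + cos (2 * of_int m1 * t) / 2) has_integral
        (if m2 = 0 then pi / 2 else 0) / 2 + (if m1 = 0 then pi / 2 else 0) / 2) {0..pi / 2}"
      by (intro has_integral_add has_integral_divide cos_even_has_integral)
    moreover have "cos (of_int b * t) * cos ((2 * real k - real y + 1) * t) = cos (2 * of_int m2 * t) / 2 + cos (2 * of_int m1 * t) / 2" for t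
      unfolding e[symmetric] cos_times_cos by (simp add: left_diff_distrib distrib_right add_divide_distrib)
    moreover have "m2 = 0 \<longleftrightarrow> b = 2 * int k - int y + 1" "m1 = 0 \<longleftrightarrow> - b = 2 * int k - int y + 1"
      using m by (auto simp: m1_def m2_def)
    moreover have "(if P then pi / 2 else 0) / 2 + (if Q then pi / 2 else 0) / 2 = (if Q then pi / 4 else 0) + (if P then pi / 4 else 0)" for P Q
      by auto
    ultimately show ?thesis by (simp only:)
  qed
  have "((\<lambda>t. \<Sum>k<y. cos (of_int b * t) * cos ((2 * real k - real y + 1) * t)) has_integral
     (\<Sum>k<y. (if - b = 2 * int k - int y + 1 then pi / 4 else 0) + (if b = 2 * int k - int y + 1 then pi / 4 else 0))) {0..pi / 2}"
    by (intro has_integral_sum one) auto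
  also have "(\<Sum>k<y. (if - b = 2 * int k - int y + 1 then pi / 4 else 0) + (if b = 2 * int k - int y + 1 then pi / 4 else 0))
      = (if \<bar>b\<bar> < int y then pi / 2 else 0)"
    using sum_lattice_delta[of b y "pi / 4"] sum_lattice_delta[of "- b" y "pi / 4"] assms
    by (simp add: sum.distrib)
  finally show ?thesis by (simp add: dirichlet_kernel_def sum_distrib_left)
qed

lemma continuous_on_dirichlet_kernel: "continuous_on A (dirichlet_kernel y)"
  unfolding dirichlet_kernel_def[abs_def] by (intro continuous_intros)

text \<open>At the integers that the walk can reach, and in general only there, the indicator is a
  cosine integral against the Dirichlet kernel. The walk commutes with the integral and acts on each
  cosine through \<open>cos t ^ n\<close>.\<close>

lemma walk_indicator_has_integral:
  assumes "odd (n + y)"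
  shows "((\<lambda>t. cos t ^ n * dirichlet_kernel y t) has_integral
    pi / 2 * walk n (\<lambda>s. if \<bar>s\<bar> < real y then 1 else 0) 0) {0..pi / 2}"
proof -
  define F where "F = (\<lambda>s. integral {0..pi / 2} (\<lambda>t. dirichlet_kernel y t * cos (t * s)))"
  have "((\<lambda>t. dirichlet_kernel y t * cos (t * s)) has_integral F s) {0..pi / 2}" for s
    unfolding F_def
    by (intro integrable_integral integrable_continuous_interval continuous_intros continuous_on_dirichlet_kernel)
  then have "((\<lambda>t. walk n (\<lambda>s. dirichlet_kernel y t * cos (t * s)) 0) has_integral walk n F 0) {0..pi / 2}"
    by (rule walk_has_integral)
  moreover have "walk n (\<lambda>s. dirichlet_kernel y t * cos (t * s)) 0 = cos t ^ n * dirichlet_kernel y t" for t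
    by (simp add: walk_cmult walk_cos)
  moreover have "walk n F (of_int 0) = walk n (\<lambda>s. pi / 2 * (if \<bar>s\<bar> < real y then 1 else 0)) (of_int 0)"
  proof (rule walk_cong_parity)
    fix k :: int assume k: "even (k + 0 + int n)"
    have "odd (k + int y)" using k assms by auto
    from integral_unique[OF cos_dirichlet_has_integral[OF this]]
    have "F (of_int k) = (if \<bar>k\<bar> < int y then pi / 2 else 0)"
      by (simp add: F_def mult.commute)
    also have "\<bar>k\<bar> < int y \<longleftrightarrow> \<bar>of_int k\<bar> < real y"
      by (metis of_int_abs of_int_less_iff of_int_of_nat_eq)
    finally show "F (of_int k) = pi / 2 * (if \<bar>of_int k\<bar> < real y then 1 else 0)" by simp
  qed
  ultimately show ?thesis by (simp only: of_int_0 walk_cmult)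
qed

section \<open>Comparison of the lattice integrand with the Gaussian one\<close>

lemma pi_half_square: "t\<^sup>2 \<le> 2.4964" if "0 \<le> t" "t \<le> pi / 2" for t :: real
proof -
  have "t\<^sup>2 \<le> 1.58\<^sup>2" using that pi_bounds by (intro power_mono) auto
  then show ?thesis by (simp add: power2_eq_square)
qed

lemma cos_le_exp: "cos t \<le> exp (- (t\<^sup>2 / 2))" if "0 \<le> t" "t \<le> pi / 2"
proof -
  have "cos t \<le> 1 - t\<^sup>2 / 2 + t ^ 4 / 24" by (rule cos_upper_4)
  also have "\<dots> \<le> 1 - t\<^sup>2 / 2 + (t\<^sup>2 / 2)\<^sup>2 / 2 - (t\<^sup>2 / 2) ^ 3 / 6"
  proof -
    have "0 \<le> t ^ 4 * (4 - t\<^sup>2)" using pi_half_square[OF that] by (intro mult_nonneg_nonneg) auto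
    then show ?thesis by (simp add: power_numeral_reduce field_simps)
  qed
  also have "\<dots> \<le> exp (- (t\<^sup>2 / 2))" by (rule exp_minus_bounds(2)) simp
  finally show ?thesis .
qed

lemma exp_minus_cos_le: "exp (- (t\<^sup>2 / 2)) - cos t \<le> 0.087 * t ^ 4" if "0 \<le> t" "t \<le> pi / 2"
proof -
  have "exp (- (t\<^sup>2 / 2)) - cos t \<le> (1 - t\<^sup>2 / 2 + (t\<^sup>2 / 2)\<^sup>2 / 2) - (1 - t\<^sup>2 / 2 + t ^ 4 / 24 - t ^ 6 / 720)"
    by (intro diff_mono exp_minus_bounds(1) cos_lower_6) simp
  also have "\<dots> = t ^ 4 * (1 / 12 + t\<^sup>2 / 720)"
    by (simp add: power_numeral_reduce field_simps)
  also have "\<dots> \<le> t ^ 4 * 0.087"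
    using pi_half_square[OF that] by (intro mult_left_mono) auto
  finally show ?thesis by simp
qed

lemma inverse_sin_minus_inverse: "0 \<le> 1 / sin t - 1 / t" "1 / sin t - 1 / t \<le> 0.2855 * t"
  if t: "0 < t" "t \<le> pi / 2"
proof -
  have sin: "0 < sin t" using t by (intro sin_gt_zero) auto
  have le: "sin t \<le> t" using t by (simp add: sin_x_le_x)
  show "0 \<le> 1 / sin t - 1 / t" using sin le t by (simp add: divide_left_mono frac_le)
  have t2: "t\<^sup>2 \<le> 2.4964" using t by (intro pi_half_square) auto
  have low: "t * (1 - t\<^sup>2 / 6) \<le> sin t"
    using sin_lower_3[of t] t by (simp add: power2_eq_square power3_eq_cube algebra_simps)
  have pos: "0 < t * (1 - t\<^sup>2 / 6)" using t t2 by simp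
  have "1 / sin t \<le> 1 / (t * (1 - t\<^sup>2 / 6))" using low pos by (intro divide_left_mono) (auto simp: sin)
  then have "1 / sin t - 1 / t \<le> 1 / (t * (1 - t\<^sup>2 / 6)) - 1 / t" by simp
  also have "\<dots> = t / (6 - t\<^sup>2)"
    using t t2 by (simp add: divide_simps) (simp add: algebra_simps power2_eq_square)
  also have "\<dots> \<le> t / 3.5036" using t t2 by (intro divide_left_mono) auto
  also have "\<dots> \<le> 0.2855 * t" using t by simp
  finally show "1 / sin t - 1 / t \<le> 0.2855 * t" .
qed

lemma power_diff_le:
  fixes a b :: real
  assumes "0 \<le> b" "b \<le> a" "1 \<le> n"
  shows "a ^ n - b ^ n \<le> real n * (a - b) * a ^ (n - 1)"
proof -
  obtain m where n: "n = Suc m" using assms(3) by (cases n) auto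
  have "a ^ Suc m - b ^ Suc m = (a - b) * (\<Sum>i<Suc m. a ^ i * b ^ (m - i))"
    using diff_power_eq_sum[of a m b] by simp
  also have "\<dots> \<le> (a - b) * (\<Sum>i<Suc m. a ^ m)"
  proof (intro mult_left_mono sum_mono)
    fix i assume "i \<in> {..<Suc m}"
    then have "a ^ i * b ^ (m - i) \<le> a ^ i * a ^ (m - i)"
      using assms by (intro mult_left_mono power_mono) auto
    also have "\<dots> = a ^ m" using \<open>i \<in> {..<Suc m}\<close> by (simp add: power_add[symmetric])
    finally show "a ^ i * b ^ (m - i) \<le> a ^ m" .
  qed (use assms in auto)
  also have "\<dots> = real n * (a - b) * a ^ (n - 1)" by (simp add: n)
  finally show ?thesis by (simp add: n)
qed

lemma exp_square_power: "exp (- (t\<^sup>2 / 2)) ^ n = exp (- (real n * t\<^sup>2 / 2))" for t :: real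
  by (simp add: exp_of_nat_mult[symmetric])

text \<open>Two replacements: \<open>1 / t\<close> for \<open>1 / sin t\<close>, and the Gaussian
  for \<open>cos t ^ n\<close>. The first costs order \<open>t\<close>, the second order
  \<open>n t^4 / t\<close>, both under a Gaussian factor, so that each integrates to order
  \<open>1 / n\<close>.\<close>

lemma kernel_difference_bound:
  assumes t: "0 < t" "t \<le> pi / 2" and n: "1 \<le> n"
  shows "\<bar>cos t ^ n * dirichlet_kernel y t - sin (real y * t) / t * exp (- (real n * t\<^sup>2 / 2))\<bar>
    \<le> 0.2855 * t * exp (- (real n * t\<^sup>2 / 2)) + 0.087 * real n * t ^ 3 * exp (- (real (n - 1) * t\<^sup>2 / 2))"
proof -
  let ?E = "exp (- (t\<^sup>2 / 2))"
  have sin: "0 < sin t" using t by (intro sin_gt_zero) auto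
  have cos: "0 \<le> cos t" using t by (intro cos_ge_zero) auto
  have D: "dirichlet_kernel y t = sin (real y * t) / sin t"
    using sin_mult_dirichlet_kernel[of t y] sin by (simp add: field_simps)
  have cE: "cos t \<le> ?E" using t by (intro cos_le_exp) auto
  have "cos t ^ n * dirichlet_kernel y t - sin (real y * t) / t * ?E ^ n
      = sin (real y * t) * (cos t ^ n * (1 / sin t - 1 / t) - (?E ^ n - cos t ^ n) / t)"
    by (simp add: D algebra_simps diff_divide_distrib)
  also have "\<bar>\<dots>\<bar> \<le> 1 * (cos t ^ n * (1 / sin t - 1 / t) + (?E ^ n - cos t ^ n) / t)"
    unfolding abs_mult
  proof (intro mult_mono)
    have "0 \<le> cos t ^ n * (1 / sin t - 1 / t)" "0 \<le> (?E ^ n - cos t ^ n) / t"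
      using inverse_sin_minus_inverse[OF t] cos power_mono[OF cE cos, of n] t by auto
    then show "\<bar>cos t ^ n * (1 / sin t - 1 / t) - (?E ^ n - cos t ^ n) / t\<bar>
        \<le> cos t ^ n * (1 / sin t - 1 / t) + (?E ^ n - cos t ^ n) / t" by linarith
  qed auto
  also have "\<dots> \<le> ?E ^ n * (0.2855 * t) + (real n * (0.087 * t ^ 4) * ?E ^ (n - 1)) / t"
    unfolding mult_1
  proof (intro add_mono mult_mono divide_right_mono)
    have "?E ^ n - cos t ^ n \<le> real n * (?E - cos t) * ?E ^ (n - 1)"
      using cos cE n by (rule power_diff_le)
    also have "\<dots> \<le> real n * (0.087 * t ^ 4) * ?E ^ (n - 1)"
      using exp_minus_cos_le[of t] t by (intro mult_right_mono mult_left_mono) auto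
    finally show "?E ^ n - cos t ^ n \<le> real n * (0.087 * t ^ 4) * ?E ^ (n - 1)" .
  qed (use inverse_sin_minus_inverse[OF t] cos power_mono[OF cE cos, of n] t in auto)
  also have "\<dots> = 0.2855 * t * ?E ^ n + 0.087 * real n * t ^ 3 * ?E ^ (n - 1)"
    using t by (simp add: power_numeral_reduce mult_ac)
  finally show ?thesis unfolding exp_square_power .
qed

section \<open>The Gaussian inversion integral\<close>

definition gauss_kernel :: "real \<Rightarrow> real \<Rightarrow> real \<Rightarrow> real" where
  "gauss_kernel v a t = sin (a * t) / t * exp (- (v * t\<^sup>2 / 2))"

text \<open>Division by zero makes the kernel 0 at \<open>t = 0\<close> instead of its limit
  \<open>a\<close>, so integrability is drawn from measurability and boundedness and not from
  continuity.\<close>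

lemma gauss_kernel_integrable:
  assumes v: "0 \<le> v"
  shows "set_integrable lborel {x..y} (gauss_kernel v a)"
    and "gauss_kernel v a integrable_on {x..y}"
proof -
  have bnd: "\<bar>gauss_kernel v a t\<bar> \<le> \<bar>a\<bar>" for t
  proof -
    have "\<bar>sin (a * t) / t\<bar> \<le> \<bar>a\<bar>"
    proof (cases "t = 0")
      case False
      have "\<bar>sin (a * t)\<bar> \<le> \<bar>a * t\<bar>" by (rule abs_sin_x_le_abs_x)
      then show ?thesis using False by (simp add: abs_mult divide_le_eq)
    qed simp
    moreover have "\<bar>exp (- (v * t\<^sup>2 / 2))\<bar> \<le> 1" using v by simp
    ultimately have "\<bar>sin (a * t) / t\<bar> * \<bar>exp (- (v * t\<^sup>2 / 2))\<bar> \<le> \<bar>a\<bar> * 1"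
      by (intro mult_mono) auto
    then show ?thesis unfolding gauss_kernel_def abs_mult by simp
  qed
  show s: "set_integrable lborel {x..y} (gauss_kernel v a)"
    unfolding set_integrable_def
  proof (rule integrableI_bounded_set[where A = "{x..y}" and B = "\<bar>a\<bar>"])
    show "(\<lambda>t. indicat_real {x..y} t *\<^sub>R gauss_kernel v a t) \<in> borel_measurable lborel"
      unfolding gauss_kernel_def[abs_def] by measurable
  qed (auto simp: bnd emeasure_lborel_Icc_eq intro!: AE_I2)
  show "gauss_kernel v a integrable_on {x..y}"
    by (rule set_borel_integral_eq_integral(1)[OF s])
qed

lemma std_normal_singleton: "measure std_normal_distribution {x} = 0"
proof -
  have "emeasure std_normal_distribution {x} = (\<integral>\<^sup>+t. ennreal (std_normal_density t) * indicator {x} t \<partial>lborel)"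
    by (subst emeasure_density) auto
  also have "\<dots> = 0"
    by (subst nn_integral_0_iff_AE) (auto intro!: AE_I'[of "{x}"] simp: null_sets_def)
  finally show ?thesis by (simp add: measure_def)
qed

text \<open>Levy inversion on the interval from \<open>- a\<close> to \<open>a\<close>. The
  integrand is real and even, which turns \<open>1 / (2 pi)\<close> over the symmetric range into
  \<open>2 / pi\<close> over the half range; single points carry no mass.\<close>

lemma gauss_kernel_inversion:
  assumes a: "0 \<le> a"
  shows "(\<lambda>T. 2 / pi * integral {0..real T} (gauss_kernel 1 a)) \<longlonglongrightarrow> measure std_normal_distribution {- a..a}"
proof -
  interpret real_distribution std_normal_distribution by (rule real_dist_normal_dist)
  let ?f = "\<lambda>t. (iexp (- (t * (- a))) - iexp (- (t * a))) / (\<i> * complex_of_real t) * char std_normal_distribution t"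
  have f: "?f t = complex_of_real (2 * gauss_kernel 1 a t)" for t
  proof (cases "t = 0")
    case False
    have "iexp (t * a) - iexp (- (t * a)) = 2 * \<i> * complex_of_real (sin (t * a))"
      by (simp add: complex_eq_iff Re_exp Im_exp)
    then have "?f t = 2 * \<i> * complex_of_real (sin (t * a)) / (\<i> * complex_of_real t) * complex_of_real (exp (- (t\<^sup>2) / 2))"
      by (simp add: char_std_normal_distribution)
    then show ?thesis using False by (simp add: gauss_kernel_def mult.commute)
  qed (simp add: gauss_kernel_def)
  have int: "(CLBINT t=- real T..real T. ?f t) = complex_of_real (4 * integral {0..real T} (gauss_kernel 1 a))" for T :: nat
  proof -
    have even: "gauss_kernel 1 a (- t) = gauss_kernel 1 a t" for t by (simp add: gauss_kernel_def)
    have "(LBINT t=- real T..real T. 2 * gauss_kernel 1 a t) = 2 * (LBINT t=- real T..real T. gauss_kernel 1 a t)"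
      by simp
    also have "(LBINT t=- real T..real T. gauss_kernel 1 a t) = (LBINT t:{- real T..real T}. gauss_kernel 1 a t)"
      using interval_integral_Icc[of "- real T" "real T" "gauss_kernel 1 a"] by simp
    also have "\<dots> = integral {- real T..real T} (gauss_kernel 1 a)"
      by (intro set_borel_integral_eq_integral gauss_kernel_integrable) simp
    also have "\<dots> = integral {- real T..0} (gauss_kernel 1 a) + integral {0..real T} (gauss_kernel 1 a)"
      by (intro Henstock_Kurzweil_Integration.integral_combine[symmetric] gauss_kernel_integrable) auto
    also have "integral {- real T..0} (gauss_kernel 1 a) = integral {0..real T} (gauss_kernel 1 a)"
      using Henstock_Kurzweil_Integration.integral_reflect_real[of "real T" 0 "gauss_kernel 1 a"] by (simp add: even)
    finally show ?thesis
      unfolding f interval_lebesgue_integral_of_real by simp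
  qed
  have "(\<lambda>T. 1 / (2 * pi) * (CLBINT t=- real T..real T. ?f t)) \<longlonglongrightarrow> complex_of_real (measure std_normal_distribution {- a<..a})"
    using Levy_Inversion[of "- a" a] a by (simp add: std_normal_singleton)
  then have "(\<lambda>T. complex_of_real (2 / pi * integral {0..real T} (gauss_kernel 1 a))) \<longlonglongrightarrow> complex_of_real (measure std_normal_distribution {- a<..a})"
    unfolding int by simp
  then have lim: "(\<lambda>T. 2 / pi * integral {0..real T} (gauss_kernel 1 a)) \<longlonglongrightarrow> measure std_normal_distribution {- a<..a}"
    by (simp only: tendsto_of_real_iff)
  have "{- a..a} = {- a} \<union> {- a<..a}" using a by auto
  then have "measure std_normal_distribution {- a..a} = measure std_normal_distribution {- a} + measure std_normal_distribution {- a<..a}"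
    by (simp only:) (rule finite_measure_Union, auto)
  then show ?thesis using lim by (simp add: std_normal_singleton)
qed

lemma gauss_kernel_scale:
  assumes n: "0 < n"
  shows "integral {0..T} (gauss_kernel 1 (y / sqrt n)) = integral {0..T / sqrt n} (gauss_kernel n y)"
proof -
  have s: "0 < sqrt n" "sqrt n * sqrt n = n" using n by auto
  have "(gauss_kernel 1 (y / sqrt n) has_integral integral {0..T} (gauss_kernel 1 (y / sqrt n))) {0..T}"
    by (intro integrable_integral gauss_kernel_integrable) simp
  then have "((\<lambda>t. gauss_kernel 1 (y / sqrt n) (sqrt n *\<^sub>R t + 0)) has_integral
      integral {0..T} (gauss_kernel 1 (y / sqrt n)) /\<^sub>R sqrt n ^ DIM(real)) (cbox ((0 - 0) /\<^sub>R sqrt n) ((T - 0) /\<^sub>R sqrt n))"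
    using s(1) by (intro has_integral_affinity') auto
  then have "((\<lambda>t. gauss_kernel 1 (y / sqrt n) (sqrt n * t)) has_integral
      integral {0..T} (gauss_kernel 1 (y / sqrt n)) / sqrt n) {0..T / sqrt n}"
    by (simp add: divide_inverse mult.commute)
  from has_integral_mult_right[OF this, of "sqrt n"]
  have "((\<lambda>t. sqrt n * gauss_kernel 1 (y / sqrt n) (sqrt n * t)) has_integral
      integral {0..T} (gauss_kernel 1 (y / sqrt n))) {0..T / sqrt n}"
    using s by simp
  moreover have "sqrt n * gauss_kernel 1 (y / sqrt n) (sqrt n * t) = gauss_kernel n y t" for t
    using s(1) n by (simp add: gauss_kernel_def power_mult_distrib)
  ultimately show ?thesis by (metis (no_types, lifting) integral_unique has_integral_cong)
qed

lemma exp_square_integral: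
  fixes m a b :: real
  assumes m: "0 < m" and ab: "a \<le> b"
  shows "((\<lambda>t. t * exp (- (m * t\<^sup>2 / 2))) has_integral (exp (- (m * a\<^sup>2 / 2)) - exp (- (m * b\<^sup>2 / 2))) / m) {a..b}"
proof -
  have "((\<lambda>t. t * exp (- (m * t\<^sup>2 / 2))) has_integral
      - exp (- (m * b\<^sup>2 / 2)) / m - (- exp (- (m * a\<^sup>2 / 2)) / m)) {a..b}"
  proof (rule fundamental_theorem_of_calculus[OF ab])
    fix t
    have "((\<lambda>t. - exp (- (m * t\<^sup>2 / 2)) / m) has_real_derivative t * exp (- (m * t\<^sup>2 / 2))) (at t within {a..b})"
      using m by (auto intro!: derivative_eq_intros)
    then show "((\<lambda>t. - exp (- (m * t\<^sup>2 / 2)) / m) has_vector_derivative t * exp (- (m * t\<^sup>2 / 2))) (at t within {a..b})"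
      by (simp add: has_real_derivative_iff_has_vector_derivative)
  qed
  then show ?thesis by (simp add: diff_divide_distrib)
qed

lemma exp_square_cube_integral:
  fixes m b :: real
  assumes m: "0 < m" and b: "0 \<le> b"
  shows "((\<lambda>t. t ^ 3 * exp (- (m * t\<^sup>2 / 2))) has_integral
    2 / m\<^sup>2 - (b\<^sup>2 / m + 2 / m\<^sup>2) * exp (- (m * b\<^sup>2 / 2))) {0..b}"
proof -
  have "((\<lambda>t. t ^ 3 * exp (- (m * t\<^sup>2 / 2))) has_integral
      - ((b\<^sup>2 / m + 2 / m\<^sup>2) * exp (- (m * b\<^sup>2 / 2))) - - ((0\<^sup>2 / m + 2 / m\<^sup>2) * exp (- (m * 0\<^sup>2 / 2)))) {0..b}"
  proof (rule fundamental_theorem_of_calculus[OF b])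
    fix t
    have "((\<lambda>t. - ((t\<^sup>2 / m + 2 / m\<^sup>2) * exp (- (m * t\<^sup>2 / 2)))) has_real_derivative
        - (2 * t / m * exp (- (m * t\<^sup>2 / 2)) + exp (- (m * t\<^sup>2 / 2)) * (- (m * t)) * (t\<^sup>2 / m + 2 / m\<^sup>2))) (at t within {0..b})"
      using m by (auto intro!: derivative_eq_intros)
    also have "- (2 * t / m * exp (- (m * t\<^sup>2 / 2)) + exp (- (m * t\<^sup>2 / 2)) * (- (m * t)) * (t\<^sup>2 / m + 2 / m\<^sup>2))
        = t ^ 3 * exp (- (m * t\<^sup>2 / 2))"
      using m by (simp add: field_simps power2_eq_square power3_eq_cube)
    finally show "((\<lambda>t. - ((t\<^sup>2 / m + 2 / m\<^sup>2) * exp (- (m * t\<^sup>2 / 2)))) has_vector_derivative t ^ 3 * exp (- (m * t\<^sup>2 / 2))) (at t within {0..b})"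
      by (simp add: has_real_derivative_iff_has_vector_derivative)
  qed
  then show ?thesis by simp
qed

text \<open>On this range \<open>t \<ge> 3/2\<close>, hence \<open>1 / t \<le> 4/9 * t\<close>, and
  the majorant has an explicit antiderivative. For \<open>n \<ge> 6\<close> its value is below
  \<open>4/9 * exp (- 6) / n\<close>.\<close>

lemma gauss_kernel_tail:
  assumes n: "6 \<le> n" and T: "pi / 2 \<le> T"
  shows "\<bar>integral {pi / 2..T} (gauss_kernel n y)\<bar> \<le> 0.002 / n"
proof -
  have "norm (integral {pi / 2..T} (gauss_kernel n y)) \<le> integral {pi / 2..T} (\<lambda>t. 4 / 9 * (t * exp (- (n * t\<^sup>2 / 2))))"
  proof (rule integral_norm_bound_integral)
    show "gauss_kernel n y integrable_on {pi / 2..T}" using n by (intro gauss_kernel_integrable) auto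
    show "(\<lambda>t. 4 / 9 * (t * exp (- (n * t\<^sup>2 / 2)))) integrable_on {pi / 2..T}"
      unfolding integrable_on_def
      by (rule exI, rule has_integral_mult_right[OF exp_square_integral]) (use n T in auto)
    fix t assume t: "t \<in> {pi / 2..T}"
    then have t0: "3 / 2 \<le> t" using pi_gt3 by auto
    have "\<bar>sin (y * t) / t\<bar> \<le> 1 / t" using t0 by (simp add: abs_mult divide_right_mono)
    also have "\<dots> \<le> 4 / 9 * t"
    proof -
      have "(3 / 2)\<^sup>2 \<le> t\<^sup>2" using t0 by (intro power_mono) auto
      then show ?thesis using t0 by (simp add: field_simps power2_eq_square)
    qed
    finally have "\<bar>sin (y * t) / t\<bar> * exp (- (n * t\<^sup>2 / 2)) \<le> 4 / 9 * t * exp (- (n * t\<^sup>2 / 2))"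
      by (intro mult_right_mono) auto
    then show "norm (gauss_kernel n y t) \<le> 4 / 9 * (t * exp (- (n * t\<^sup>2 / 2)))"
      by (simp add: gauss_kernel_def abs_mult)
  qed
  also have "\<dots> = 4 / 9 * ((exp (- (n * (pi / 2)\<^sup>2 / 2)) - exp (- (n * T\<^sup>2 / 2))) / n)"
    using exp_square_integral[of n "pi / 2" T] n T by (intro integral_unique has_integral_mult_right) auto
  also have "\<dots> \<le> 4 / 9 * (0.0045 / n)"
  proof -
    have "(3 / 2)\<^sup>2 \<le> (pi / 2)\<^sup>2" using pi_gt3 by (intro power_mono) auto
    then have "6 * (3 / 2)\<^sup>2 \<le> n * (pi / 2)\<^sup>2" using n by (intro mult_mono) auto
    then have "exp (- (n * (pi / 2)\<^sup>2 / 2)) \<le> exp (- 6)" by (simp add: power2_eq_square)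
    also have "exp (- 6) \<le> (0.0045 :: real)"
    proof -
      have "2.5 ^ 6 \<le> exp (1 :: real) ^ 6"
        using e_approx_32 by (intro power_mono) (auto simp: abs_if split: if_splits)
      also have "\<dots> = exp 6" by (simp add: exp_of_nat_mult[symmetric])
      finally have "2.5 ^ 6 \<le> exp (6 :: real)" .
      then show ?thesis by (simp add: exp_minus field_simps)
    qed
    finally have "exp (- (n * (pi / 2)\<^sup>2 / 2)) - exp (- (n * T\<^sup>2 / 2)) \<le> 0.0045"
      using exp_gt_zero[of "- (n * T\<^sup>2 / 2)"] by linarith
    then show ?thesis using n by (intro mult_left_mono divide_right_mono) auto
  qed
  also have "\<dots> = 0.002 / n" by simp
  finally show ?thesis by simp
qed

lemma kernel_integral_difference:
  assumes n: "6 \<le> n" and par: "odd (n + y)"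
  shows "\<bar>pi / 2 * walk n (\<lambda>s. if \<bar>s\<bar> < real y then 1 else 0) 0 - integral {0..pi / 2} (gauss_kernel (real n) (real y))\<bar>
    \<le> 0.2855 / real n + 0.174 * real n / (real n - 1)\<^sup>2"
proof -
  let ?A = "\<lambda>t. cos t ^ n * dirichlet_kernel y t"
  let ?G = "gauss_kernel (real n) (real y)"
  let ?B = "\<lambda>t. 0.2855 * (t * exp (- (real n * t\<^sup>2 / 2))) + 0.087 * real n * (t ^ 3 * exp (- ((real n - 1) * t\<^sup>2 / 2)))"
  have m: "0 < real n - 1" using n by simp
  define I1 where "I1 = (exp (- (real n * 0\<^sup>2 / 2)) - exp (- (real n * (pi / 2)\<^sup>2 / 2))) / real n"
  define I2 where "I2 = 2 / (real n - 1)\<^sup>2 - ((pi / 2)\<^sup>2 / (real n - 1) + 2 / (real n - 1)\<^sup>2) * exp (- ((real n - 1) * (pi / 2)\<^sup>2 / 2))"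
  have B: "(?B has_integral 0.2855 * I1 + 0.087 * real n * I2) {0..pi / 2}"
    unfolding I1_def I2_def using n m
    by (intro has_integral_add has_integral_mult_right exp_square_integral exp_square_cube_integral) auto
  have I1: "I1 \<le> 1 / real n" unfolding I1_def using n by (intro divide_right_mono) auto
  have I2: "I2 \<le> 2 / (real n - 1)\<^sup>2" unfolding I2_def using m by simp
  have A: "(?A has_integral pi / 2 * walk n (\<lambda>s. if \<bar>s\<bar> < real y then 1 else 0) 0) {0..pi / 2}"
    by (rule walk_indicator_has_integral[OF par])
  have G: "(?G has_integral integral {0..pi / 2} ?G) {0..pi / 2}"
    by (intro integrable_integral gauss_kernel_integrable) simp
  \<comment> \<open>The pointwise estimate requires \<open>t > 0\<close>: at 0 the lattice integrand
    is \<open>y\<close>, while the Gaussian kernel is 0 by convention. The end point is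
    negligible.\<close>
  have AG: "((\<lambda>t. ?A t - ?G t) has_integral pi / 2 * walk n (\<lambda>s. if \<bar>s\<bar> < real y then 1 else 0) 0 - integral {0..pi / 2} ?G) {0<..pi / 2}"
    using has_integral_diff[OF A G] by (subst has_integral_spike_set_eq[where T = "{0..pi / 2}"]) (auto intro: negligible_subset[of "{0}"])
  have B': "(?B has_integral 0.2855 * I1 + 0.087 * real n * I2) {0<..pi / 2}"
    using B by (subst has_integral_spike_set_eq[where T = "{0..pi / 2}"]) (auto intro: negligible_subset[of "{0}"])
  have "norm (integral {0<..pi / 2} (\<lambda>t. ?A t - ?G t)) \<le> integral {0<..pi / 2} ?B"
  proof (rule integral_norm_bound_integral)
    show "(\<lambda>t. ?A t - ?G t) integrable_on {0<..pi / 2}" "?B integrable_on {0<..pi / 2}"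
      using AG B' by (auto simp: integrable_on_def)
    fix t assume "t \<in> {0<..pi / 2}"
    then have "\<bar>?A t - ?G t\<bar> \<le> 0.2855 * t * exp (- (real n * t\<^sup>2 / 2)) + 0.087 * real n * t ^ 3 * exp (- (real (n - 1) * t\<^sup>2 / 2))"
      unfolding gauss_kernel_def using n by (intro kernel_difference_bound) auto
    also have "\<dots> = ?B t" using n by (simp add: of_nat_diff mult.assoc)
    finally show "norm (?A t - ?G t) \<le> ?B t" by simp
  qed
  also have "\<dots> = 0.2855 * I1 + 0.087 * real n * I2" by (rule integral_unique[OF B'])
  also have "\<dots> \<le> 0.2855 * (1 / real n) + 0.087 * real n * (2 / (real n - 1)\<^sup>2)"
    using I1 I2 by (intro add_mono mult_left_mono) auto
  also have "\<dots> = 0.2855 / real n + 0.174 * real n / (real n - 1)\<^sup>2" by simp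
  finally show ?thesis unfolding integral_unique[OF AG] by simp
qed

text \<open>As \<open>n + y\<close> is odd, \<open>y\<close> lies midway between the lattice points
  \<open>y - 1\<close> and \<open>y + 1\<close>. This continuity correction removes the term of
  order \<open>n^(-1/2)\<close> and leaves order \<open>1 / n\<close>.\<close>

lemma walk_gauss_midpoint:
  assumes n: "6 \<le> n" and par: "odd (n + y)"
  shows "\<bar>walk n (\<lambda>s. if \<bar>s\<bar> < real y then 1 else 0) 0 - measure std_normal_distribution {- (real y / sqrt (real n))..real y / sqrt (real n)}\<bar>
    \<le> 0.3475 / real n"
proof -
  let ?W = "walk n (\<lambda>s. if \<bar>s\<bar> < real y then 1 else 0) 0"
  let ?G = "gauss_kernel (real n) (real y)"
  let ?a = "real y / sqrt (real n)"
  let ?E = "0.2855 / real n + 0.174 * real n / (real n - 1)\<^sup>2 + 0.002 / real n"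
  have n0: "0 < real n" using n by simp
  have "\<forall>\<^sub>F T in sequentially. pi / 2 * sqrt (real n) \<le> real T"
    using filterlim_real_sequentially unfolding filterlim_at_top by blast
  then have ev: "\<forall>\<^sub>F T in sequentially. \<bar>2 / pi * integral {0..real T} (gauss_kernel 1 ?a) - ?W\<bar> \<le> 2 / pi * ?E"
  proof eventually_elim
    case (elim T)
    then have T: "pi / 2 \<le> real T / sqrt (real n)" using n0 by (simp add: field_simps)
    have "integral {0..real T} (gauss_kernel 1 ?a) = integral {0..real T / sqrt (real n)} ?G"
      by (rule gauss_kernel_scale[OF n0])
    also have "\<dots> = integral {0..pi / 2} ?G + integral {pi / 2..real T / sqrt (real n)} ?G"
      using T n0 by (intro Henstock_Kurzweil_Integration.integral_combine[symmetric] gauss_kernel_integrable) auto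
    finally have split: "integral {0..real T} (gauss_kernel 1 ?a)
        = integral {0..pi / 2} ?G + integral {pi / 2..real T / sqrt (real n)} ?G" .
    have "\<bar>integral {0..real T} (gauss_kernel 1 ?a) - pi / 2 * ?W\<bar> \<le> ?E"
    proof -
      have tail: "\<bar>integral {pi / 2..real T / sqrt (real n)} ?G\<bar> \<le> 0.002 / real n"
        using n T by (intro gauss_kernel_tail) auto
      have "\<bar>x + w - v\<bar> \<le> e + e'" if "\<bar>v - x\<bar> \<le> e" "\<bar>w\<bar> \<le> e'" for x w v e e' :: real
        using that by linarith
      from this[OF kernel_integral_difference[OF n par] tail] show ?thesis unfolding split .
    qed
    then have "2 / pi * \<bar>integral {0..real T} (gauss_kernel 1 ?a) - pi / 2 * ?W\<bar> \<le> 2 / pi * ?E"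
      by (intro mult_left_mono) auto
    moreover have "2 / pi * \<bar>integral {0..real T} (gauss_kernel 1 ?a) - pi / 2 * ?W\<bar>
        = \<bar>2 / pi * integral {0..real T} (gauss_kernel 1 ?a) - ?W\<bar>"
    proof -
      have "2 / pi * \<bar>x - pi / 2 * w\<bar> = \<bar>2 / pi * (x - pi / 2 * w)\<bar>" for x w :: real
        by (simp only: abs_mult) simp
      moreover have "2 / pi * (x - pi / 2 * w) = 2 / pi * x - w" for x w :: real
        by (simp add: field_simps)
      ultimately show ?thesis by (simp only:)
    qed
    ultimately show ?case by (simp only:)
  qed
  have "(\<lambda>T. \<bar>2 / pi * integral {0..real T} (gauss_kernel 1 ?a) - ?W\<bar>) \<longlonglongrightarrow> \<bar>measure std_normal_distribution {- ?a..?a} - ?W\<bar>"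
    by (intro tendsto_intros gauss_kernel_inversion) simp
  then have "\<bar>measure std_normal_distribution {- ?a..?a} - ?W\<bar> \<le> 2 / pi * ?E"
    using ev by (rule tendsto_upperbound) simp
  also have "\<dots> \<le> 2 / 3.1 * (0.5381 / real n)"
  proof (intro mult_mono divide_left_mono)
    \<comment> \<open>From \<open>n \<ge> 6\<close> follows \<open>n / (n - 1) \<le> 6/5\<close>;
      the factor 1.44 is its square.\<close>
    have "25 * (real n)\<^sup>2 \<le> 36 * (real n - 1)\<^sup>2"
    proof -
      have "(5 * real n)\<^sup>2 \<le> (6 * (real n - 1))\<^sup>2" using n by (intro power_mono) auto
      then show ?thesis unfolding power_mult_distrib by simp
    qed
    then have "real n / (real n - 1)\<^sup>2 \<le> 1.44 / real n"
      using n by (simp add: divide_simps power2_eq_square)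
    then have "0.174 * real n / (real n - 1)\<^sup>2 \<le> 0.174 * (1.44 / real n)"
      by (simp only: times_divide_eq_right[symmetric]) simp
    moreover have "0.2855 / x + 0.174 * (1.44 / x) + 0.002 / x \<le> 0.5381 / x" if "0 < x" for x :: real
      using that by (simp add: divide_simps)
    from this[OF n0] have "0.2855 / real n + 0.174 * (1.44 / real n) + 0.002 / real n \<le> 0.5381 / real n" .
    ultimately show "?E \<le> 0.5381 / real n" by linarith
  qed (use pi_bounds n in auto)
  also have "\<dots> \<le> 0.3475 / real n" using n0 by (simp add: divide_simps)
  finally show ?thesis by (simp add: abs_minus_commute)
qed

section \<open>Numerical bounds on normal probabilities\<close>

lemma inverse_sqrt_2_pi: "0.397 \<le> 1 / sqrt (2 * pi)" "1 / sqrt (2 * pi) \<le> 0.4017"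
proof -
  have "1 / 0.4017 \<le> sqrt (2 * pi)"
    using pi_bounds by (intro real_le_rsqrt) (simp add: power2_eq_square)
  then show "1 / sqrt (2 * pi) \<le> 0.4017" by (simp add: field_simps)
  have "sqrt (2 * pi) \<le> 1 / 0.397"
    using pi_bounds by (intro real_le_lsqrt) (auto simp: power2_eq_square)
  then show "0.397 \<le> 1 / sqrt (2 * pi)" by (simp add: field_simps)
qed

lemma std_normal_density_le: "std_normal_density x \<le> 0.4017"
proof -
  have "std_normal_density x \<le> 1 / sqrt (2 * pi) * 1"
    unfolding std_normal_density_def by (intro mult_left_mono) auto
  then show ?thesis using inverse_sqrt_2_pi by simp
qed

lemma std_normal_density_ge:
  assumes "\<bar>x\<bar> \<le> b" and "0 \<le> 1 - b\<^sup>2 / 2 + (b\<^sup>2 / 2)\<^sup>2 / 2 - (b\<^sup>2 / 2) ^ 3 / 6"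
  shows "0.397 * (1 - b\<^sup>2 / 2 + (b\<^sup>2 / 2)\<^sup>2 / 2 - (b\<^sup>2 / 2) ^ 3 / 6) \<le> std_normal_density x"
proof -
  have "x\<^sup>2 \<le> b\<^sup>2" using assms(1) by (metis abs_ge_zero power2_abs power_mono)
  then have "exp (- (b\<^sup>2 / 2)) \<le> exp (- x\<^sup>2 / 2)" by simp
  with exp_minus_bounds(2)[of "b\<^sup>2 / 2"] have "1 - b\<^sup>2 / 2 + (b\<^sup>2 / 2)\<^sup>2 / 2 - (b\<^sup>2 / 2) ^ 3 / 6 \<le> exp (- x\<^sup>2 / 2)"
    using zero_le_power2[of b] by linarith
  then show ?thesis
    unfolding std_normal_density_def using inverse_sqrt_2_pi assms(2) by (intro mult_mono) auto
qed

lemma measure_std_normal_le: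
  assumes A: "A \<in> sets borel" and l: "emeasure lborel A \<le> ennreal l" "0 \<le> l"
  shows "measure std_normal_distribution A \<le> 0.4017 * l"
proof -
  interpret prob_space std_normal_distribution by (rule prob_space_std_normal)
  have "emeasure std_normal_distribution A = (\<integral>\<^sup>+t. ennreal (std_normal_density t) * indicator A t \<partial>lborel)"
    using A by (subst emeasure_density) auto
  also have "\<dots> \<le> (\<integral>\<^sup>+t. ennreal 0.4017 * indicator A t \<partial>lborel)"
    by (intro nn_integral_mono mult_right_mono ennreal_leI std_normal_density_le) auto
  also have "\<dots> = ennreal 0.4017 * emeasure lborel A"
    using A by (intro nn_integral_cmult_indicator) auto
  also have "\<dots> \<le> ennreal 0.4017 * ennreal l" by (intro mult_left_mono l) auto
  also have "\<dots> = ennreal (0.4017 * l)" using l by (intro ennreal_mult[symmetric]) auto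
  finally show ?thesis using l by (simp add: emeasure_eq_measure)
qed

lemma measure_std_normal_ge:
  assumes ab: "a \<le> b" and c: "0 \<le> c" "\<And>x. a \<le> x \<Longrightarrow> x \<le> b \<Longrightarrow> c \<le> std_normal_density x"
  shows "c * (b - a) \<le> measure std_normal_distribution {a<..b}" "c * (b - a) \<le> measure std_normal_distribution {a..<b}"
proof -
  interpret prob_space std_normal_distribution by (rule prob_space_std_normal)
  have key: "c * (b - a) \<le> measure std_normal_distribution A" if "A \<in> sets borel" "A \<subseteq> {a..b}" "emeasure lborel A = ennreal (b - a)" for A
  proof -
    have "ennreal (c * (b - a)) = ennreal c * emeasure lborel A"
      unfolding that(3) using c ab by (intro ennreal_mult) auto
    also have "\<dots> = (\<integral>\<^sup>+t. ennreal c * indicator A t \<partial>lborel)"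
      using that by (intro nn_integral_cmult_indicator[symmetric]) auto
    also have "\<dots> \<le> (\<integral>\<^sup>+t. ennreal (std_normal_density t) * indicator A t \<partial>lborel)"
      using that(2) c(2) by (intro nn_integral_mono) (auto simp: indicator_def intro!: ennreal_leI)
    also have "\<dots> = emeasure std_normal_distribution A"
      using that by (subst emeasure_density) auto
    finally show ?thesis by (simp add: emeasure_eq_measure)
  qed
  show "c * (b - a) \<le> measure std_normal_distribution {a<..b}" "c * (b - a) \<le> measure std_normal_distribution {a..<b}"
    using ab by (intro key; auto)+
qed

lemma measure_std_normal_split:
  assumes "0 \<le> u" "u \<le> v"
  shows "measure std_normal_distribution {- v..v} = measure std_normal_distribution {- u..u} + measure std_normal_distribution {- v..<- u} + measure std_normal_distribution {u<..v}"
proof -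
  interpret prob_space std_normal_distribution by (rule prob_space_std_normal)
  have "{- v..v} = {- u..u} \<union> {- v..<- u} \<union> {u<..v}" using assms by auto
  then show ?thesis
    using assms by (simp add: finite_measure_Union Int_Un_distrib2 disjoint_iff)
qed

lemma measure_std_normal_increment:
  assumes "0 \<le> u" "u \<le> v"
  shows "measure std_normal_distribution {- u..u} \<le> measure std_normal_distribution {- v..v}"
    and "measure std_normal_distribution {- v..v} \<le> measure std_normal_distribution {- u..u} + 0.8034 * (v - u)"
proof -
  show "measure std_normal_distribution {- u..u} \<le> measure std_normal_distribution {- v..v}"
    unfolding measure_std_normal_split[OF assms] by simp
  have "measure std_normal_distribution {- v..<- u} \<le> 0.4017 * (v - u)" "measure std_normal_distribution {u<..v} \<le> 0.4017 * (v - u)"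
    using assms by (intro measure_std_normal_le; simp)+
  then show "measure std_normal_distribution {- v..v} \<le> measure std_normal_distribution {- u..u} + 0.8034 * (v - u)"
    unfolding measure_std_normal_split[OF assms] by simp
qed

lemma measure_std_normal_zero: "measure std_normal_distribution {- 0..0} = 0"
  using std_normal_singleton[of 0] by simp

lemma measure_std_normal_lower:
  assumes "0 \<le> u" "u \<le> v" "\<And>x. \<bar>x\<bar> \<le> v \<Longrightarrow> c \<le> std_normal_density x" "0 \<le> c"
  shows "measure std_normal_distribution {- u..u} + 2 * c * (v - u) \<le> measure std_normal_distribution {- v..v}"
proof -
  have "c * (- u - - v) \<le> measure std_normal_distribution {- v..<- u}" "c * (v - u) \<le> measure std_normal_distribution {u<..v}"
    by (rule measure_std_normal_ge(2), use assms in auto)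
       (rule measure_std_normal_ge(1), use assms in auto)
  then show ?thesis unfolding measure_std_normal_split[OF assms(1,2)] by (simp add: algebra_simps)
qed

text \<open>Lower Riemann sums with at most two rectangles on each side; they serve the small values
  of \<open>n\<close>.\<close>

lemma measure_std_normal_values:
  "0.28 \<le> measure std_normal_distribution {- 0.4..0.4}" "0.35 \<le> measure std_normal_distribution {- 0.5..0.5}"
  "0.58 \<le> measure std_normal_distribution {- 1..1}"
proof -
  have half: "0.35 \<le> std_normal_density x" if "\<bar>x\<bar> \<le> 0.5" for x
    using std_normal_density_ge[OF that] by (simp add: power2_eq_square power3_eq_cube)
  have one: "0.239 \<le> std_normal_density x" if "\<bar>x\<bar> \<le> 1" for x
    using std_normal_density_ge[OF that] by (simp add: power2_eq_square power3_eq_cube)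
  show "0.28 \<le> measure std_normal_distribution {- 0.4..0.4}"
    using measure_std_normal_lower[of 0 "0.4" "0.35"] half measure_std_normal_zero by simp
  show h: "0.35 \<le> measure std_normal_distribution {- 0.5..0.5}"
    using measure_std_normal_lower[of 0 "0.5" "0.35"] half measure_std_normal_zero by simp
  show "0.58 \<le> measure std_normal_distribution {- 1..1}"
    using measure_std_normal_lower[of "0.5" 1 "0.239"] one h by simp
qed

section \<open>The distance for two treatments\<close>

lemma chi_square_1_cdf:
  assumes "0 \<le> z"
  shows "measure (chi_square 1) {..z} = measure std_normal_distribution {- sqrt z..sqrt z}"
proof -
  have "x\<^sup>2 \<le> z \<longleftrightarrow> \<bar>x\<bar> \<le> sqrt z" for x
    using real_sqrt_le_iff[of "x\<^sup>2" z] by (simp only: real_sqrt_abs)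
  then have "(\<lambda>x::real. x\<^sup>2) -` {..z} = {- sqrt z..sqrt z}"
    by (auto simp: abs_le_iff)
  then show ?thesis unfolding chi_square_1 by (subst measure_distr) auto
qed

text \<open>Moving the threshold to the nearest suitable midpoint shifts \<open>u\<close> by at most
  \<open>1 / sqrt n\<close> and costs \<open>2 * 0.4017 / sqrt n\<close>, as 0.4017 bounds the
  normal density. The remaining \<open>0.1462 / sqrt n\<close> of the constant 0.9496 pays for the
  estimate at the midpoint.\<close>

lemma walk_distance_large:
  assumes n: "6 \<le> n" and u: "0 \<le> u"
  shows "\<bar>walk n (\<lambda>s. if \<bar>s\<bar> \<le> sqrt (real n) * u then 1 else 0) 0 - measure std_normal_distribution {- u..u}\<bar>
    \<le> 0.9496 / sqrt (real n)"
proof -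
  define a where "a = sqrt (real n) * u"
  have sn: "0 < sqrt (real n)" using n by simp
  have a: "0 \<le> a" "u = a / sqrt (real n)" using u sn by (auto simp: a_def)
  define m where "m = nat \<lfloor>a\<rfloor>"
  have m: "real m \<le> a" "a < real m + 1" using a(1) by (auto simp: m_def)
  \<comment> \<open>\<open>y\<close> is the choice among \<open>m\<close> and \<open>m + 1\<close>
    that the walk cannot hit. On reachable points, \<open>\<bar>s\<bar> \<le> a\<close> and
    \<open>\<bar>s\<bar> < y\<close> then coincide, and \<open>y\<close> is within 1 of
    \<open>a\<close>.\<close>
  define y where "y = (if even (n + m) then m + 1 else m)"
  have par: "odd (n + y)" by (simp add: y_def)
  have ya: "real y - 1 \<le> a" "a \<le> real y + 1" using m by (auto simp: y_def)
  have W: "walk n (\<lambda>s. if \<bar>s\<bar> \<le> a then 1 else 0) (of_int 0) = walk n (\<lambda>s. if \<bar>s\<bar> < real y then 1 else 0 :: real) (of_int 0)"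
  proof (rule walk_cong_parity)
    fix k :: int assume k: "even (k + 0 + int n)"
    have "\<bar>real_of_int k\<bar> \<le> a \<longleftrightarrow> \<bar>k\<bar> \<le> int m"
    proof -
      have "\<bar>k\<bar> \<le> int m \<longleftrightarrow> real_of_int \<bar>k\<bar> \<le> real m" by (metis of_int_le_iff of_int_of_nat_eq)
      moreover have "real_of_int \<bar>k\<bar> \<le> a \<Longrightarrow> \<bar>k\<bar> \<le> int m"
      proof -
        assume "real_of_int \<bar>k\<bar> \<le> a"
        then have "real_of_int \<bar>k\<bar> < of_int (int m + 1)" using m by simp
        then show "\<bar>k\<bar> \<le> int m" by linarith
      qed
      ultimately show ?thesis using m by auto
    qed
    also have "\<bar>k\<bar> \<le> int m \<longleftrightarrow> \<bar>k\<bar> < int y"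
    proof (cases "even (n + m)")
      case True
      then show ?thesis by (auto simp: y_def)
    next
      case False
      have "\<bar>k\<bar> \<noteq> int m"
      proof
        assume "\<bar>k\<bar> = int m"
        then have "even k \<longleftrightarrow> even (int m)" by (metis dvd_abs_iff)
        then have "even (int m + int n)" using k by simp
        then show False using False by (simp flip: of_nat_add add: add.commute)
      qed
      then show ?thesis using False by (auto simp: y_def)
    qed
    also have "\<dots> \<longleftrightarrow> \<bar>real_of_int k\<bar> < real y"
      by (metis of_int_abs of_int_less_iff of_int_of_nat_eq)
    finally show "(if \<bar>real_of_int k\<bar> \<le> a then 1 else 0) = (if \<bar>real_of_int k\<bar> < real y then 1 else 0 :: real)"
      by simp
  qed
  let ?v = "real y / sqrt (real n)"
  have "\<bar>measure std_normal_distribution {- u..u} - measure std_normal_distribution {- v..v}\<bar> \<le> 0.8034 * \<bar>u - v\<bar>" if "0 \<le> v" for v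
  proof (cases "u \<le> v")
    case True
    then have "\<bar>u - v\<bar> = v - u" by simp
    then show ?thesis using measure_std_normal_increment[OF u True] by (simp only: abs_le_iff) linarith
  next
    case False
    then have uv: "v \<le> u" "\<bar>u - v\<bar> = u - v" by auto
    then show ?thesis using measure_std_normal_increment[OF that uv(1)] by (simp only: abs_le_iff) linarith
  qed
  from this[of ?v] have "\<bar>measure std_normal_distribution {- u..u} - measure std_normal_distribution {- ?v..?v}\<bar> \<le> 0.8034 * \<bar>u - ?v\<bar>"
    by simp
  also have "\<bar>u - ?v\<bar> \<le> 1 / sqrt (real n)"
  proof -
    have "u - ?v = (a - real y) / sqrt (real n)" by (simp add: a(2) diff_divide_distrib)
    then have "\<bar>u - ?v\<bar> = \<bar>a - real y\<bar> / sqrt (real n)" using sn by (simp add: abs_divide)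
    also have "\<dots> \<le> 1 / sqrt (real n)" using ya sn by (intro divide_right_mono) auto
    finally show ?thesis .
  qed
  finally have G: "\<bar>measure std_normal_distribution {- u..u} - measure std_normal_distribution {- ?v..?v}\<bar> \<le> 0.8034 * (1 / sqrt (real n))"
    by simp
  have M: "\<bar>walk n (\<lambda>s. if \<bar>s\<bar> \<le> a then 1 else 0) 0 - measure std_normal_distribution {- ?v..?v}\<bar> \<le> 0.3475 / real n"
    using walk_gauss_midpoint[OF n par] W by simp
  \<comment> \<open>Here \<open>n \<ge> 6\<close> enters numerically:
    \<open>0.3475 / 2.449 < 0.1462\<close>.\<close>
  have "0.3475 / real n \<le> 0.1462 * (1 / sqrt (real n))"
  proof -
    have "2.449 \<le> sqrt (real n)" using n by (intro real_le_rsqrt) (simp add: power2_eq_square)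
    then have "0.3475 \<le> 0.1462 * sqrt (real n)" by simp
    then have "0.3475 / real n \<le> 0.1462 * sqrt (real n) / real n" by (intro divide_right_mono) auto
    also have "\<dots> = 0.1462 * (1 / sqrt (real n))"
      using n by (simp add: field_simps)
    finally show ?thesis .
  qed
  from order_trans[OF M this]
  have "\<bar>walk n (\<lambda>s. if \<bar>s\<bar> \<le> a then 1 else 0) 0 - measure std_normal_distribution {- ?v..?v}\<bar> \<le> 0.1462 * (1 / sqrt (real n))" .
  moreover have "\<bar>w - g\<bar> \<le> e + f" if "\<bar>g - v\<bar> \<le> f" "\<bar>w - v\<bar> \<le> e" for w g v e f :: real
    using that by linarith
  ultimately have "\<bar>walk n (\<lambda>s. if \<bar>s\<bar> \<le> a then 1 else 0) 0 - measure std_normal_distribution {- u..u}\<bar>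
      \<le> 0.1462 * (1 / sqrt (real n)) + 0.8034 * (1 / sqrt (real n))"
    using G by blast
  also have "\<dots> = (0.1462 + 0.8034) * (1 / sqrt (real n))" by (simp only: distrib_right)
  also have "\<dots> = 0.9496 / sqrt (real n)" by simp
  finally show ?thesis unfolding a_def .
qed

text \<open>The constants of the Fourier estimate rely on \<open>n \<ge> 6\<close>. For fewer steps
  the walk probability is computed on each range of the threshold between reachable points, and
  crude bounds on the normal probability suffice.\<close>

lemma walk_distance_small:
  assumes n: "1 \<le> n" "n \<le> 5" and u: "0 \<le> u"
  shows "\<bar>walk n (\<lambda>s. if \<bar>s\<bar> \<le> sqrt (real n) * u then 1 else 0) 0 - measure std_normal_distribution {- u..u}\<bar>
    \<le> 0.9496 / sqrt (real n)"
proof -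
  define g where "g = measure std_normal_distribution {- u..u}"
  let ?a = "sqrt (real n) * u"
  have G01: "0 \<le> g" "g \<le> 1"
    unfolding g_def by (rule measure_nonneg, rule prob_space.prob_le_1[OF prob_space_std_normal])
  have G_le: "g \<le> 0.8034 * u"
    using measure_std_normal_increment(2)[of 0 u] measure_std_normal_zero u by (simp add: g_def)
  have G_04: "0.28 \<le> g" if "0.4 \<le> u"
    using measure_std_normal_increment(1)[of "0.4" u] measure_std_normal_values that by (simp add: g_def)
  have G_05: "0.35 \<le> g" if "0.5 \<le> u"
    using measure_std_normal_increment(1)[of "0.5" u] measure_std_normal_values that by (simp add: g_def)
  have G_1: "0.58 \<le> g" if "1 \<le> u"
    using measure_std_normal_increment(1)[of 1 u] measure_std_normal_values that by (simp add: g_def)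
  have s: "sqrt 2 \<le> 1.4143" "sqrt 3 \<le> 1.7321" "sqrt 5 \<le> 2.2361"
    by (rule real_le_lsqrt; simp add: power2_eq_square)+
  have s4: "sqrt 4 = 2" using real_sqrt_abs[of 2] by simp
  have s_pos: "1 \<le> sqrt 2" "1 \<le> sqrt 3" "1 \<le> sqrt 5" by simp_all
  \<comment> \<open>For odd \<open>n\<close> the walk cannot end in the open interval from -1 to 1,
    so for such a threshold the distance is \<open>g\<close> itself.\<close>
  have small: "g \<le> 0.9496 / sqrt (real n)" if "?a < 1"
  proof -
    have "u \<le> 1 / sqrt (real n)" using that n by (simp add: field_simps)
    then have "0.8034 * u \<le> 0.8034 * (1 / sqrt (real n))" by (intro mult_left_mono) auto
    also have "\<dots> = 0.8034 / sqrt (real n)" by simp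
    also have "\<dots> \<le> 0.9496 / sqrt (real n)" by (rule divide_right_mono) auto
    finally show ?thesis using G_le by simp
  qed
  have cases: "n = 1 \<or> n = 2 \<or> n = 3 \<or> n = 4 \<or> n = 5" using n by linarith
  have bounds: "0.67 \<le> 0.9496 / sqrt 2" "0.54 \<le> 0.9496 / sqrt 3" "0.42 \<le> 0.9496 / sqrt 5"
    using s s_pos by (simp_all add: field_simps)
  have a_lower: "u \<ge> c" if "t \<le> ?a" "sqrt (real n) \<le> b" "c * b \<le> t" "0 < b" for c b t
  proof -
    have "c * b \<le> b * u" using that u mult_right_mono[OF that(2) u] by linarith
    then show ?thesis using that(4) by simp
  qed
  have "\<bar>walk n (\<lambda>s. if \<bar>s\<bar> \<le> ?a then 1 else 0) 0 - g\<bar> \<le> 0.9496 / sqrt (real n)"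
    using cases
  proof (elim disjE)
    assume n1: "n = 1"
    show ?thesis
    proof (cases "?a < 1")
      case True
      then show ?thesis using small[OF True] G01 u n1 by simp
    next
      case False
      then have "1 \<le> u" using n1 by simp
      then show ?thesis using G_1 G01 n1 False by simp
    qed
  next
    assume n2: "n = 2"
    show ?thesis
    proof (cases "?a < 2")
      case True
      then have "\<bar>walk n (\<lambda>s. if \<bar>s\<bar> \<le> ?a then 1 else 0) 0 - g\<bar> \<le> 0.67"
        using G01 u n2 by (simp add: numeral_2_eq_2 abs_real_def)
      then show ?thesis using bounds n2 by simp
    next
      case False
      then have "1 \<le> u" using n2 s by (intro a_lower[of 2 "1.4143"]) auto
      then have "\<bar>walk n (\<lambda>s. if \<bar>s\<bar> \<le> ?a then 1 else 0) 0 - g\<bar> \<le> 0.67"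
        using G_1 G01 u n2 False by (simp add: numeral_2_eq_2 abs_real_def)
      then show ?thesis using bounds n2 by simp
    qed
  next
    assume n3: "n = 3"
    consider "?a < 1" | "1 \<le> ?a" "?a < 3" | "3 \<le> ?a" by linarith
    then show ?thesis
    proof cases
      case 1
      then show ?thesis using small[OF 1] G01 u n3 by (simp add: numeral_3_eq_3)
    next
      case 2
      then have "0.5 \<le> u" using n3 s by (intro a_lower[of 1 "1.7321"]) auto
      then have "\<bar>walk n (\<lambda>s. if \<bar>s\<bar> \<le> ?a then 1 else 0) 0 - g\<bar> \<le> 0.54"
        using G_05 G01 u n3 2 by (simp add: numeral_3_eq_3 abs_real_def)
      then show ?thesis using bounds n3 by simp
    next
      case 3
      then have "1 \<le> u" using n3 s by (intro a_lower[of 3 "1.7321"]) auto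
      then have "\<bar>walk n (\<lambda>s. if \<bar>s\<bar> \<le> ?a then 1 else 0) 0 - g\<bar> \<le> 0.54"
        using G_1 G01 u n3 3 by (simp add: numeral_3_eq_3 abs_real_def)
      then show ?thesis using bounds n3 by simp
    qed
  next
    assume n4: "n = 4"
    have e4: "(4::nat) = Suc (Suc (Suc (Suc 0)))" by simp
    consider "?a < 2" | "2 \<le> ?a" "?a < 4" | "4 \<le> ?a" by linarith
    then show ?thesis
    proof cases
      case 1
      then have "u \<le> 1" using n4 s4 by simp
      then have "g \<le> 0.8034" using G_le by simp
      then show ?thesis using G01 u n4 1 s4 by (simp add: e4 abs_real_def)
    next
      case 2
      then have "1 \<le> u" using n4 s4 by simp
      then show ?thesis using G_1 G01 u n4 2 s4 by (simp add: e4 abs_real_def)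
    next
      case 3
      then have "1 \<le> u" using n4 s4 by simp
      then show ?thesis using G_1 G01 u n4 3 s4 by (simp add: e4 abs_real_def)
    qed
  next
    assume n5: "n = 5"
    have e5: "(5::nat) = Suc (Suc (Suc (Suc (Suc 0))))" by simp
    consider "?a < 1" | "1 \<le> ?a" "?a < 3" | "3 \<le> ?a" "?a < 5" | "5 \<le> ?a" by linarith
    then show ?thesis
    proof cases
      case 1
      then show ?thesis using small[OF 1] G01 u n5 by (simp add: e5)
    next
      case 2
      then have "0.4 \<le> u" using n5 s by (intro a_lower[of 1 "2.2361"]) auto
      then have "\<bar>walk n (\<lambda>s. if \<bar>s\<bar> \<le> ?a then 1 else 0) 0 - g\<bar> \<le> 0.42"
        using G_04 G01 u n5 2 by (simp add: e5 abs_real_def)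
      then show ?thesis using bounds n5 by simp
    next
      case 3
      then have "1 \<le> u" using n5 s by (intro a_lower[of 3 "2.2361"]) auto
      then have "\<bar>walk n (\<lambda>s. if \<bar>s\<bar> \<le> ?a then 1 else 0) 0 - g\<bar> \<le> 0.42"
        using G_1 G01 u n5 3 by (simp add: e5 abs_real_def)
      then show ?thesis using bounds n5 by simp
    next
      case 4
      then have "1 \<le> u" using n5 s by (intro a_lower[of 5 "2.2361"]) auto
      then have "\<bar>walk n (\<lambda>s. if \<bar>s\<bar> \<le> ?a then 1 else 0) 0 - g\<bar> \<le> 0.42"
        using G_1 G01 u n5 4 by (simp add: e5 abs_real_def)
      then show ?thesis using bounds n5 by simp
    qed
  qed
  then show ?thesis by (simp only: g_def)
qed

section \<open>Assembly of the cases in the number of treatments\<close>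

lemma friedman_distance_2:
  assumes n: "1 \<le> n" and z: "0 \<le> z"
  shows "\<bar>family_avg 2 {1..n} (\<lambda>x. if friedman_F n 2 x \<le> z then 1 else 0)
    - measure (chi_square 1) {..z}\<bar> \<le> 0.9496 / sqrt (real n)"
  unfolding friedman_cdf_2[OF assms] chi_square_1_cdf[OF z] real_sqrt_mult
  using walk_distance_small[of n "sqrt z"] walk_distance_large[of n "sqrt z"] n z by (cases "n \<le> 5") auto

lemma friedman_distance_general:
  fixes n r :: nat and l N :: real
  assumes n: "1 \<le> n" and r: "3 \<le> r" and N: "15.34 \<le> N" "N ^ 4 = real n"
    and l: "\<And>x. chi_density (real (r - 1) / 2) x \<le> l / sqrt (real r - 1)"
  shows "\<bar>family_avg r {1..n} (\<lambda>x. if friedman_F n r x \<le> z then 1 else 0)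
    - measure (chi_square (r - 1)) {..z}\<bar> \<le> (16 * l + 6.1) / N"
proof -
  let ?d = "real r - 1"
  define \<alpha> where "\<alpha> = 16 / N * sqrt ?d"
  have d: "2 \<le> ?d" using r by simp
  have \<alpha>: "0 < \<alpha>" using d N by (simp add: \<alpha>_def)
  have "l / sqrt ?d * \<alpha> = 16 * l / N" using d by (simp add: \<alpha>_def)
  moreover have "16 * l / N + 6.1 / N = (16 * l + 6.1) / N" by (simp add: add_divide_distrib)
  ultimately show ?thesis
    using friedman_cdf_bound[OF n r \<alpha> l, of z] stein_constant_bound[OF d N(1) N(2)[symmetric] \<alpha>_def] by linarith
qed

lemma family_avg_if_bounds:
  assumes "finite I"
  shows "0 \<le> family_avg r I (\<lambda>x. if P x then 1 else 0)" "family_avg r I (\<lambda>x. if P x then 1 else 0) \<le> 1"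
proof -
  show "0 \<le> family_avg r I (\<lambda>x. if P x then 1 else 0)"
    by (rule order_trans[OF eq_refl[OF family_avg_const[OF assms, of r 0, symmetric]] family_avg_mono]) auto
  show "family_avg r I (\<lambda>x. if P x then 1 else 0) \<le> 1"
    by (rule order_trans[OF family_avg_mono eq_refl[OF family_avg_const[OF assms, of r 1]]]) auto
qed

lemma friedman_distance_trivial:
  "\<bar>family_avg r {1..n} (\<lambda>x. if P x then 1 else 0) - measure (chi_square p) A\<bar> \<le> 1"
proof -
  have "measure (chi_square p) A \<le> 1" by (rule prob_space.prob_le_1[OF prob_space_chi_square])
  moreover have "0 \<le> measure (chi_square p) A" by (rule measure_nonneg)
  ultimately show ?thesis
    using family_avg_if_bounds[of "{1..n}" r P, OF finite_atLeastAtMost] by (simp only: abs_le_iff) linarith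
qed

text \<open>With two degrees of freedom the density is at most 1/2, so \<open>l = 0.7072\<close>
  covers \<open>\<surd>2 / 2\<close>, and \<open>16 l + 6.1\<close> stays below 30. For
  \<open>n^(1/4) < 15.34\<close> the claim exceeds 1.\<close>

lemma friedman_distance_3:
  assumes n: "1 \<le> n"
  shows "\<bar>family_avg 3 {1..n} (\<lambda>x. if friedman_F n 3 x \<le> z then 1 else 0)
    - measure (chi_square (3 - 1)) {..z}\<bar> \<le> 30 / real n powr (1 / 4)"
proof -
  let ?N = "real n powr (1 / 4)"
  let ?P = "family_avg 3 {1..n} (\<lambda>x. if friedman_F n 3 x \<le> z then 1 else 0)"
  have N: "0 < ?N" "?N ^ 4 = real n" using n by (simp_all add: powr_realpow[symmetric] powr_powr)
  show ?thesis
  proof (cases "15.34 \<le> ?N")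
    case True
    have l: "chi_density (real (3 - 1) / 2) x \<le> 0.7072 / sqrt (real 3 - 1)" for x
    proof -
      have "sqrt 2 \<le> 1.4144" by (rule real_le_lsqrt) (simp_all add: power2_eq_square)
      then have "1 / 2 \<le> 0.7072 / sqrt 2" by (simp add: field_simps)
      from order_trans[OF chi_density_2_le[of x] this] show ?thesis by simp
    qed
    have "\<bar>?P - measure (chi_square (3 - 1)) {..z}\<bar> \<le> (16 * 0.7072 + 6.1) / ?N"
      by (rule friedman_distance_general[OF n _ True N(2) l]) simp
    also have "\<dots> \<le> 30 / ?N" using N by (intro divide_right_mono) auto
    finally show ?thesis .
  next
    case False
    then have "1 \<le> 30 / ?N" using N by simp
    then show ?thesis by (rule order_trans[OF friedman_distance_trivial])
  qed
qed

text \<open>The density bound \<open>0.61 / \<surd>(2 d)\<close> gives \<open>l = 0.4314\<close>,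
  and \<open>16 l + 6.1 = 13.0024\<close> lies below \<open>13 * r^(1/8)\<close>. For smaller
  \<open>n\<close> the claim is at least 1.\<close>

lemma friedman_distance_ge_4:
  assumes n: "1 \<le> n" and r: "4 \<le> r"
  shows "\<bar>family_avg r {1..n} (\<lambda>x. if friedman_F n r x \<le> z then 1 else 0)
    - measure (chi_square (r - 1)) {..z}\<bar> \<le> 13 * real r powr (1 / 8) / real n powr (1 / 4)"
proof -
  let ?N = "real n powr (1 / 4)"
  let ?P = "family_avg r {1..n} (\<lambda>x. if friedman_F n r x \<le> z then 1 else 0)"
  have N: "0 < ?N" "?N ^ 4 = real n" using n by (simp_all add: powr_realpow[symmetric] powr_powr)
  have root: "(q ^ 8) powr (1 / 8) = q" if "0 < q" for q :: real
  proof -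
    have "q ^ 8 = q powr 8" using that by simp
    then show ?thesis using that by (simp only: powr_powr) simp
  qed
  \<comment> \<open>Origin of the threshold 15.34: it is \<open>13 * 1.18\<close>, where 1.18 is a
    lower bound for the eighth root of 4.\<close>
  have "(1.18 :: real) = (1.18 ^ 8) powr (1 / 8)"
    by (rule root[symmetric]) simp
  also have "\<dots> \<le> real r powr (1 / 8)"
  proof (rule powr_mono2)
    have "1.18 ^ 8 \<le> (4 :: real)" by (simp add: eval_nat_numeral)
    then show "1.18 ^ 8 \<le> real r" using r by linarith
  qed simp_all
  finally have r8: "15.34 \<le> 13 * real r powr (1 / 8)" by simp
  show ?thesis
  proof (cases "15.34 \<le> ?N")
    case True
    have l: "chi_density (real (r - 1) / 2) x \<le> 0.4314 / sqrt (real r - 1)" for x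
    proof -
      have d: "0 < sqrt (real r - 1)" using r by simp
      have "1.4141 \<le> sqrt 2" by (rule real_le_rsqrt) (simp add: power2_eq_square)
      then have "0.61 / sqrt 2 \<le> 0.4314" by (simp add: field_simps)
      then have "0.61 / sqrt 2 / sqrt (real r - 1) \<le> 0.4314 / sqrt (real r - 1)"
        using d by (intro divide_right_mono) auto
      moreover have "chi_density (real (r - 1) / 2) x \<le> 0.61 / sqrt (2 * real (r - 1))"
        using r by (intro chi_density_le) auto
      moreover have "0.61 / sqrt (2 * real (r - 1)) = 0.61 / sqrt 2 / sqrt (real r - 1)"
        using r real_sqrt_mult[of 2 "real (r - 1)"] by (simp add: of_nat_diff)
      ultimately show ?thesis by (simp only:)
    qed
    have "\<bar>?P - measure (chi_square (r - 1)) {..z}\<bar> \<le> (16 * 0.4314 + 6.1) / ?N"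
      using r by (intro friedman_distance_general[OF n _ True N(2) l]) simp
    also have "\<dots> \<le> 13 * real r powr (1 / 8) / ?N" using N r8 by (intro divide_right_mono) auto
    finally show ?thesis .
  next
    case False
    then have "?N \<le> 13 * real r powr (1 / 8)" using r8 by linarith
    then have "1 \<le> 13 * real r powr (1 / 8) / ?N" using N(1) by simp
    then show ?thesis by (rule order_trans[OF friedman_distance_trivial])
  qed
qed

theorem corollary1p6:
  fixes M :: "'a measure"
    and \<pi> :: "nat \<Rightarrow> 'a \<Rightarrow> nat \<Rightarrow> nat"
    and n r :: nat
  assumes "prob_space M"
    and "n \<ge> 1" and "r \<ge> 2"
    and "prob_space.indep_vars M (\<lambda>_. count_space {p. p permutes {1..r}}) \<pi> {1..n}"
    and "\<And>i. i \<in> {1..n} \<Longrightarrow>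
           distr M (count_space {p. p permutes {1..r}}) (\<pi> i)
             = uniform_count_measure {p. p permutes {1..r}}"
  shows "kolmogorov_dist (distr M borel (\<lambda>\<omega>. friedman_F n r (\<lambda>i. \<pi> i \<omega>))) (chi_square (r - 1))
    \<le> (if r = 2 then 0.9496 / sqrt (real n)
       else if r = 3 then
         30 / real n powr (1/4) + 75 / real n powr (1/2) + 120 / real n powr (3/4)
         + 8 / real n powr (5/4) + 36 / real n powr (3/2)
       else
         13 * real r powr (1/8) / real n powr (1/4) * (1 + 1 / real r)
         + 46 / (real r powr (1/4) * real n powr (1/2))
         + 54 * real r powr (3/8) / real n powr (3/4)
         + 3 * real r powr (1/8) / real n powr (5/4)
         + 8 * real r powr (3/4) / real n powr (3/2))"
    (is "_ \<le> ?B")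
  unfolding kolmogorov_dist_def
proof (rule cSUP_least)
  fix z :: real assume "z \<in> {0..}"
  then have z: "0 \<le> z" by simp
  note n = \<open>n \<ge> 1\<close>
  let ?P = "family_avg r {1..n} (\<lambda>x. if friedman_F n r x \<le> z then 1 else 0)"
  have cdf: "measure (distr M borel (\<lambda>\<omega>. friedman_F n r (\<lambda>i. \<pi> i \<omega>))) {..z} = ?P"
    using assms by (intro friedman_cdf_eq_family_avg)
  consider "r = 2" | "r = 3" | "4 \<le> r" using \<open>r \<ge> 2\<close> by linarith
  then have "\<bar>?P - measure (chi_square (r - 1)) {..z}\<bar> \<le> ?B"
  proof cases
    case 1
    then show ?thesis using friedman_distance_2[OF n z] by simp
  next
    case 2
    have "\<bar>?P - measure (chi_square (r - 1)) {..z}\<bar> \<le> 30 / real n powr (1 / 4)"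
      using friedman_distance_3[OF n, of z] unfolding 2 .
    \<comment> \<open>The leading term already bounds the distance; the other terms are nonnegative
      and are added on.\<close>
    moreover have "0 \<le> 75 / real n powr (1/2)" "0 \<le> 120 / real n powr (3/4)"
      "0 \<le> 8 / real n powr (5/4)" "0 \<le> 36 / real n powr (3/2)" by simp_all
    ultimately have "\<bar>?P - measure (chi_square (r - 1)) {..z}\<bar>
      \<le> 30 / real n powr (1/4) + 75 / real n powr (1/2) + 120 / real n powr (3/4)
         + 8 / real n powr (5/4) + 36 / real n powr (3/2)" by linarith
    also have "\<dots> = ?B" using 2 by simp
    finally show ?thesis .
  next
    case 3
    have "\<bar>?P - measure (chi_square (r - 1)) {..z}\<bar> \<le> 13 * real r powr (1 / 8) / real n powr (1 / 4)"
      by (rule friedman_distance_ge_4[OF n 3])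
    also have "\<dots> \<le> 13 * real r powr (1/8) / real n powr (1/4) * (1 + 1 / real r)"
      by (subst mult_1_right[symmetric], rule mult_left_mono) simp_all
    finally have "\<bar>?P - measure (chi_square (r - 1)) {..z}\<bar> \<le> \<dots>" .
    moreover have "0 \<le> 46 / (real r powr (1/4) * real n powr (1/2))" "0 \<le> 54 * real r powr (3/8) / real n powr (3/4)"
      "0 \<le> 3 * real r powr (1/8) / real n powr (5/4)" "0 \<le> 8 * real r powr (3/4) / real n powr (3/2)"
      by simp_all
    ultimately have "\<bar>?P - measure (chi_square (r - 1)) {..z}\<bar>
      \<le> 13 * real r powr (1/8) / real n powr (1/4) * (1 + 1 / real r)
         + 46 / (real r powr (1/4) * real n powr (1/2))
         + 54 * real r powr (3/8) / real n powr (3/4)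
         + 3 * real r powr (1/8) / real n powr (5/4)
         + 8 * real r powr (3/4) / real n powr (3/2)" by linarith
    also have "\<dots> = ?B" using 3 by simp
    finally show ?thesis .
  qed
  then show "\<bar>measure (distr M borel (\<lambda>\<omega>. friedman_F n r (\<lambda>i. \<pi> i \<omega>))) {..z} - measure (chi_square (r - 1)) {..z}\<bar> \<le> ?B"
    unfolding cdf .
qed simp

end
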